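(* Let $\Omega\subset\mathbb{R}^n$ ($n\ge2$) be a bounded domain, and let $u=u(t,x)=(u^1,\dots,u^n)$ be a classical solution of $$-u^i_{tt}+C^{kl}_{ij}\,u^j_{kl}+f_i(u)=0\quad\text{in }\mathbb{R}\times\Omega,\qquad i=1,\dots,n,$$ with the homogeneous Dirichlet boundary condition $u=0$ on $\mathbb{R}\times\partial\Omega$, where $f_i=\partial F/\partial u^i$ and $F(0)=0$. Let $$E(u)=\frac12\left(C^{kl}_{ij}\,u^i_k\,u^j_l+u^i_t\,u^i_t\right)-F(u)$$ be the energy density. Then, for every $t\in\mathbb{R}$, $$\frac{d}{dt}\int_\Omega\left[t\,E(u)+u^i_t\,u^i_k\,x^k+\frac{n-1}{2}\,u^i u^i_t\right]dx=\int_\Omega\left[\frac{n-1}{2}\,u^kf_k(u)-(n+1)F(u)\right]dx$$ $$\qquad+\int_{\partial\Omega}\left[\frac12\left(C^{kl}_{ij}\,u^i_k\,u^j_l+\frac12\,u^i_t\,u^i_t\right)(x,\nu)+t\,C^{kl}_{ij}\,u^i_t\,u^j_l\,\nu_k\right]ds.$$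
   Context: Summation over repeated indices, running from $1$ to $n$, is understood. Subscripts on $u$ denote partial derivatives: $u^k_i=\partial u^k/\partial x_i$, $u^k_t=\partial u^k/\partial t$, $u^k_{ij}=\partial^2u^k/\partial x_i\partial x_j$, etc.; $x^k=x_k$ are the coordinates of $x$. The boundary $\partial\Omega$ is (piecewise) smooth with outward unit normal $\nu=(\nu_1,\dots,\nu_n)$, and $(\cdot,\cdot)$ is the Euclidean scalar product. The elastic moduli $C^{kl}_{ij}$ are real constants with the symmetries $C^{kl}_{ij}=C^{il}_{kj}=C^{kj}_{il}=C^{lk}_{ji}$ and satisfying $C^{kl}_{ij}a^i_ka^j_l\ge0$ for every real matrix $(a^p_q)$. The potential $F:\mathbb{R}^n\to\mathbb{R}$ is sufficiently smooth (at least $C^1$) with $F(0)=0$. All functions are assumed smooth enough that every derivative written exists in the classical sense; for solutions this is taken to mean $u\in C^2(\mathbb{R}\times\overline\Omega;\mathbb{R}^n)$. *)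

theory Defs
  imports "HOL-Analysis.Analysis"
begin

definition partial_deriv :: "'n::finite \<Rightarrow> (real^'n \<Rightarrow> 'b::real_normed_vector) \<Rightarrow> real^'n \<Rightarrow> 'b" where
  "partial_deriv k g x = vector_derivative (\<lambda>s. g (x + s *\<^sub>R axis k 1)) (at 0)"

definition grad :: "(real^'n::finite \<Rightarrow> real) \<Rightarrow> real^'n \<Rightarrow> real^'n" where
  "grad g x = (\<chi> k. partial_deriv k g x)"

definition C1 :: "(real^'n::finite \<Rightarrow> real) \<Rightarrow> bool" where
  "C1 g \<longleftrightarrow> (\<forall>x. g differentiable (at x)) \<and> continuous_on UNIV (grad g)"


subsection \<open>Functions of time and space that are smooth up to the boundary\<close>

text \<open>
  A function lies in \<open>C\<^sup>1(\<real> \<times> closure \<Omega>)\<close> if it is continuously differentiable in \<open>\<real> \<times> \<Omega>\<close> and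
  if the function and its first derivatives extend continuously to \<open>\<real> \<times> closure \<Omega>\<close>. The boundary
  values of a derivative are those of this (unique) extension.
\<close>

definition extend_to_boundary ::
    "(real^'n::finite) set \<Rightarrow> (real \<Rightarrow> real^'n \<Rightarrow> real^'n) \<Rightarrow> real \<Rightarrow> real^'n \<Rightarrow> real^'n" where
  "extend_to_boundary \<Omega> g t x =
     (if x \<in> \<Omega> then g t x else Lim (at (t, x) within UNIV \<times> \<Omega>) (\<lambda>(s, y). g s y))"

definition deriv_t ::
    "(real^'n::finite) set \<Rightarrow> (real \<Rightarrow> real^'n \<Rightarrow> real^'n) \<Rightarrow> real \<Rightarrow> real^'n \<Rightarrow> real^'n" where
  "deriv_t \<Omega> v = extend_to_boundary \<Omega> (\<lambda>t x. vector_derivative (\<lambda>s. v s x) (at t))"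

definition deriv_x ::
    "(real^'n::finite) set \<Rightarrow> 'n \<Rightarrow> (real \<Rightarrow> real^'n \<Rightarrow> real^'n) \<Rightarrow> real \<Rightarrow> real^'n \<Rightarrow> real^'n" where
  "deriv_x \<Omega> k v = extend_to_boundary \<Omega> (\<lambda>t x. partial_deriv k (v t) x)"

definition C1_up_to_boundary :: "(real^'n::finite) set \<Rightarrow> (real \<Rightarrow> real^'n \<Rightarrow> real^'n) \<Rightarrow> bool" where
  "C1_up_to_boundary \<Omega> v \<longleftrightarrow>
     (\<forall>t. \<forall>x\<in>\<Omega>. (\<lambda>(s, y). v s y) differentiable (at (t, x))) \<and>
     continuous_on (UNIV \<times> closure \<Omega>) (\<lambda>(t, x). v t x) \<and>
     continuous_on (UNIV \<times> closure \<Omega>) (\<lambda>(t, x). deriv_t \<Omega> v t x) \<and>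
     (\<forall>k. continuous_on (UNIV \<times> closure \<Omega>) (\<lambda>(t, x). deriv_x \<Omega> k v t x))"

definition C2_up_to_boundary :: "(real^'n::finite) set \<Rightarrow> (real \<Rightarrow> real^'n \<Rightarrow> real^'n) \<Rightarrow> bool" where
  "C2_up_to_boundary \<Omega> u \<longleftrightarrow>
     C1_up_to_boundary \<Omega> u \<and> C1_up_to_boundary \<Omega> (deriv_t \<Omega> u) \<and>
     (\<forall>k. C1_up_to_boundary \<Omega> (deriv_x \<Omega> k u))"


subsection \<open>Piecewise smooth boundaries, outward normal and surface measure\<close>

text \<open>
  Inside the open set \<open>U\<close>, and up to relabelling and reorienting the coordinate axes, \<open>\<Omega>\<close> is the
  region below the graph of a \<open>C\<^sup>1\<close> function \<open>\<gamma>\<close> of the coordinates other than \<open>x\<^sub>m\<close> (\<open>s = 1\<close>), or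
  the region above it (\<open>s = -1\<close>). Then \<open>frontier \<Omega> \<inter> U\<close> is the part of the graph lying in \<open>U\<close>.
  That \<open>\<gamma>\<close> is defined globally is no restriction: shrink \<open>U\<close> and cut \<open>\<gamma>\<close> off.
\<close>

definition boundary_chart ::
    "(real^'n::finite) set \<Rightarrow> (real^'n) set \<Rightarrow> 'n \<Rightarrow> real \<Rightarrow> (real^'n \<Rightarrow> real) \<Rightarrow> bool" where
  "boundary_chart \<Omega> U m s \<gamma> \<longleftrightarrow>
     open U \<and> (s = 1 \<or> s = - 1) \<and>
     C1 \<gamma> \<and> (\<forall>x h. \<gamma> (x + h *\<^sub>R axis m 1) = \<gamma> x) \<and>
     \<Omega> \<inter> U = {x \<in> U. s * (x $ m - \<gamma> x) < 0}"

definition regular_boundary :: "(real^'n::finite) set \<Rightarrow> (real^'n) set" where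
  "regular_boundary \<Omega> = {x \<in> frontier \<Omega>. \<exists>U m s \<gamma>. x \<in> U \<and> boundary_chart \<Omega> U m s \<gamma>}"

text \<open>
  The outward unit normal does not depend on the chart; it has no meaning off the regular boundary.
\<close>

definition outward_normal :: "(real^'n::finite) set \<Rightarrow> real^'n \<Rightarrow> real^'n" where
  "outward_normal \<Omega> x =
     (THE \<nu>. \<exists>U m s \<gamma>. x \<in> U \<and> x \<in> frontier \<Omega> \<and> boundary_chart \<Omega> U m s \<gamma> \<and>
        \<nu> = (s / sqrt (1 + (norm (grad \<gamma> x))\<^sup>2)) *\<^sub>R (axis m 1 - grad \<gamma> x))"

text \<open>
  The area \<open>\<integral> sqrt (1 + |\<nabla>\<gamma>|\<^sup>2) dy\<close> of the part of the graph of \<open>\<gamma>\<close> lying in \<open>A\<close>, where \<open>y\<close> ranges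
  over the coordinates other than \<open>x\<^sub>m\<close>, with \<open>(n-1)\<close>-dimensional Lebesgue measure.
\<close>

definition graph_area :: "'n::finite \<Rightarrow> (real^'n \<Rightarrow> real) \<Rightarrow> (real^'n) set \<Rightarrow> ennreal" where
  "graph_area m \<gamma> A =
     (\<integral>\<^sup>+ y. (let p = (\<chi> k. if k = m then 0 else y k) in
         ennreal (sqrt (1 + (norm (grad \<gamma> p))\<^sup>2)) * indicator A (p + \<gamma> p *\<^sub>R axis m 1))
       \<partial>(\<Pi>\<^sub>M k\<in>UNIV - {m}. lborel))"

text \<open>
  The surface measure is the unique Borel measure that is carried by the regular boundary and is
  given by the area formula in every chart.
\<close>

definition surface_measure :: "(real^'n::finite) set \<Rightarrow> (real^'n) measure" where
  "surface_measure \<Omega> =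
     (THE \<sigma>. sets \<sigma> = sets borel \<and> emeasure \<sigma> (- regular_boundary \<Omega>) = 0 \<and>
        (\<forall>U m s \<gamma> A. boundary_chart \<Omega> U m s \<gamma> \<and> A \<in> sets borel \<and> A \<subseteq> U \<longrightarrow>
           emeasure \<sigma> A = graph_area m \<gamma> A))"

text \<open>Sets of \<open>(n-1)\<close>-dimensional Hausdorff measure zero.\<close>

definition codim1_null :: "(real^'n::finite) set \<Rightarrow> bool" where
  "codim1_null S \<longleftrightarrow>
     (\<forall>e>0. \<exists>(c :: nat \<Rightarrow> real^'n) r. (\<forall>j. r j > 0) \<and> S \<subseteq> (\<Union>j. ball (c j) (r j)) \<and>
        summable (\<lambda>j. r j ^ (CARD('n) - 1)) \<and> (\<Sum>j. r j ^ (CARD('n) - 1)) < e)"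

text \<open>
  The boundary may have edges, corners and the like, as long as they form a set of
  \<open>(n-1)\<close>-dimensional measure zero. The area condition holds automatically if there are none,
  the boundary being compact.
\<close>

definition piecewise_smooth_boundary :: "(real^'n::finite) set \<Rightarrow> bool" where
  "piecewise_smooth_boundary \<Omega> \<longleftrightarrow>
     codim1_null (frontier \<Omega> - regular_boundary \<Omega>) \<and>
     emeasure (surface_measure \<Omega>) (regular_boundary \<Omega>) < \<infinity>"


subsection \<open>Elastic moduli and energy\<close>

text \<open>\<open>C k l i j\<close> stands for the modulus with upper indices \<open>k, l\<close> and lower indices \<open>i, j\<close>.\<close>

definition elastic_moduli :: "('n::finite \<Rightarrow> 'n \<Rightarrow> 'n \<Rightarrow> 'n \<Rightarrow> real) \<Rightarrow> bool" where
  "elastic_moduli C \<longleftrightarrow>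
     (\<forall>k l i j. C k l i j = C i l k j \<and> C k l i j = C k j i l \<and> C k l i j = C l k j i) \<and>
     (\<forall>a. (\<Sum>i\<in>UNIV. \<Sum>j\<in>UNIV. \<Sum>k\<in>UNIV. \<Sum>l\<in>UNIV. C k l i j * a i k * a j l) \<ge> 0)"

definition elastic_form :: "(real^'n::finite) set \<Rightarrow> ('n \<Rightarrow> 'n \<Rightarrow> 'n \<Rightarrow> 'n \<Rightarrow> real) \<Rightarrow>
    (real \<Rightarrow> real^'n \<Rightarrow> real^'n) \<Rightarrow> real \<Rightarrow> real^'n \<Rightarrow> real" where
  "elastic_form \<Omega> C u t x =
     (\<Sum>i\<in>UNIV. \<Sum>j\<in>UNIV. \<Sum>k\<in>UNIV. \<Sum>l\<in>UNIV.
        C k l i j * deriv_x \<Omega> k u t x $ i * deriv_x \<Omega> l u t x $ j)"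

definition energy_density :: "(real^'n::finite) set \<Rightarrow> ('n \<Rightarrow> 'n \<Rightarrow> 'n \<Rightarrow> 'n \<Rightarrow> real) \<Rightarrow>
    (real^'n \<Rightarrow> real) \<Rightarrow> (real \<Rightarrow> real^'n \<Rightarrow> real^'n) \<Rightarrow> real \<Rightarrow> real^'n \<Rightarrow> real" where
  "energy_density \<Omega> C F u t x =
     1/2 * (elastic_form \<Omega> C u t x + (\<Sum>i\<in>UNIV. deriv_t \<Omega> u t x $ i * deriv_t \<Omega> u t x $ i))
     - F (u t x)"

end

theory Submission
  imports Defs
begin

text \<open>
  By the equation, the time derivative of the integrand is the bulk density of the theorem plus the
  divergence of a flux \<open>Y\<close>, so the theorem is the Leibniz rule together with the Gauss-Green formula
  for \<open>Y\<close>. On the boundary \<open>u\<close> and \<open>u\<^sub>t\<close> vanish and the gradient of each \<open>u\<^sup>i\<close> is parallel to \<open>\<nu>\<close>;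
  this reduces \<open>(Y, \<nu>)\<close> to half the elastic form times \<open>(x, \<nu>)\<close>.

  The Gauss-Green formula in a chart follows from the fundamental theorem of calculus on lines after
  a shear that flattens the graph. Its left-hand side does not depend on the chart, so the graph areas
  of two charts agree where the charts overlap, and they glue to the surface measure. The singular
  part of the boundary is removed by cutoff functions that vanish near it: if it is covered by
  balls of radii \<open>r\<^sub>j\<close>, the gradient of the cutoff has \<open>L\<^sup>1\<close> norm at most a constant times \<open>\<Sum>\<^sub>j r\<^sub>j\<^sup>n\<^sup>-\<^sup>1\<close>.
\<close>

subsection \<open>Slicing Lebesgue measure along a coordinate direction\<close>

text \<open>\<open>graph_area\<close> integrates over the coordinates other than
  \<open>x $ m\<close>, in a product of function type. The proof stays with \<open>lborel\<close> on
  \<open>real^'n\<close>: a function that is constant along e_m is integrated over a slab of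
  thickness one, so that slicing, shears and pushforwards concern a single measure, and the product
  measure is met only when \<open>graph_area\<close> is identified. Comparing the areas of two
  charts directly would need a change of variables between the graphs. The flux avoids it: it fixes
  the integral of \<nu>_m g over the boundary, and in a chart of direction m the weight s \<nu>_m is
  strictly positive, so the area is recovered by division. Hence Gauss-Green is proved chart by
  chart before \<open>surface_measure\<close>, a definite description, is known to denote anything.
  The boundary values of the derivatives of u are limits from inside; that u_t vanishes on the
  boundary, or that gradients are normal to it, cannot be had by differentiating u = 0 there.
  Boundary curves are approximated by curves in \<Omega> instead.\<close>

definition bounded_borel :: "('a::euclidean_space \<Rightarrow> real) \<Rightarrow> bool" where
  "bounded_borel f \<longleftrightarrow> f \<in> borel_measurable borel \<and> bounded (range f) \<and> bounded {x. f x \<noteq> 0}"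

lemma bounded_borelI:
  assumes "f \<in> borel_measurable borel" "\<And>x. \<bar>f x\<bar> \<le> B" "\<And>x. f x \<noteq> 0 \<Longrightarrow> norm x \<le> R"
  shows "bounded_borel f"
  unfolding bounded_borel_def bounded_iff using assms by auto

lemma bounded_borelE:
  assumes "bounded_borel f"
  obtains B R where "\<And>x. \<bar>f x\<bar> \<le> B" "\<And>x. f x \<noteq> 0 \<Longrightarrow> norm x \<le> R" "B > 0" "R > 0"
proof -
  obtain B where B: "\<And>x. \<bar>f x\<bar> \<le> B" using assms unfolding bounded_borel_def bounded_iff by auto
  obtain R where R: "\<And>x. f x \<noteq> 0 \<Longrightarrow> norm x \<le> R" using assms unfolding bounded_borel_def bounded_iff by auto
  show ?thesis
    by (rule that[of "max B 1" "max R 1"]) (use B R in \<open>auto simp: le_max_iff_disj\<close>)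
qed

lemma bounded_borel_measurable [measurable_dest]: "bounded_borel f \<Longrightarrow> f \<in> borel_measurable borel"
  by (simp add: bounded_borel_def)

text \<open>The class is chosen for this: bounded with bounded support settles integrability at
  once, on the whole space, on lines and on products, so the uses of Fubini below reduce to
  exhibiting a bound and a radius.\<close>

lemma bounded_borel_integrable:
  fixes f :: "'a::euclidean_space \<Rightarrow> real"
  assumes "bounded_borel f" shows "integrable lborel f"
proof -
  from assms obtain B R where *: "\<And>x. \<bar>f x\<bar> \<le> B" "\<And>x. f x \<noteq> 0 \<Longrightarrow> norm x \<le> R" "B > 0" by (elim bounded_borelE) blast
  have "integrable lborel (\<lambda>x. B * indicator (cball (0::'a) R) x :: real)"
    by (intro integrable_mult_right integrable_real_indicator)
       (use emeasure_lborel_cball_finite[of "0::'a" R] in \<open>auto simp: less_top\<close>)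
  then show ?thesis
    by (rule Bochner_Integration.integrable_bound)
       (use * assms in \<open>auto simp: indicator_def bounded_borel_measurable\<close>)
qed

lemma bounded_borel_add:
  assumes "bounded_borel f" "bounded_borel g" shows "bounded_borel (\<lambda>x. f x + g x)"
proof -
  from assms(1) obtain B R where f: "\<And>x. \<bar>f x\<bar> \<le> B" "\<And>x. f x \<noteq> 0 \<Longrightarrow> norm x \<le> R" by (elim bounded_borelE) blast
  from assms(2) obtain B' R' where g: "\<And>x. \<bar>g x\<bar> \<le> B'" "\<And>x. g x \<noteq> 0 \<Longrightarrow> norm x \<le> R'" by (elim bounded_borelE) blast
  note [measurable] = bounded_borel_measurable[OF assms(1)] bounded_borel_measurable[OF assms(2)]
  show ?thesis
  proof (rule bounded_borelI[where B="B+B'" and R="max R R'"])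
    show "\<bar>f x + g x\<bar> \<le> B + B'" for x using f(1)[of x] g(1)[of x] by linarith
    show "norm x \<le> max R R'" if "f x + g x \<noteq> 0" for x
      using that f(2)[of x] g(2)[of x] by (metis add.right_neutral le_max_iff_disj)
  qed measurable
qed

lemma continuous_bounded_cball:
  fixes h :: "'a::euclidean_space \<Rightarrow> real"
  assumes "continuous_on UNIV h"
  obtains b where "\<And>x. norm x \<le> R \<Longrightarrow> \<bar>h x\<bar> \<le> b"
proof -
  have "bounded (h ` cball 0 R)"
    by (intro compact_imp_bounded compact_continuous_image continuous_on_subset[OF assms]) auto
  then show ?thesis using that unfolding bounded_iff by (metis imageI mem_cball_0 real_norm_def)
qed

text \<open>The continuous factor may be unbounded: it is estimated on the compact ball that
  contains the support of \<open>f\<close>.\<close>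

lemma bounded_borel_continuous_mult:
  assumes "bounded_borel f" "continuous_on UNIV h" shows "bounded_borel (\<lambda>x. h x * f x)"
proof -
  from assms(1) obtain B R where f: "\<And>x. \<bar>f x\<bar> \<le> B" "\<And>x. f x \<noteq> 0 \<Longrightarrow> norm x \<le> R" "B > 0" by (elim bounded_borelE) blast
  obtain b where b: "\<And>x. norm x \<le> R \<Longrightarrow> \<bar>h x\<bar> \<le> b" by (rule continuous_bounded_cball[OF assms(2)]) blast
  note [measurable] = bounded_borel_measurable[OF assms(1)] borel_measurable_continuous_onI[OF assms(2)]
  show ?thesis
  proof (rule bounded_borelI[where B="\<bar>b\<bar> * B" and R=R])
    show "\<bar>h x * f x\<bar> \<le> \<bar>b\<bar> * B" for x
    proof (cases "f x = 0")
      case False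
      then have "\<bar>h x\<bar> \<le> \<bar>b\<bar>" using b[of x] f(2) by fastforce
      then show ?thesis unfolding abs_mult using f by (intro mult_mono) auto
    qed (use f(3) in auto)
    show "norm x \<le> R" if "h x * f x \<noteq> 0" for x using that f(2) by auto
  qed measurable
qed

lemma norm_le_line:
  fixes x :: "real^'n::finite"
  shows "\<bar>z\<bar> \<le> norm (x + z *\<^sub>R axis m 1) + norm x" "norm x \<le> norm (x + z *\<^sub>R axis m 1) + \<bar>z\<bar>"
proof -
  have "norm (z *\<^sub>R axis m (1::real)) \<le> norm (x + z *\<^sub>R axis m 1) + norm x"
    by (metis add_diff_cancel_left' norm_triangle_ineq4)
  then show "\<bar>z\<bar> \<le> norm (x + z *\<^sub>R axis m 1) + norm x" by simp
  have "norm x \<le> norm (x + z *\<^sub>R axis m 1) + norm (z *\<^sub>R axis m (1::real))"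
    by (metis add_diff_cancel_right' norm_triangle_ineq4)
  then show "norm x \<le> norm (x + z *\<^sub>R axis m 1) + \<bar>z\<bar>" by simp
qed

lemma bounded_support_line:
  fixes h :: "real^'n::finite \<Rightarrow> real"
  assumes "bounded {x. h x \<noteq> 0}"
  obtains R where "\<And>z. norm z \<ge> R \<Longrightarrow> h (x + z *\<^sub>R axis m 1) = 0"
proof -
  obtain R where R: "\<And>x. h x \<noteq> 0 \<Longrightarrow> norm x \<le> R" using assms unfolding bounded_iff by auto
  show ?thesis
  proof (rule that[of "R + norm x + 1"], rule ccontr)
    fix z :: real assume "R + norm x + 1 \<le> norm z" "h (x + z *\<^sub>R axis m 1) \<noteq> 0"
    then show False using R[of "x + z *\<^sub>R axis m 1"] norm_le_line(1)[of z x m] by simp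
  qed
qed

lemma bounded_borel_line:
  fixes f :: "real^'n::finite \<Rightarrow> real"
  assumes "bounded_borel f" shows "bounded_borel (\<lambda>z. f (x + z *\<^sub>R axis m 1))"
proof -
  from assms obtain B R where *: "\<And>x. \<bar>f x\<bar> \<le> B" "\<And>x. f x \<noteq> 0 \<Longrightarrow> norm x \<le> R" by (elim bounded_borelE) blast
  note [measurable] = bounded_borel_measurable[OF assms]
  show ?thesis
  proof (rule bounded_borelI[where B=B and R="R + norm x"])
    show "norm z \<le> R + norm x" if "f (x + z *\<^sub>R axis m 1) \<noteq> 0" for z
      using *(2)[OF that] norm_le_line(1)[of z x m] by simp
  qed (use * in auto)
qed

text \<open>Its thickness is one, so the integral over \<open>slab m\<close> of a function that is
  constant along the m-th axis is its integral over the remaining n - 1 coordinates.\<close>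

definition slab :: "'n::finite \<Rightarrow> (real^'n) set" where
  "slab m = {x. 0 \<le> x $ m \<and> x $ m \<le> 1}"

lemma slab_borel [measurable]: "slab m \<in> sets borel"
  unfolding slab_def by measurable

lemma lborel_translate:
  fixes f :: "'a::euclidean_space \<Rightarrow> real" assumes [measurable]: "f \<in> borel_measurable borel"
  shows "(\<integral>x. f (x + c) \<partial>lborel) = (\<integral>x. f x \<partial>lborel)"
proof -
  have "(\<integral>x. f x \<partial>lborel) = (\<integral>x. f x \<partial>distr lborel borel ((+) c))"
    by (simp add: lborel_distr_plus)
  also have "\<dots> = (\<integral>x. f (c + x) \<partial>lborel)" by (subst integral_distr) auto
  finally show ?thesis by (simp add: add.commute)
qed

text \<open>Translating \<open>x\<close> by \<open>- z e\<^sub>m\<close> inside the double integral moves \<open>z\<close> into the slab condition, and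
  \<open>{z. x - z e\<^sub>m \<in> slab m}\<close> has length one.\<close>

lemma slab_fubini:
  fixes f :: "real^'n::finite \<Rightarrow> real"
  assumes "bounded_borel f"
  shows "(\<integral>x. f x \<partial>lborel) = (\<integral>x. indicator (slab m) x * (\<integral>z. f (x + z *\<^sub>R axis m 1) \<partial>lborel) \<partial>lborel)"
proof -
  note [measurable] = bounded_borel_measurable[OF assms]
  let ?e = "axis m (1::real) :: real^'n"
  from assms obtain B R where *: "\<And>x. \<bar>f x\<bar> \<le> B" "\<And>x. f x \<noteq> 0 \<Longrightarrow> norm x \<le> R" "B > 0" "R > 0" by (elim bounded_borelE) blast
  define h where "h = (\<lambda>(x::real^'n, z::real). indicator (slab m) x * f (x + z *\<^sub>R ?e))"
  have [measurable]: "h \<in> borel_measurable (lborel \<Otimes>\<^sub>M lborel)" unfolding h_def by measurable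
  have hB: "bounded_borel h"
  \<comment> \<open>If \<open>h (x, z)\<close> is nonzero, then |x_m + z| \<le> R with 0 \<le> x_m
    \<le> 1, hence |z| \<le> R + 1 and |x| \<le> R + (R + 1); the norm of the pair is at most their
    sum.\<close>
  proof (rule bounded_borelI[where B=B and R="(R+(R+1)) + (R+1)"])
    show "h \<in> borel_measurable borel"
      unfolding borel_prod[symmetric] h_def by measurable
    show "\<bar>h p\<bar> \<le> B" for p using * less_imp_le by (auto simp: h_def indicator_def split: prod.split)
    fix p assume "h p \<noteq> 0"
    then obtain x z where p: "p = (x,z)" "x \<in> slab m" "f (x + z *\<^sub>R ?e) \<noteq> 0"
      by (cases p) (auto simp: h_def indicator_def split: if_splits)
    then have 1: "norm (x + z *\<^sub>R ?e) \<le> R" using * by auto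
    have "\<bar>(x + z *\<^sub>R ?e) $ m\<bar> \<le> R" using 1 component_le_norm_cart order_trans by blast
    then have z: "\<bar>z\<bar> \<le> R + 1" using p(2) by (auto simp: slab_def axis_def)
    have "norm x \<le> R + (R+1)" using 1 z norm_le_line(2)[of x z m] by simp
    moreover have "norm p \<le> norm x + norm z" using norm_Pair_le[of x z] p by auto
    ultimately show "norm p \<le> (R+(R+1)) + (R+1)" using z by simp
  qed
  have hi: "integrable (lborel \<Otimes>\<^sub>M lborel) h"
    using bounded_borel_integrable[OF hB] by (simp add: lborel_prod)
  have len: "(\<integral>z. indicator (slab m) (x - z *\<^sub>R ?e) \<partial>lborel) = (1::real)" for x :: "real^'n"
  proof -
    have "(\<integral>z. indicator (slab m) (x - z *\<^sub>R ?e) \<partial>lborel) = (\<integral>z. indicator {x$m - 1..x$m} z \<partial>lborel :: real)"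
      by (intro Bochner_Integration.integral_cong) (auto simp: slab_def indicator_def axis_def)
    then show ?thesis by simp
  qed
  have "(\<integral>x. indicator (slab m) x * (\<integral>z. f (x + z *\<^sub>R ?e) \<partial>lborel) \<partial>lborel) = (\<integral>x. (\<integral>z. h (x,z) \<partial>lborel) \<partial>lborel)"
    unfolding h_def by simp
  also have "\<dots> = (\<integral>z. (\<integral>x. h (x,z) \<partial>lborel) \<partial>lborel)"
    using lborel_pair.Fubini_integral[of "\<lambda>x z. h (x,z)"] hi by (simp add: case_prod_beta')
  also have "\<dots> = (\<integral>z. (\<integral>x. indicator (slab m) (x - z *\<^sub>R ?e) * f x \<partial>lborel) \<partial>lborel)"
  proof (rule Bochner_Integration.integral_cong[OF refl])
    fix z :: real
    have "(\<integral>x. (\<lambda>y. indicator (slab m) (y - z *\<^sub>R ?e) * f y) (x + z *\<^sub>R ?e) \<partial>lborel) =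
        (\<integral>x. indicator (slab m) (x - z *\<^sub>R ?e) * f x \<partial>lborel)"
      by (rule lborel_translate) measurable
    then show "(\<integral>x. h (x,z) \<partial>lborel) = (\<integral>x. indicator (slab m) (x - z *\<^sub>R ?e) * f x \<partial>lborel)"
      by (simp add: h_def)
  qed
  also have "\<dots> = (\<integral>x. (\<integral>z. indicator (slab m) (x - z *\<^sub>R ?e) * f x \<partial>lborel) \<partial>lborel)"
  proof -
    define h2 where "h2 = (\<lambda>(x::real^'n, z::real). indicator (slab m) (x - z *\<^sub>R ?e) * f x)"
    have "bounded_borel h2"
    proof (rule bounded_borelI[where B=B and R="R + (R+1)"])
      show "h2 \<in> borel_measurable borel"
        unfolding borel_prod[symmetric] h2_def by measurable
      show "\<bar>h2 p\<bar> \<le> B" for p using * less_imp_le by (auto simp: h2_def indicator_def split: prod.split)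
      fix p assume "h2 p \<noteq> 0"
      then obtain x z where p: "p = (x,z)" "x - z *\<^sub>R ?e \<in> slab m" "f x \<noteq> 0"
        by (cases p) (auto simp: h2_def indicator_def split: if_splits)
      then have 1: "norm x \<le> R" using * by auto
      have "\<bar>x $ m\<bar> \<le> R" using 1 component_le_norm_cart order_trans by blast
      then have z: "\<bar>z\<bar> \<le> R + 1" using p(2) by (auto simp: slab_def axis_def)
      moreover have "norm p \<le> norm x + norm z" using norm_Pair_le[of x z] p by auto
      ultimately show "norm p \<le> R + (R+1)" using 1 by simp
    qed
    from bounded_borel_integrable[OF this] have "integrable (lborel \<Otimes>\<^sub>M lborel) h2" by (simp add: lborel_prod)
    then show ?thesis
      using lborel_pair.Fubini_integral[of "\<lambda>x z. h2 (x,z)"] by (simp add: case_prod_beta' h2_def)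
  qed
  also have "\<dots> = (\<integral>x. f x \<partial>lborel)" using len by simp
  finally show ?thesis by simp
qed

text \<open>The factor \<open>s\<close> selects the half-line below or above \<open>c\<close>. The
  far end contributes nothing because \<open>f\<close> vanishes there, and \<open>s\<close> is the
  sign with which the endpoint \<open>c\<close> enters. Differentiability is asked inside the
  half-line and continuity up to \<open>c\<close>, which is what a function smooth up to the
  boundary offers.\<close>

lemma integral_line_FTC:
  fixes f f' :: "real \<Rightarrow> real"
  assumes "s = 1 \<or> s = -1"
    and "bounded_borel (\<lambda>z. f' z * indicator {z. s * (z - c) < 0} z)"
    and "\<And>z. s * (z - c) < 0 \<Longrightarrow> (f has_real_derivative f' z) (at z)"
    and "continuous_on {z. s * (z - c) \<le> 0} f" and "\<And>z. norm z \<ge> R \<Longrightarrow> f z = 0"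
  shows "(\<integral>z. f' z * indicator {z. s * (z - c) < 0} z \<partial>lborel) = s * f c"
proof -
  let ?g = "\<lambda>z. f' z * indicator {z. s * (z - c) < 0} z"
  from assms(2) obtain B R' where R': "\<And>z. ?g z \<noteq> 0 \<Longrightarrow> norm z \<le> R'" "R' > 0" by (elim bounded_borelE) blast
  have I: "(?g has_integral integral\<^sup>L lborel ?g) UNIV"
    by (intro has_integral_integral_lborel bounded_borel_integrable assms)
  \<comment> \<open>Beyond \<open>K\<close> both \<open>f\<close> and the integrand vanish, and
    \<open>c\<close> lies strictly between \<open>-K\<close> and \<open>K\<close>.\<close>
  define K where "K = max (max R R') \<bar>c\<bar> + 1"
  have K: "K > R" "K > R'" "-K < c" "c < K" unfolding K_def by auto
  from assms(1) show ?thesis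
  proof
    assume s: "s = 1"
    have "(f' has_integral f c - f (-K)) {-K..c}"
      by (rule fundamental_theorem_of_calculus_interior)
         (use assms(3,4) s K in \<open>auto simp: has_real_derivative_iff_has_vector_derivative[symmetric] elim!: continuous_on_subset\<close>)
    \<comment> \<open>The indicator is zero at \<open>c\<close> itself, a change at a single
      point.\<close>
    then have "(?g has_integral f c - f (-K)) {-K..c}"
      by (rule has_integral_spike_finite[rotated 2, where S="{c}"]) (auto simp: s)
    then have "(?g has_integral f c - f (-K)) UNIV"
    proof (rule has_integral_on_superset)
      fix z assume z: "z \<notin> {-K..c}"
      show "?g z = 0"
      proof (rule ccontr)
        assume "?g z \<noteq> 0" with R' have "norm z \<le> R'" "z < c" by (auto simp: s indicator_def split: if_splits)
        with z K show False by auto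
      qed
    qed simp
    moreover have "f (-K) = 0" using K R' by (intro assms(5)) auto
    ultimately show ?thesis using has_integral_unique[OF I] s by simp
  next
    assume s: "s = -1"
    have "(f' has_integral f K - f c) {c..K}"
      by (rule fundamental_theorem_of_calculus_interior)
         (use assms(3,4) s K in \<open>auto simp: has_real_derivative_iff_has_vector_derivative[symmetric] elim!: continuous_on_subset\<close>)
    then have "(?g has_integral f K - f c) {c..K}"
      by (rule has_integral_spike_finite[rotated 2, where S="{c}"]) (auto simp: s)
    then have "(?g has_integral f K - f c) UNIV"
    proof (rule has_integral_on_superset)
      fix z assume z: "z \<notin> {c..K}"
      show "?g z = 0"
      proof (rule ccontr)
        assume "?g z \<noteq> 0" with R' have "norm z \<le> R'" "z > c" by (auto simp: s indicator_def split: if_splits)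
        with z K show False by auto
      qed
    qed simp
    moreover have "f K = 0" using K R' by (intro assms(5)) auto
    ultimately show ?thesis using has_integral_unique[OF I] s by simp
  qed
qed

lemma integral_line_FTC_UNIV:
  fixes f f' :: "real \<Rightarrow> real"
  assumes "bounded_borel f'" and "\<And>z. (f has_real_derivative f' z) (at z)"
    and "\<And>z. norm z \<ge> R \<Longrightarrow> f z = 0"
  shows "(\<integral>z. f' z \<partial>lborel) = 0"
proof -
  from assms(1) obtain B R' where R': "\<And>z. f' z \<noteq> 0 \<Longrightarrow> norm z \<le> R'" "R' > 0" by (elim bounded_borelE) blast
  define K where "K = max R R' + 1"
  have K: "K > R" "K > R'" unfolding K_def by auto
  have "(f' has_integral f K - f (-K)) {-K..K}"
    by (rule fundamental_theorem_of_calculus)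
       (use assms K R' in \<open>auto simp: has_real_derivative_iff_has_vector_derivative[symmetric] intro: DERIV_subset\<close>)
  then have "(f' has_integral f K - f (-K)) UNIV"
    by (rule has_integral_on_superset) (use R' K in force)+
  moreover have "f K = 0" "f (-K) = 0" using K R' by (auto intro!: assms(3))
  ultimately show ?thesis
    using has_integral_unique[OF has_integral_integral_lborel[OF bounded_borel_integrable[OF assms(1)]]] by simp
qed

text \<open>Only the derivative along the k-th axis is required, at every point. This admits
  functions that jump across a hyperplane parallel to that axis, such as the sheared function
  extended by zero in \<open>graph_gauss_green\<close>.\<close>

lemma integral_partial_UNIV:
  fixes h h' :: "real^'n::finite \<Rightarrow> real"
  assumes "bounded_borel h'" "bounded {x. h x \<noteq> 0}"
    and "\<And>x. ((\<lambda>z. h (x + z *\<^sub>R axis k 1)) has_real_derivative h' x) (at 0)"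
  shows "(\<integral>x. h' x \<partial>lborel) = 0"
proof -
  let ?e = "axis k (1::real) :: real^'n"
  have "(\<integral>z. h' (x + z *\<^sub>R ?e) \<partial>lborel) = 0" for x
  proof -
    obtain R where R: "\<And>z. norm z \<ge> R \<Longrightarrow> h (x + z *\<^sub>R ?e) = 0" by (rule bounded_support_line[OF assms(2)]) blast
    show ?thesis
    proof (rule integral_line_FTC_UNIV[where f="\<lambda>z. h (x + z *\<^sub>R ?e)" and R=R])
      show "bounded_borel (\<lambda>z. h' (x + z *\<^sub>R ?e))" by (rule bounded_borel_line[OF assms(1)])
      fix z :: real
      have "((\<lambda>w. h ((x + z *\<^sub>R ?e) + w *\<^sub>R ?e)) has_real_derivative h' (x + z *\<^sub>R ?e)) (at (z - z))"
        using assms(3)[of "x + z *\<^sub>R ?e"] by simp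
      then have "((\<lambda>w. h ((x + z *\<^sub>R ?e) + (w - z) *\<^sub>R ?e)) has_real_derivative h' (x + z *\<^sub>R ?e) * 1) (at z)"
        by (rule DERIV_chain2[where g="\<lambda>w. w - z"]) (auto intro!: derivative_eq_intros)
      then show "((\<lambda>w. h (x + w *\<^sub>R ?e)) has_real_derivative h' (x + z *\<^sub>R ?e)) (at z)"
        by (simp add: algebra_simps)
    qed (rule R)
  qed
  then show ?thesis by (subst slab_fubini[OF assms(1), of k]) simp
qed

subsection \<open>Continuously differentiable functions and cutoffs\<close>

lemma has_derivative_partial:
  fixes g :: "real^'n::finite \<Rightarrow> 'b::real_normed_vector"
  assumes "(g has_derivative D) (at x)"
  shows "((\<lambda>s. g (x + s *\<^sub>R axis k 1)) has_vector_derivative D (axis k 1)) (at 0)"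
proof -
  have "((\<lambda>s. x + s *\<^sub>R axis k 1) has_derivative (\<lambda>s. s *\<^sub>R axis k 1)) (at (0::real))"
    by (auto intro!: derivative_eq_intros)
  moreover have "(g has_derivative D) (at (x + 0 *\<^sub>R axis k 1))" using assms by simp
  ultimately have "((\<lambda>s. g (x + s *\<^sub>R axis k 1)) has_derivative (\<lambda>s. D (s *\<^sub>R axis k 1))) (at 0)"
    by (rule has_derivative_compose)
  then show ?thesis
    unfolding has_vector_derivative_def
    using has_derivative_linear[OF assms] by (simp add: linear_cmul)
qed

lemma partial_deriv_eq:
  fixes g :: "real^'n::finite \<Rightarrow> 'b::real_normed_vector"
  assumes "(g has_derivative D) (at x)"
  shows "partial_deriv k g x = D (axis k 1)"
  unfolding partial_deriv_def using has_derivative_partial[OF assms] by (rule vector_derivative_at)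

lemma linear_eq_inner_axis:
  fixes D :: "real^'n::finite \<Rightarrow> real"
  assumes "linear D" shows "D h = h \<bullet> (\<chi> k. D (axis k 1))"
proof -
  have "D h = D (\<Sum>k\<in>UNIV. h $ k *\<^sub>R axis k 1)"
    by (metis basis_expansion scalar_mult_eq_scaleR)
  also have "\<dots> = (\<Sum>k\<in>UNIV. h $ k * D (axis k 1))"
    using assms by (simp add: linear_sum linear_cmul)
  finally show ?thesis by (simp add: inner_vec_def)
qed

lemma GDERIV_grad:
  fixes g :: "real^'n::finite \<Rightarrow> real"
  assumes "g differentiable (at x)" shows "GDERIV g x :> grad g x"
proof -
  obtain D where D: "(g has_derivative D) (at x)" using assms unfolding differentiable_def by blast
  have "D = (\<lambda>h. h \<bullet> grad g x)"
    using linear_eq_inner_axis[OF has_derivative_linear[OF D]]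
    unfolding grad_def partial_deriv_eq[OF D] by blast
  then show ?thesis unfolding gderiv_def using D by simp
qed

lemma GDERIV_unique:
  assumes "GDERIV f x :> a" "GDERIV f x :> b" shows "a = b"
proof -
  have "(\<lambda>h. h \<bullet> a) = (\<lambda>h. h \<bullet> b)"
    using assms has_derivative_unique unfolding gderiv_def by blast
  then show ?thesis by (metis inner_commute vector_eq_rdot)
qed

lemma GDERIV_imp_grad:
  fixes g :: "real^'n::finite \<Rightarrow> real"
  assumes "GDERIV g x :> G" shows "grad g x = G"
proof -
  have "g differentiable (at x)" using assms unfolding gderiv_def differentiable_def by blast
  then show ?thesis using GDERIV_grad GDERIV_unique assms by blast
qed

lemma GDERIV_isCont: "GDERIV f x :> a \<Longrightarrow> isCont f x"
  unfolding gderiv_def by (rule has_derivative_continuous)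

lemma GDERIV_transform_open:
  assumes "GDERIV f x :> a" "open T" "x \<in> T" "\<And>y. y \<in> T \<Longrightarrow> f y = g y"
  shows "GDERIV g x :> a"
  using assms has_derivative_transform_within_open unfolding gderiv_def by blast

lemma GDERIV_eq_0:
  assumes "GDERIV g x :> a" "open T" "x \<in> T" "\<And>y. y \<in> T \<Longrightarrow> g y = 0"
  shows "a = 0"
proof -
  have "GDERIV g x :> 0" by (rule GDERIV_transform_open[OF GDERIV_const[of 0] assms(2,3)]) (simp add: assms(4))
  with assms(1) show ?thesis by (rule GDERIV_unique)
qed

lemma GDERIV_line:
  fixes g :: "real^'n::finite \<Rightarrow> real"
  assumes "GDERIV g (x + z *\<^sub>R axis k 1) :> G"
  shows "((\<lambda>z. g (x + z *\<^sub>R axis k 1)) has_real_derivative G $ k) (at z)"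
proof -
  have "((\<lambda>s. x + s *\<^sub>R axis k 1) has_derivative (\<lambda>s. s *\<^sub>R axis k 1)) (at z)"
    by (auto intro!: derivative_eq_intros)
  then have "((\<lambda>s. g (x + s *\<^sub>R axis k 1)) has_derivative (\<lambda>s. (s *\<^sub>R axis k 1) \<bullet> G)) (at z)"
    using assms unfolding gderiv_def by (rule has_derivative_compose)
  then show ?thesis unfolding has_field_derivative_def
    by (simp add: inner_axis' mult.commute[of _ "G $ k"] fun_eq_iff)
qed

lemma C1_has_derivative: "C1 g \<Longrightarrow> GDERIV g x :> grad g x"
  by (simp add: C1_def GDERIV_grad)

lemma C1_continuous: "C1 g \<Longrightarrow> continuous_on UNIV g"
  by (simp add: C1_def continuous_at_imp_continuous_on differentiable_imp_continuous_within)

lemma C1_continuous_grad: "C1 g \<Longrightarrow> continuous_on UNIV (grad g)"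
  by (simp add: C1_def)

text \<open>The regularity class of the Gauss-Green formula: boundary values for \<open>g\<close>,
  boundedness for the gradient. The gradient is a parameter \<open>G\<close> rather than chosen, so
  that the sum and product rules produce explicit gradients. Boundedness of \<open>g\<close> is
  stated separately because \<open>S\<close> may be the whole space, as it is for cutoffs.\<close>

definition C1_upto :: "(real^'n::finite) set \<Rightarrow> (real^'n \<Rightarrow> real) \<Rightarrow> (real^'n \<Rightarrow> real^'n) \<Rightarrow> bool" where
  "C1_upto S g G \<longleftrightarrow> continuous_on (closure S) g \<and> bounded (g ` closure S) \<and>
     continuous_on S G \<and> bounded (G ` S) \<and> (\<forall>x\<in>S. GDERIV g x :> G x)"

lemma C1_uptoI:
  assumes "continuous_on (closure S) g" "bounded (g ` closure S)"
     "continuous_on S G" "bounded (G ` S)" "\<And>x. x \<in> S \<Longrightarrow> GDERIV g x :> G x"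
  shows "C1_upto S g G"
  using assms by (auto simp: C1_upto_def)

lemma C1_uptoD:
  assumes "C1_upto S g G"
  shows "continuous_on (closure S) g" "bounded (g ` closure S)"
     "continuous_on S G" "bounded (G ` S)" "\<And>x. x \<in> S \<Longrightarrow> GDERIV g x :> G x"
  using assms by (auto simp: C1_upto_def)

lemma C1_upto_subset:
  assumes "C1_upto T g G" "S \<subseteq> T" shows "C1_upto S g G"
  using assms unfolding C1_upto_def
  by (meson bounded_subset closure_mono continuous_on_subset image_mono subsetD)

lemma bounded_scaleR_image:
  fixes f :: "'a \<Rightarrow> real" and g :: "'a \<Rightarrow> 'b::real_normed_vector"
  assumes "bounded (f ` S)" "bounded (g ` S)"
  shows "bounded ((\<lambda>x. f x *\<^sub>R g x) ` S)"
proof -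
  obtain a b where "\<And>x. x \<in> S \<Longrightarrow> \<bar>f x\<bar> \<le> a" "\<And>x. x \<in> S \<Longrightarrow> norm (g x) \<le> b"
    using assms unfolding bounded_iff by auto
  then have "norm (f x *\<^sub>R g x) \<le> a * b" if "x \<in> S" for x
    using that by (auto intro!: mult_mono) (metis abs_ge_zero order_trans)
  then show ?thesis unfolding bounded_iff by auto
qed

lemma C1_upto_mult:
  assumes "C1_upto S f F" "C1_upto S g G"
  shows "C1_upto S (\<lambda>x. f x * g x) (\<lambda>x. f x *\<^sub>R G x + g x *\<^sub>R F x)"
proof (rule C1_uptoI)
  note f = C1_uptoD[OF assms(1)] and g = C1_uptoD[OF assms(2)]
  have sub: "bounded (f ` S)" "bounded (g ` S)" "continuous_on S f" "continuous_on S g"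
    using f g by (meson bounded_subset continuous_on_subset closure_subset image_mono)+
  show "continuous_on (closure S) (\<lambda>x. f x * g x)" using f g by (intro continuous_intros)
  show "bounded ((\<lambda>x. f x * g x) ` closure S)" using bounded_scaleR_image[OF f(2) g(2)] by simp
  show "continuous_on S (\<lambda>x. f x *\<^sub>R G x + g x *\<^sub>R F x)" using f g sub by (intro continuous_intros)
  show "bounded ((\<lambda>x. f x *\<^sub>R G x + g x *\<^sub>R F x) ` S)"
    using sub f g by (intro bounded_plus_comp bounded_scaleR_image)
  show "GDERIV (\<lambda>x. f x * g x) x :> f x *\<^sub>R G x + g x *\<^sub>R F x" if "x \<in> S" for x
    using that f g by (intro GDERIV_mult)
qed

lemma C1_upto_add:
  assumes "C1_upto S f F" "C1_upto S g G"
  shows "C1_upto S (\<lambda>x. f x + g x) (\<lambda>x. F x + G x)"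
  using C1_uptoD[OF assms(1)] C1_uptoD[OF assms(2)]
  by (intro C1_uptoI continuous_intros bounded_plus_comp GDERIV_add)

lemma C1_upto_const: "C1_upto S (\<lambda>x. c) (\<lambda>x. 0)"
  by (intro C1_uptoI continuous_intros GDERIV_const) (auto simp: bounded_iff)

lemma C1_upto_cmult:
  assumes "C1_upto S g G" shows "C1_upto S (\<lambda>x. c * g x) (\<lambda>x. c *\<^sub>R G x)"
  using C1_upto_mult[OF C1_upto_const assms, of c] by simp

lemma C1_upto_sum:
  assumes "\<And>i. i \<in> I \<Longrightarrow> C1_upto S (g i) (G i)"
  shows "C1_upto S (\<lambda>x. \<Sum>i\<in>I. g i x) (\<lambda>x. \<Sum>i\<in>I. G i x)"
  using assms
  by (induction I rule: infinite_finite_induct) (auto intro: C1_upto_const C1_upto_add)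

lemma C1_upto_diff:
  assumes "C1_upto S f F" "C1_upto S g G"
  shows "C1_upto S (\<lambda>x. f x - g x) (\<lambda>x. F x - G x)"
  using C1_upto_add[OF assms(1) C1_upto_cmult[OF assms(2), of "-1"]] by simp

lemma C1_upto_borel:
  assumes "C1_upto S g G" "open S"
  shows "(\<lambda>x. G x $ k * indicator S x) \<in> borel_measurable borel"
    "(\<lambda>x. g x * indicator S x) \<in> borel_measurable borel"
proof -
  have "(\<lambda>x. indicator S x *\<^sub>R G x $ k) \<in> borel_measurable borel"
    by (rule borel_measurable_continuous_on_indicator)
       (use C1_uptoD[OF assms(1)] assms(2) in \<open>auto intro!: continuous_intros\<close>)
  then show "(\<lambda>x. G x $ k * indicator S x) \<in> borel_measurable borel" by (simp add: mult.commute)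
  have "(\<lambda>x. indicator S x *\<^sub>R g x) \<in> borel_measurable borel"
    by (rule borel_measurable_continuous_on_indicator)
       (use C1_uptoD[OF assms(1)] assms(2) closure_subset in \<open>auto intro!: continuous_intros elim!: continuous_on_subset\<close>)
  then show "(\<lambda>x. g x * indicator S x) \<in> borel_measurable borel" by (simp add: mult.commute)
qed

lemma C1_upto_bounded_borel:
  assumes "C1_upto S g G" "open S" "bounded S"
  shows "bounded_borel (\<lambda>x. G x $ k * indicator S x)"
proof -
  obtain B where "\<And>x. x \<in> S \<Longrightarrow> norm (G x) \<le> B" using C1_uptoD(4)[OF assms(1)] unfolding bounded_iff by auto
  then have B: "\<And>x. x \<in> S \<Longrightarrow> \<bar>G x $ k\<bar> \<le> B" using component_le_norm_cart order_trans by blast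
  obtain R where R: "\<And>x. x \<in> S \<Longrightarrow> norm x \<le> R" using assms(3) unfolding bounded_iff by auto
  show ?thesis
    by (rule bounded_borelI[where B="max B 0" and R=R])
       (use B R C1_upto_borel[OF assms(1,2)] in \<open>auto simp: indicator_def le_max_iff_disj split: if_splits\<close>)
qed

section \<open>Cutoff functions of balls, with explicit gradients\<close>

definition sqpos :: "real \<Rightarrow> real" where "sqpos v = (max 0 v)\<^sup>2"

lemma DERIV_sqpos: "(sqpos has_real_derivative 2 * max 0 v) (at v)"
proof -
  consider "v > 0" | "v < 0" | "v = 0" by linarith
  then show ?thesis
  proof cases
    case 1
    have "((\<lambda>v. v\<^sup>2) has_real_derivative 2 * v) (at v)" by (auto intro!: derivative_eq_intros)
    then have "(sqpos has_real_derivative 2 * v) (at v)"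
      by (rule has_field_derivative_transform_within_open[where S="{0<..}"]) (use 1 in \<open>auto simp: sqpos_def\<close>)
    then show ?thesis using 1 by simp
  next
    case 2
    have "((\<lambda>v. 0) has_real_derivative 0) (at v)" by simp
    then have "(sqpos has_real_derivative 0) (at v)"
      by (rule has_field_derivative_transform_within_open[where S="{..<0}"]) (use 2 in \<open>auto simp: sqpos_def\<close>)
    then show ?thesis using 2 by simp
  next
    case 3
    have "((\<lambda>h. sqpos h / h) \<longlongrightarrow> 0) (at 0)"
    proof (rule Lim_null_comparison[where g="\<lambda>h. \<bar>h\<bar>"])
      have "norm (sqpos h / h) \<le> \<bar>h\<bar>" for h
        by (auto simp: sqpos_def max_def power2_eq_square)
      then show "\<forall>\<^sub>F h in at 0. norm (sqpos h / h) \<le> \<bar>h\<bar>" by simp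
      show "((\<lambda>h. \<bar>h\<bar>) \<longlongrightarrow> 0) (at (0::real))" by (rule tendsto_rabs_zero) simp
    qed
    then show ?thesis using 3 by (simp add: DERIV_def sqpos_def)
  qed
qed

text \<open>With the squared distance in units of r as argument, the thresholds 1 and 4 are the
  distances r and 2r. \<open>sqpos\<close> squares the positive part to make it continuously
  differentiable, and the two summands of the denominator never vanish together.\<close>

definition cutoff1 :: "real \<Rightarrow> real" where "cutoff1 v = sqpos (4 - v) / (sqpos (4 - v) + sqpos (v - 1))"

lemma cutoff1_denom: "sqpos (4 - v) + sqpos (v - 1) > 0"
proof (cases "v < 4")
  case True then show ?thesis by (intro add_pos_nonneg) (auto simp: sqpos_def)
next
  case False then show ?thesis by (intro add_nonneg_pos) (auto simp: sqpos_def)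
qed

lemma cutoff1_bounds: "0 \<le> cutoff1 v" "cutoff1 v \<le> 1"
  using cutoff1_denom[of v] by (auto simp: cutoff1_def sqpos_def)

lemma cutoff1_eq_1: "v \<le> 1 \<Longrightarrow> cutoff1 v = 1"
  using cutoff1_denom[of v] by (auto simp: cutoff1_def sqpos_def)

lemma cutoff1_eq_0: "4 \<le> v \<Longrightarrow> cutoff1 v = 0"
  by (auto simp: cutoff1_def sqpos_def)

text \<open>The quotient rule left unsimplified: this is the form that \<open>DERIV_divide\<close>
  returns, and continuity can be read off from it.\<close>

definition cutoff1' :: "real \<Rightarrow> real" where
  "cutoff1' v = (2 * max 0 (4 - v) * (-1) * (sqpos (4 - v) + sqpos (v - 1)) -
      sqpos (4 - v) * (2 * max 0 (4 - v) * (-1) + 2 * max 0 (v - 1) * 1)) /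
      ((sqpos (4 - v) + sqpos (v - 1)) * (sqpos (4 - v) + sqpos (v - 1)))"

lemma DERIV_cutoff1: "(cutoff1 has_real_derivative cutoff1' v) (at v)"
proof -
  have 1: "((\<lambda>v. sqpos (4 - v)) has_real_derivative 2 * max 0 (4 - v) * (-1)) (at v)"
    by (rule DERIV_chain2[OF DERIV_sqpos]) (auto intro!: derivative_eq_intros)
  have 2: "((\<lambda>v. sqpos (v - 1)) has_real_derivative 2 * max 0 (v - 1) * 1) (at v)"
    by (rule DERIV_chain2[OF DERIV_sqpos]) (auto intro!: derivative_eq_intros)
  show ?thesis
    unfolding cutoff1_def[abs_def] cutoff1'_def
    by (rule DERIV_divide[OF 1 DERIV_add[OF 1 2]]) (use cutoff1_denom[of v] in auto)
qed

lemma continuous_cutoff1': "continuous_on UNIV cutoff1'"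
  unfolding cutoff1'_def[abs_def] sqpos_def
  using cutoff1_denom unfolding sqpos_def
  by (intro continuous_intros ballI) (metis less_irrefl mult_eq_0_iff)

lemma cutoff1'_eq_0: "v \<notin> {1..4} \<Longrightarrow> cutoff1' v = 0"
  by (auto simp: cutoff1'_def sqpos_def algebra_simps)

lemma cutoff1'_bounded: "\<exists>B>0. \<forall>v. \<bar>cutoff1' v\<bar> \<le> B"
proof -
  have "bounded (cutoff1' ` {1..4})"
    by (intro compact_imp_bounded compact_continuous_image continuous_on_subset[OF continuous_cutoff1']) auto
  then obtain B where B: "\<And>v. v \<in> {1..4} \<Longrightarrow> \<bar>cutoff1' v\<bar> \<le> B" unfolding bounded_iff by (metis imageI real_norm_def)
  have "\<bar>cutoff1' v\<bar> \<le> max B 1" for v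
    using B[of v] cutoff1'_eq_0[of v] by (cases "v \<in> {1..4}") auto
  then show ?thesis by (intro exI[of _ "max B 1"]) auto
qed

text \<open>Built on the squared distance, which is smooth also at the centre.\<close>

definition cutoff :: "'a::real_inner \<Rightarrow> real \<Rightarrow> 'a \<Rightarrow> real" where
  "cutoff c r x = cutoff1 (((x - c) \<bullet> (x - c)) / r\<^sup>2)"

definition cutoff_grad :: "'a::real_inner \<Rightarrow> real \<Rightarrow> 'a \<Rightarrow> 'a" where
  "cutoff_grad c r x = (cutoff1' (((x - c) \<bullet> (x - c)) / r\<^sup>2) * 2 / r\<^sup>2) *\<^sub>R (x - c)"

lemma cutoff_bounds: "0 \<le> cutoff c r x" "cutoff c r x \<le> 1"
  unfolding cutoff_def by (rule cutoff1_bounds)+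

lemma inner_dist: "(x - c) \<bullet> (x - c) = (dist c x)\<^sup>2"
  by (metis dist_commute dist_norm power2_norm_eq_inner)

lemma cutoff_eq_1: "r > 0 \<Longrightarrow> dist c x \<le> r \<Longrightarrow> cutoff c r x = 1"
  unfolding cutoff_def by (rule cutoff1_eq_1) (auto simp: inner_dist)

lemma cutoff_eq_0: "r > 0 \<Longrightarrow> dist c x \<ge> 2 * r \<Longrightarrow> cutoff c r x = 0"
  unfolding cutoff_def inner_dist
  using power_mono[of "2 * r" "dist c x" 2]
  by (intro cutoff1_eq_0) (simp add: field_simps)

lemma GDERIV_cutoff: "GDERIV (cutoff c r) x :> cutoff_grad c r x"
proof -
  have "((\<lambda>x. (x - c) \<bullet> (x - c)) has_derivative (\<lambda>h. h \<bullet> (2 *\<^sub>R (x - c)))) (at x)"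
    by (rule has_derivative_eq_rhs, (rule derivative_intros)+) (auto simp: inner_commute)
  then have "GDERIV (\<lambda>x. (x - c) \<bullet> (x - c)) x :> 2 *\<^sub>R (x - c)" unfolding gderiv_def .
  from GDERIV_mult[OF GDERIV_const this, of "1 / r\<^sup>2"]
  have 1: "GDERIV (\<lambda>x. ((x - c) \<bullet> (x - c)) / r\<^sup>2) x :> (2 / r\<^sup>2) *\<^sub>R (x - c)"
    by simp
  show ?thesis
    unfolding cutoff_def[abs_def]
    using GDERIV_DERIV_compose[OF 1 DERIV_cutoff1] by (simp add: cutoff_grad_def)
qed

lemma cutoff_grad_eq_0: "r > 0 \<Longrightarrow> dist c x > 2 * r \<Longrightarrow> cutoff_grad c r x = 0"
proof -
  assume "r > 0" "dist c x > 2 * r"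
  then have "(2*r)\<^sup>2 < (dist c x)\<^sup>2" by (intro power_strict_mono) auto
  then have "(dist c x)\<^sup>2 / r\<^sup>2 \<notin> {1..4}" using \<open>r > 0\<close> by (auto simp: field_simps)
  then show ?thesis by (simp add: cutoff_grad_def inner_dist cutoff1'_eq_0)
qed

text \<open>The constant is the same for all centres and radii: the chain rule gives the factor 2 /
  r^2 times |x - c|, and |x - c| \<le> 2r on the support, whence 4 times the bound for
  \<open>cutoff1'\<close>.\<close>

lemma cutoff_grad_bound:
  obtains B where "B > 0" "\<And>(c::'a::real_inner) r x. r > 0 \<Longrightarrow> norm (cutoff_grad c r x) \<le> B / r"
proof -
  obtain B where B: "B > 0" "\<And>v. \<bar>cutoff1' v\<bar> \<le> B" using cutoff1'_bounded by blast
  have "norm (cutoff_grad c r x) \<le> (4 * B) / r" if "r > 0" for c r and x :: 'a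
  proof (cases "dist c x > 2 * r")
    case True then show ?thesis using that B by (simp add: cutoff_grad_eq_0)
  next
    case False
    have "norm (cutoff_grad c r x) = \<bar>cutoff1' ((dist c x)\<^sup>2 / r\<^sup>2)\<bar> * 2 / r\<^sup>2 * dist c x"
      using that by (simp add: cutoff_grad_def inner_dist abs_mult dist_norm norm_minus_commute)
    also have "\<dots> \<le> B * 2 / r\<^sup>2 * (2 * r)"
      using False B that by (intro mult_mono divide_right_mono) (auto simp: less_imp_le)
    also have "\<dots> = (4 * B) / r" using that by (simp add: power2_eq_square)
    finally show ?thesis .
  qed
  then show ?thesis using that[of "4 * B"] B by auto
qed

lemma C1_upto_cutoff:
  fixes c :: "real^'n::finite"
  assumes "r > 0" shows "C1_upto S (cutoff c r) (cutoff_grad c r)"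
proof (rule C1_uptoI)
  show "continuous_on (closure S) (cutoff c r)"
    using GDERIV_cutoff GDERIV_isCont continuous_at_imp_continuous_on by blast
  show "bounded (cutoff c r ` closure S)"
    unfolding bounded_iff using cutoff_bounds[of c r] by (auto intro!: exI[of _ 1])
  show "continuous_on S (cutoff_grad c r)"
    unfolding cutoff_grad_def[abs_def]
    by (intro continuous_intros continuous_on_compose2[OF continuous_cutoff1']) (use assms in auto)
  obtain B where "B > 0" "\<And>(c::real^'n) r x. r > 0 \<Longrightarrow> norm (cutoff_grad c r x) \<le> B / r"
    using cutoff_grad_bound by blast
  then show "bounded (cutoff_grad c r ` S)"
    unfolding bounded_iff using assms by (auto intro!: exI[of _ "B / r"])
qed (rule GDERIV_cutoff)

subsection \<open>The Gauss-Green formula below a graph\<close>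

text \<open>Vertical projection to the graph. When \<open>\<gamma>\<close> ignores the m-th
  coordinate, each point of the graph is reached from a whole vertical line, of which a unit segment
  lies in the slab.\<close>

definition graph_point :: "'n::finite \<Rightarrow> (real^'n \<Rightarrow> real) \<Rightarrow> real^'n \<Rightarrow> real^'n" where
  "graph_point m \<gamma> x = x + (\<gamma> x - x $ m) *\<^sub>R axis m 1"

lemma invariant_grad:
  fixes \<gamma> :: "real^'n::finite \<Rightarrow> real"
  assumes inv: "\<And>x h. \<gamma> (x + h *\<^sub>R axis m 1) = \<gamma> x"
  shows "grad \<gamma> (x + h *\<^sub>R axis m 1) = grad \<gamma> x" "grad \<gamma> x $ m = 0"
proof -
  have "\<gamma> (x + h *\<^sub>R axis m 1 + s *\<^sub>R axis k 1) = \<gamma> (x + s *\<^sub>R axis k 1)" for s k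
    using inv[of "x + s *\<^sub>R axis k 1" h] by (simp add: algebra_simps)
  then show "grad \<gamma> (x + h *\<^sub>R axis m 1) = grad \<gamma> x"
    by (simp add: grad_def partial_deriv_def)
  show "grad \<gamma> x $ m = 0" by (simp add: grad_def partial_deriv_def inv)
qed

lemma invariant_graph_point:
  assumes inv: "\<And>x h. \<gamma> (x + h *\<^sub>R axis m 1) = \<gamma> x"
  shows "\<gamma> (graph_point m \<gamma> x) = \<gamma> x" "grad \<gamma> (graph_point m \<gamma> x) = grad \<gamma> x"
    "graph_point m \<gamma> x $ m = \<gamma> x"
  unfolding graph_point_def by (simp_all add: inv invariant_grad(1)[OF inv])

lemma graph_point_borel [measurable]:
  assumes [measurable]: "\<gamma> \<in> borel_measurable borel"
  shows "graph_point m \<gamma> \<in> borel_measurable borel"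
proof -
  have [measurable]: "(\<lambda>x::real^'a. x $ m) \<in> borel_measurable borel"
    by (intro borel_measurable_continuous_onI continuous_intros)
  show ?thesis unfolding graph_point_def[abs_def] by simp
qed

lemma boundary_chartD:
  assumes "boundary_chart \<Omega> U m s \<gamma>"
  shows "open U" "s = 1 \<or> s = -1" "s * s = 1" "C1 \<gamma>" "\<And>x h. \<gamma> (x + h *\<^sub>R axis m 1) = \<gamma> x"
    "\<And>x. x \<in> U \<Longrightarrow> x \<in> \<Omega> \<longleftrightarrow> s * (x $ m - \<gamma> x) < 0"
  using assms unfolding boundary_chart_def by auto

lemma C1_borel:
  fixes \<gamma> :: "real^'n::finite \<Rightarrow> real"
  assumes "C1 \<gamma>"
  shows "\<gamma> \<in> borel_measurable borel" "grad \<gamma> \<in> borel_measurable borel"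
  using C1_continuous[OF assms] C1_continuous_grad[OF assms] borel_measurable_continuous_onI by blast+

text \<open>A step of length e/2 against the sign \<open>s\<close> leads from the graph into the
  region and stays in the ball of radius e.\<close>

lemma graph_closure:
  fixes \<gamma> :: "real^'n::finite \<Rightarrow> real"
  assumes "s = 1 \<or> s = -1" and inv: "\<And>x h. \<gamma> (x + h *\<^sub>R axis m 1) = \<gamma> x"
    and "x $ m = \<gamma> x" "open W" "x \<in> W"
  obtains y where "y \<in> W" "s * (y $ m - \<gamma> y) < 0"
proof -
  obtain e where e: "e > 0" "ball x e \<subseteq> W" using assms openE by blast
  let ?y = "x + (- s * e / 2) *\<^sub>R axis m 1"
  have "dist x ?y < e" using e assms(1) by (auto simp: dist_norm)
  then have "?y \<in> W" using e by auto
  moreover have "s * (?y $ m - \<gamma> ?y) < 0" unfolding inv using assms(1,3) e by auto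
  ultimately show ?thesis using that by blast
qed

text \<open>Points on the graph are limits of points of the region by \<open>graph_closure\<close>;
  points strictly on the other side have a neighbourhood in \<open>U\<close> that misses
  \<Omega>.\<close>

lemma chart_frontier:
  fixes \<Omega> :: "(real^'n::finite) set"
  assumes "boundary_chart \<Omega> U m s \<gamma>" "open \<Omega>" "x \<in> U"
  shows "x \<in> frontier \<Omega> \<longleftrightarrow> x $ m = \<gamma> x"
    "x \<in> closure \<Omega> \<longleftrightarrow> s * (x $ m - \<gamma> x) \<le> 0"
proof -
  note c = boundary_chartD[OF assms(1)]
  have cont: "continuous_on UNIV \<gamma>" using c by (simp add: C1_continuous)
  have A: "x \<in> closure \<Omega>" if "s * (x $ m - \<gamma> x) \<le> 0"
  proof (cases "x \<in> \<Omega>")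
    case False
    then have "x $ m = \<gamma> x" using c(2) c(6)[OF assms(3)] that by auto
    show ?thesis unfolding closure_iff_nhds_not_empty
    proof (intro allI impI)
      fix A V assume V: "V \<subseteq> A" "open V" "x \<in> V"
      obtain y where "y \<in> V \<inter> U" "s * (y $ m - \<gamma> y) < 0"
        using graph_closure[of s \<gamma> m x "V \<inter> U"] c \<open>x $ m = \<gamma> x\<close> V assms(3) by auto
      then show "\<Omega> \<inter> A \<noteq> {}" using c(6) V by auto
    qed
  qed (use closure_subset in auto)
  have B: "x \<notin> closure \<Omega>" if "s * (x $ m - \<gamma> x) > 0"
  proof -
    let ?W = "U \<inter> {x. s * (x $ m - \<gamma> x) > 0}"
    have "open {x. s * (x $ m - \<gamma> x) > 0}"
      by (intro open_Collect_less continuous_intros cont)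
    then have "open ?W" "x \<in> ?W" using that assms c by auto
    moreover have "?W \<inter> \<Omega> = {}" using c(6) by force
    ultimately show ?thesis by (meson disjoint_iff open_Int_closure_eq_empty)
  qed
  show C: "x \<in> closure \<Omega> \<longleftrightarrow> s * (x $ m - \<gamma> x) \<le> 0" using A B by force
  have "x \<in> frontier \<Omega> \<longleftrightarrow> x \<in> closure \<Omega> \<and> x \<notin> \<Omega>"
    using assms(2) by (simp add: frontier_def interior_open)
  then show "x \<in> frontier \<Omega> \<longleftrightarrow> x $ m = \<gamma> x" unfolding C using c(2) c(6)[OF assms(3)] by auto
qed

text \<open>It suffices to bound \<open>\<gamma>\<close> on the ball that contains the support of
  \<open>f\<close>: by invariance its value at \<open>x\<close> is its value at the sheared point,
  which lies in that ball.\<close>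

lemma bounded_support_shear:
  fixes f :: "real^'n::finite \<Rightarrow> real"
  assumes "bounded {x. f x \<noteq> 0}" "continuous_on UNIV \<gamma>" and inv: "\<And>x h. \<gamma> (x + h *\<^sub>R axis m 1) = \<gamma> x"
  shows "bounded {x. f (x + \<gamma> x *\<^sub>R axis m 1) \<noteq> 0}"
proof -
  obtain R where R: "\<And>x. f x \<noteq> 0 \<Longrightarrow> norm x \<le> R" using assms(1) unfolding bounded_iff by auto
  obtain b where b: "\<And>x. norm x \<le> R \<Longrightarrow> \<bar>\<gamma> x\<bar> \<le> b" by (rule continuous_bounded_cball[OF assms(2)]) blast
  have "norm x \<le> R + b" if "f (x + \<gamma> x *\<^sub>R axis m 1) \<noteq> 0" for x
    using R[OF that] b[of "x + \<gamma> x *\<^sub>R axis m 1"] norm_le_line(2)[of x "\<gamma> x" m] by (simp add: inv)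
  then show ?thesis unfolding bounded_iff by blast
qed

lemma bounded_borel_shear:
  fixes f :: "real^'n::finite \<Rightarrow> real"
  assumes "bounded_borel f" "continuous_on UNIV \<gamma>" and inv: "\<And>x h. \<gamma> (x + h *\<^sub>R axis m 1) = \<gamma> x"
  shows "bounded_borel (\<lambda>x. f (x + \<gamma> x *\<^sub>R axis m 1))"
proof -
  note [measurable] = borel_measurable_continuous_onI[OF assms(2)] bounded_borel_measurable[OF assms(1)]
  show ?thesis unfolding bounded_borel_def
  proof (intro conjI)
    show "bounded (range (\<lambda>x. f (x + \<gamma> x *\<^sub>R axis m 1)))"
      using assms(1) unfolding bounded_borel_def by (auto elim: bounded_subset)
    show "bounded {x. f (x + \<gamma> x *\<^sub>R axis m 1) \<noteq> 0}"
      using assms(1) unfolding bounded_borel_def by (intro bounded_support_shear[OF _ assms(2) inv]) blast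
  qed measurable
qed

text \<open>On each vertical line the shear is a translation by the constant
  \<open>\<gamma> x\<close>, so slicing and translation invariance take the place of a Jacobian
  computation.\<close>

lemma integral_shear:
  fixes f :: "real^'n::finite \<Rightarrow> real"
  assumes "bounded_borel f" "continuous_on UNIV \<gamma>" and inv: "\<And>x h. \<gamma> (x + h *\<^sub>R axis m 1) = \<gamma> x"
  shows "(\<integral>x. f (x + \<gamma> x *\<^sub>R axis m 1) \<partial>lborel) = (\<integral>x. f x \<partial>lborel)"
proof -
  have "(\<integral>z. f (x + z *\<^sub>R axis m 1 + \<gamma> (x + z *\<^sub>R axis m 1) *\<^sub>R axis m 1) \<partial>lborel) =
      (\<integral>z. f (x + z *\<^sub>R axis m 1) \<partial>lborel)" for x
  proof -
    have "(\<lambda>z. f (x + z *\<^sub>R axis m 1)) \<in> borel_measurable borel"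
      using bounded_borel_line[OF assms(1)] bounded_borel_measurable by blast
    from lborel_translate[OF this, of "\<gamma> x"] show ?thesis
      unfolding inv by (simp add: algebra_simps)
  qed
  then show ?thesis
    by (subst (1 2) slab_fubini[of _ m]) (simp_all add: assms bounded_borel_shear)
qed

text \<open>In the vertical direction this is the fundamental theorem on each line. For k \<noteq> m
  the shear turns the region into a half-space that translations along e_k preserve; there the
  derivative along e_k integrates to zero, and by the chain rule it is the sheared function G_k +
  (\<partial>_k \<gamma>) G_m. The k-th component thus reduces to the vertical one with weight -
  \<partial>_k \<gamma>, the k-th entry of \<open>axis m 1 - grad \<gamma> x\<close>.\<close>

theorem graph_gauss_green:
  fixes g :: "real^'n::finite \<Rightarrow> real"
  assumes s: "s = 1 \<or> s = -1" and \<gamma>: "C1 \<gamma>" and inv: "\<And>x h. \<gamma> (x + h *\<^sub>R axis m 1) = \<gamma> x"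
    and V: "V = {x. s * (x $ m - \<gamma> x) < 0}"
    and bounded_borel: "\<And>k. bounded_borel (\<lambda>x. G x $ k * indicator V x)" and bg: "bounded {x. g x \<noteq> 0}"
    and der: "\<And>x. x \<in> V \<Longrightarrow> GDERIV g x :> G x"
    and cont: "continuous_on {x. s * (x $ m - \<gamma> x) \<le> 0} g"
  shows "(\<integral>x. G x $ k * indicator V x \<partial>lborel) =
    (\<integral>x. indicator (slab m) x * (s * (axis m 1 - grad \<gamma> x) $ k * g (graph_point m \<gamma> x)) \<partial>lborel)"
proof -
  let ?e = "axis m (1::real) :: real^'n"
  note contg = C1_continuous[OF \<gamma>]
  note [measurable] = C1_borel[OF \<gamma>]
  have line: "(\<integral>z. G (x + z *\<^sub>R ?e) $ m * indicator V (x + z *\<^sub>R ?e) \<partial>lborel) = s * g (graph_point m \<gamma> x)" for x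
  proof -
    let ?c = "\<gamma> x - x $ m"
    obtain R where R: "\<And>z. norm z \<ge> R \<Longrightarrow> g (x + z *\<^sub>R ?e) = 0" by (rule bounded_support_line[OF bg]) blast
    have Vz: "x + z *\<^sub>R ?e \<in> V \<longleftrightarrow> s * (z - ?c) < 0" for z
      unfolding V by (simp add: inv algebra_simps)
    have ind: "indicator V (x + z *\<^sub>R ?e) = (indicator {z. s * (z - ?c) < 0} z :: real)" for z
      using Vz[of z] by (auto simp: indicator_def)
    have "(\<integral>z. G (x + z *\<^sub>R ?e) $ m * indicator {z. s * (z - ?c) < 0} z \<partial>lborel) = s * g (x + ?c *\<^sub>R ?e)"
    proof (rule integral_line_FTC[OF s, where R=R])
      show "bounded_borel (\<lambda>z. G (x + z *\<^sub>R ?e) $ m * indicator {z. s * (z - ?c) < 0} z)"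
        using bounded_borel_line[OF bounded_borel[of m], of x m] by (simp add: ind)
      show "((\<lambda>z. g (x + z *\<^sub>R ?e)) has_real_derivative G (x + z *\<^sub>R ?e) $ m) (at z)"
        if "s * (z - ?c) < 0" for z
        by (rule GDERIV_line[OF der]) (use that Vz in auto)
      show "continuous_on {z. s * (z - ?c) \<le> 0} (\<lambda>z. g (x + z *\<^sub>R ?e))"
        by (rule continuous_on_compose2[OF cont]) (auto intro!: continuous_intros simp: inv algebra_simps)
    qed (rule R)
    then show ?thesis by (simp add: ind graph_point_def)
  qed
  show ?thesis
  proof (cases "k = m")
    case True
    show ?thesis unfolding True
      by (subst slab_fubini[OF bounded_borel[of m], of m]) (simp add: line invariant_grad(2)[OF inv])
  next
    case False
    have \<gamma>k: "continuous_on UNIV (\<lambda>x. grad \<gamma> x $ k)" using C1_continuous_grad[OF \<gamma>] by (intro continuous_intros)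
    let ?sh = "\<lambda>x. x + \<gamma> x *\<^sub>R ?e"
    have shV: "?sh x \<in> V \<longleftrightarrow> s * x $ m < 0" for x by (simp add: V inv)
    have bounded_borel_prod: "bounded_borel (\<lambda>x. grad \<gamma> x $ k * (G x $ m * indicator V x))"
      by (rule bounded_borel_continuous_mult[OF bounded_borel \<gamma>k])
    let ?q = "\<lambda>x. G x $ k * indicator V x + grad \<gamma> x $ k * (G x $ m * indicator V x)"
    have bq: "bounded_borel ?q" by (rule bounded_borel_add[OF bounded_borel bounded_borel_prod])
    have zero: "(\<integral>x. ?q (?sh x) \<partial>lborel) = 0"
    proof (rule integral_partial_UNIV[where h="\<lambda>x. if s * x $ m < 0 then g (?sh x) else 0" and k=k])
      show "bounded_borel (\<lambda>x. ?q (?sh x))" by (rule bounded_borel_shear[OF bq contg inv])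
      show "bounded {x. (if s * x $ m < 0 then g (?sh x) else 0) \<noteq> 0}"
        by (rule bounded_subset[OF bounded_support_shear[OF bg contg inv]]) (auto split: if_splits)
      fix x :: "real^'n"
      \<comment> \<open>A step along e_k leaves x_m unchanged, so the case distinction is constant
        along the line and the jump of the extension at x_m = 0 is never crossed.\<close>
      have km: "(x + z *\<^sub>R axis k 1) $ m = x $ m" for z :: real using False by (simp add: axis_def)
      have "((\<lambda>z. if s * x $ m < 0 then g (?sh (x + z *\<^sub>R axis k 1)) else 0) has_real_derivative ?q (?sh x)) (at 0)"
      proof (cases "s * x $ m < 0")
        case True
        have 1: "((\<lambda>z. ?sh (x + z *\<^sub>R axis k 1)) has_derivative (\<lambda>z. z *\<^sub>R axis k 1 + (grad \<gamma> x $ k * z) *\<^sub>R ?e)) (at 0)"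
        proof -
          have "((\<lambda>z. \<gamma> (x + z *\<^sub>R axis k 1)) has_real_derivative grad \<gamma> x $ k) (at 0)"
            by (rule GDERIV_line) (use C1_has_derivative[OF \<gamma>] in auto)
          then have "((\<lambda>z. \<gamma> (x + z *\<^sub>R axis k 1)) has_derivative (\<lambda>z. grad \<gamma> x $ k * z)) (at 0)"
            by (simp add: has_field_derivative_def)
          then show ?thesis
            by (auto intro!: derivative_eq_intros)
        qed
        have 2: "(g has_derivative (\<lambda>h. h \<bullet> G (?sh x))) (at (?sh (x + 0 *\<^sub>R axis k 1)))"
          using der[of "?sh x"] shV True by (simp add: gderiv_def)
        from has_derivative_compose[OF 1 2]
        have "((\<lambda>z. g (?sh (x + z *\<^sub>R axis k 1))) has_real_derivative G (?sh x) $ k + grad \<gamma> x $ k * G (?sh x) $ m) (at 0)"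
          unfolding has_field_derivative_def
          by (rule has_derivative_eq_rhs) (simp add: inner_add_left inner_axis' algebra_simps fun_eq_iff)
        then show ?thesis using True shV[of x] by (simp add: invariant_grad(1)[OF inv])
      next
        case False
        then show ?thesis using shV[of x] by simp
      qed
      then show "((\<lambda>z. if s * (x + z *\<^sub>R axis k 1) $ m < 0 then g (?sh (x + z *\<^sub>R axis k 1)) else 0) has_real_derivative ?q (?sh x)) (at 0)"
        unfolding km .
    qed
    have "0 = (\<integral>x. ?q x \<partial>lborel)" using integral_shear[OF bq contg inv] zero by simp
    also have "\<dots> = (\<integral>x. G x $ k * indicator V x \<partial>lborel) + (\<integral>x. grad \<gamma> x $ k * (G x $ m * indicator V x) \<partial>lborel)"
      by (intro Bochner_Integration.integral_add bounded_borel_integrable bounded_borel bounded_borel_prod)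
    finally have "(\<integral>x. G x $ k * indicator V x \<partial>lborel) = - (\<integral>x. grad \<gamma> x $ k * (G x $ m * indicator V x) \<partial>lborel)"
      by simp
    also have "\<dots> = - (\<integral>x. indicator (slab m) x * (grad \<gamma> x $ k * (s * g (graph_point m \<gamma> x))) \<partial>lborel)"
      by (subst slab_fubini[OF bounded_borel_prod, of m]) (simp add: invariant_grad(1)[OF inv] line)
    also have "\<dots> = (\<integral>x. indicator (slab m) x * (s * (axis m 1 - grad \<gamma> x) $ k * g (graph_point m \<gamma> x)) \<partial>lborel)"
      unfolding integral_minus[symmetric] using False by (intro Bochner_Integration.integral_cong) (auto simp: axis_def)
    finally show ?thesis .
  qed
qed

text \<open>\<Omega> agrees with the region cut off by the graph only inside \<open>U\<close>. As
  \<open>g\<close> vanishes off the compact set \<open>K\<close>, extension by zero from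
  \<open>K\<close> makes it a function on the whole region \<open>V\<close>, to which the formula
  for graphs applies.\<close>

theorem chart_gauss_green:
  fixes g :: "real^'n::finite \<Rightarrow> real"
  assumes ch: "boundary_chart \<Omega> U m s \<gamma>" and \<Omega>: "open \<Omega>" "bounded \<Omega>" and g: "C1_upto \<Omega> g G"
    and K: "compact K" "K \<subseteq> U" and g0: "\<And>x. x \<in> closure \<Omega> - K \<Longrightarrow> g x = 0"
  shows "(\<integral>x. G x $ k * indicator \<Omega> x \<partial>lborel) =
    (\<integral>x. indicator (slab m) x * (s * (axis m 1 - grad \<gamma> x) $ k *
       (g (graph_point m \<gamma> x) * indicator K (graph_point m \<gamma> x))) \<partial>lborel)"
proof -
  note c = boundary_chartD[OF ch] and C = C1_uptoD[OF g]
  define V where "V = {x. s * (x $ m - \<gamma> x) < 0}"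
  note contg = C1_continuous[OF c(4)]
  have oV: "open V" unfolding V_def by (intro open_Collect_less continuous_intros contg)
  have VU: "x \<in> V \<longleftrightarrow> x \<in> \<Omega>" if "x \<in> U" for x using c(6) that by (simp add: V_def)
  have G0: "G x = 0" if "x \<in> \<Omega> - K" for x
    by (rule GDERIV_eq_0[OF C(5), where T="\<Omega> - K"])
       (use that \<Omega> K g0 closure_subset in \<open>auto simp: open_Diff compact_imp_closed\<close>)
  define g' where "g' = (\<lambda>x. g x * indicator K x)"
  define G' where "G' = (\<lambda>x. indicator K x *\<^sub>R G x)"
  \<comment> \<open>Off \<open>K\<close> both sides are zero because the gradient vanishes there; on
    \<open>K\<close>, which lies in \<open>U\<close>, membership in \<open>V\<close> and in \<Omega>
    coincide.\<close>
  have eq: "G' x $ k * indicator V x = G x $ k * indicator \<Omega> x" for x k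
    using VU[of x] G0[of x] K(2) by (cases "x \<in> K") (auto simp: G'_def indicator_def)
  \<comment> \<open>Two relatively open pieces: in \<open>U\<close> the extension equals
    \<open>g\<close> wherever the closed region meets it, off \<open>K\<close> it is zero. They
    cover the region because \<open>K\<close> lies in \<open>U\<close>.\<close>
  have cV: "{x. s * (x $ m - \<gamma> x) \<le> 0} = ({x. s * (x $ m - \<gamma> x) \<le> 0} \<inter> U) \<union> ({x. s * (x $ m - \<gamma> x) \<le> 0} - K)" (is "?S = ?A \<union> ?B")
    using K(2) by auto
  have "continuous_on (?A \<union> ?B) g'"
  proof (rule continuous_on_Un_local_open)
    show "openin (top_of_set (?A \<union> ?B)) ?A" unfolding cV[symmetric] using c(1) by (auto simp: openin_open)
    show "openin (top_of_set (?A \<union> ?B)) ?B" unfolding cV[symmetric]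
      using K(1) by (auto simp: openin_open intro!: exI[of _ "-K"] compact_imp_closed)
    have "g x = g' x" if "x \<in> ?A" for x
      using chart_frontier(2)[OF ch \<Omega>(1), of x] that g0[of x] by (auto simp: g'_def indicator_def)
    moreover have "continuous_on ?A g"
      by (rule continuous_on_subset[OF C(1)]) (use chart_frontier(2)[OF ch \<Omega>(1)] in auto)
    ultimately show "continuous_on ?A g'" using continuous_on_cong by (metis (no_types, lifting))
    show "continuous_on ?B g'"
      by (rule continuous_on_eq[of _ "\<lambda>_. 0"]) (auto simp: g'_def)
  qed
  then have cont: "continuous_on ?S g'" using cV by simp
  have "(\<integral>x. G' x $ k * indicator V x \<partial>lborel) =
    (\<integral>x. indicator (slab m) x * (s * (axis m 1 - grad \<gamma> x) $ k * g' (graph_point m \<gamma> x)) \<partial>lborel)"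
  proof (rule graph_gauss_green[OF c(2,4,5) V_def])
    show "bounded_borel (\<lambda>x. G' x $ k * indicator V x)" for k
      unfolding eq by (rule C1_upto_bounded_borel[OF g \<Omega>])
    show "bounded {x. g' x \<noteq> 0}"
      by (rule bounded_subset[OF compact_imp_bounded[OF K(1)]]) (auto simp: g'_def indicator_def)
    show "continuous_on {x. s * (x $ m - \<gamma> x) \<le> 0} g'" by (rule cont)
    show "GDERIV g' x :> G' x" if "x \<in> V" for x
    proof (cases "x \<in> K")
      case True
      then have "x \<in> \<Omega> \<inter> U" using that VU K by auto
      have "GDERIV g' x :> G x"
        by (rule GDERIV_transform_open[OF C(5), where T="\<Omega> \<inter> U"])
           (use \<open>x \<in> \<Omega> \<inter> U\<close> \<Omega> c(1) g0 closure_subset in \<open>auto simp: g'_def indicator_def\<close>)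
      then show ?thesis using True by (simp add: G'_def)
    next
      case False
      have "GDERIV g' x :> 0"
        by (rule GDERIV_transform_open[OF GDERIV_const[of 0], where T="- K"])
           (use False K in \<open>auto simp: g'_def compact_imp_closed\<close>)
      then show ?thesis using False by (simp add: G'_def)
    qed
  qed
  then show ?thesis by (simp add: eq g'_def)
qed

text \<open>Extended by zero across the boundary, \<open>g\<close> is differentiable everywhere and
  has compact support.\<close>

theorem interior_gauss_green:
  fixes g :: "real^'n::finite \<Rightarrow> real"
  assumes \<Omega>: "open \<Omega>" "bounded \<Omega>" and g: "C1_upto \<Omega> g G"
    and K: "compact K" "K \<subseteq> \<Omega>" and g0: "\<And>x. x \<in> \<Omega> - K \<Longrightarrow> g x = 0"
  shows "(\<integral>x. G x $ k * indicator \<Omega> x \<partial>lborel) = 0"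
proof (rule integral_partial_UNIV[where h="\<lambda>x. g x * indicator K x" and k=k])
  note C = C1_uptoD[OF g]
  have G0: "G x = 0" if "x \<in> \<Omega> - K" for x
    by (rule GDERIV_eq_0[OF C(5), where T="\<Omega> - K"])
       (use that \<Omega> K g0 closure_subset in \<open>auto simp: open_Diff compact_imp_closed\<close>)
  show "bounded_borel (\<lambda>x. G x $ k * indicator \<Omega> x)" by (rule C1_upto_bounded_borel[OF g \<Omega>])
  show "bounded {x. g x * indicator K x \<noteq> 0}"
    by (rule bounded_subset[OF compact_imp_bounded[OF K(1)]]) (auto simp: indicator_def)
  fix x
  have "GDERIV (\<lambda>x. g x * indicator K x) x :> (if x \<in> \<Omega> then G x else 0)"
  proof (cases "x \<in> \<Omega>")
    case True
    have "GDERIV (\<lambda>x. g x * indicator K x) x :> G x"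
      by (rule GDERIV_transform_open[OF C(5), where T="\<Omega>"]) (use True \<Omega> g0 in \<open>auto simp: indicator_def\<close>)
    then show ?thesis using True by simp
  next
    case False
    have "GDERIV (\<lambda>x. g x * indicator K x) x :> 0"
      by (rule GDERIV_transform_open[OF GDERIV_const[of 0], where T="- K"])
         (use False K in \<open>auto simp: compact_imp_closed\<close>)
    then show ?thesis using False by simp
  qed
  then have "((\<lambda>z. g (x + z *\<^sub>R axis k 1) * indicator K (x + z *\<^sub>R axis k 1)) has_real_derivative
      (if x \<in> \<Omega> then G x else 0) $ k) (at 0)"
    by (intro GDERIV_line) simp
  then show "((\<lambda>z. g (x + z *\<^sub>R axis k 1) * indicator K (x + z *\<^sub>R axis k 1)) has_real_derivative
      G x $ k * indicator \<Omega> x) (at 0)"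
    by (cases "x \<in> \<Omega>") auto
qed

subsection \<open>The area measure of a graph\<close>

lemma cutoff_pos_iff: "r > 0 \<Longrightarrow> cutoff c (r / 2) x > 0 \<longleftrightarrow> x \<in> ball c r"
proof -
  assume r: "r > 0"
  \<comment> \<open>With radius r/2 the threshold becomes 4 (r/2)^2 = r^2.\<close>
  have "cutoff1 v > 0 \<longleftrightarrow> v < 4" for v
    using cutoff1_denom[of v] by (cases "v < 4") (auto simp: cutoff1_def sqpos_def)
  then have "cutoff c (r / 2) x > 0 \<longleftrightarrow> (dist c x)\<^sup>2 < r\<^sup>2"
    unfolding cutoff_def inner_dist using r by (auto simp: field_simps)
  also have "\<dots> \<longleftrightarrow> dist c x < r"
    using r by (metis less_eq_real_def power2_less_imp_less power_strict_mono zero_le_dist zero_less_numeral)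
  finally show ?thesis by simp
qed

text \<open>Continuous differentiability lets these functions multiply \<open>g\<close> in
  Gauss-Green; the range [0, 1] keeps products and complements in the class and makes the powers of
  1 - \<psi> monotone.\<close>

definition test_fun :: "(real^'n::finite \<Rightarrow> real) \<Rightarrow> bool" where
  "test_fun \<psi> \<longleftrightarrow> (\<exists>\<Psi>. C1_upto UNIV \<psi> \<Psi>) \<and> (\<forall>x. 0 \<le> \<psi> x \<and> \<psi> x \<le> 1)"

lemma test_funI:
  "C1_upto UNIV \<psi> \<Psi> \<Longrightarrow> (\<And>x. 0 \<le> \<psi> x) \<Longrightarrow> (\<And>x. \<psi> x \<le> 1) \<Longrightarrow> test_fun \<psi>"
  unfolding test_fun_def by blast

lemma test_funE:
  assumes "test_fun \<psi>"
  obtains \<Psi> where "C1_upto UNIV \<psi> \<Psi>" "\<And>x. 0 \<le> \<psi> x" "\<And>x. \<psi> x \<le> 1"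
  using assms unfolding test_fun_def by blast

lemma test_fun_mult:
  assumes "test_fun \<psi>" "test_fun \<phi>" shows "test_fun (\<lambda>x. \<psi> x * \<phi> x)"
proof -
  obtain \<Psi> where 1: "C1_upto UNIV \<psi> \<Psi>" "\<And>x. 0 \<le> \<psi> x" "\<And>x. \<psi> x \<le> 1" using assms(1) by (rule test_funE) blast
  obtain \<Phi> where 2: "C1_upto UNIV \<phi> \<Phi>" "\<And>x. 0 \<le> \<phi> x" "\<And>x. \<phi> x \<le> 1" using assms(2) by (rule test_funE) blast
  show ?thesis by (rule test_funI[OF C1_upto_mult[OF 1(1) 2(1)]]) (auto intro!: mult_le_one mult_nonneg_nonneg 1 2)
qed

lemma test_fun_compl:
  assumes "test_fun \<psi>" shows "test_fun (\<lambda>x. 1 - \<psi> x)"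
proof -
  obtain \<Psi> where 1: "C1_upto UNIV \<psi> \<Psi>" "\<And>x. 0 \<le> \<psi> x" "\<And>x. \<psi> x \<le> 1" using assms(1) by (rule test_funE) blast
  show ?thesis by (rule test_funI[OF C1_upto_diff[OF C1_upto_const 1(1)]]) (use 1 in auto)
qed

lemma test_fun_const: "test_fun (\<lambda>x. 1)"
  by (rule test_funI[OF C1_upto_const]) auto

lemma test_fun_power: "test_fun \<psi> \<Longrightarrow> test_fun (\<lambda>x. \<psi> x ^ j)"
  by (induction j) (auto intro: test_fun_mult simp: test_fun_const)

lemma test_fun_cutoff: "r > 0 \<Longrightarrow> test_fun (cutoff c r)"
  by (rule test_funI[OF C1_upto_cutoff]) (auto intro: cutoff_bounds)

lemma test_fun_continuous: "test_fun \<psi> \<Longrightarrow> continuous_on UNIV \<psi>"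
  by (elim test_funE, drule C1_uptoD(1)) simp

lemma test_fun_borel [measurable_dest]: "test_fun \<psi> \<Longrightarrow> \<psi> \<in> borel_measurable borel"
  by (intro borel_measurable_continuous_onI test_fun_continuous)

text \<open>Balls are positivity sets of cutoffs, so the positivity sets contain a base of the
  topology. This shape is what \<open>second_countable_borel_measurable\<close> turns into
  generators of the Borel sets.\<close>

lemma open_generated_by_test_fun:
  "open = generate_topology {{x::real^'n::finite. \<psi> x > 0} | \<psi>. test_fun \<psi>}" (is "open = generate_topology ?X")
proof (intro ext iffI)
  fix S :: "(real^'n) set"
  assume S: "open S"
  let ?B = "{ball c r | c r. r > 0 \<and> ball c r \<subseteq> S}"
  have Seq: "S = \<Union>?B"
  proof
    show "S \<subseteq> \<Union>?B" using S openE by (smt (verit, best) Union_iff centre_in_ball mem_Collect_eq subsetI)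
  qed auto
  have "generate_topology ?X T" if "T \<in> ?B" for T
  proof -
    obtain c r where T: "T = ball c r" "r > 0" using \<open>T \<in> ?B\<close> by blast
    have "T = {x. cutoff c (r/2) x > 0}" unfolding T(1) using cutoff_pos_iff[OF T(2), of c] by blast
    moreover have "test_fun (cutoff c (r/2))" using T by (intro test_fun_cutoff) auto
    ultimately show ?thesis by (intro generate_topology.Basis) blast
  qed
  then have "generate_topology ?X (\<Union>?B)" by (rule generate_topology.UN)
  then show "generate_topology ?X S" by (subst Seq)
next
  fix S :: "(real^'n) set"
  assume "generate_topology ?X S"
  then show "open S"
  proof induction
    case (Basis S)
    then obtain \<psi> where \<psi>: "S = {x. \<psi> x > 0}" "test_fun \<psi>" by blast
    show ?case unfolding \<psi>(1) using test_fun_continuous[OF \<psi>(2)] by (intro open_Collect_less continuous_intros) auto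
  qed (auto intro: open_Union)
qed

text \<open>Monotone convergence: 1 - (1 - \<psi>)^j is again a test function and increases to the
  indicator of the positivity set, whose measure is thereby a limit of integrals of test
  functions.\<close>

lemma emeasure_test_fun_pos:
  assumes \<psi>: "test_fun \<psi>" and M: "sets M = sets borel"
  shows "(\<lambda>j. \<integral>\<^sup>+x. ennreal (1 - (1 - \<psi> x) ^ j) \<partial>M) \<longlonglongrightarrow> emeasure M {x. \<psi> x > 0}"
proof -
  note b = \<psi>[unfolded test_fun_def, THEN conjunct2, rule_format]
  have [measurable]: "\<psi> \<in> borel_measurable M"
    using test_fun_borel[OF \<psi>] M measurable_cong_sets by blast
  have sp: "space M = UNIV" using M sets_eq_imp_space_eq by force
  have "(\<lambda>j. \<integral>\<^sup>+x. ennreal (1 - (1 - \<psi> x) ^ j) \<partial>M) \<longlonglongrightarrow> (\<integral>\<^sup>+x. indicator {x. \<psi> x > 0} x \<partial>M)"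
  proof (rule nn_integral_LIMSEQ)
    show "incseq (\<lambda>j x. ennreal (1 - (1 - \<psi> x) ^ j))"
      unfolding incseq_def le_fun_def
      using b by (auto intro!: ennreal_leI power_decreasing)
    fix x
    show "(\<lambda>j. ennreal (1 - (1 - \<psi> x) ^ j)) \<longlonglongrightarrow> indicator {x. \<psi> x > 0} x"
    proof (cases "\<psi> x > 0")
      case True
      have "(\<lambda>j. ennreal (1 - (1 - \<psi> x) ^ j)) \<longlonglongrightarrow> ennreal (1 - 0)"
        by (intro tendsto_intros LIMSEQ_realpow_zero) (use b True in auto)
      then show ?thesis using True by simp
    next
      case False
      then have "\<psi> x = 0" using b[of x] by auto
      then show ?thesis by simp
    qed
  qed measurable
  moreover have "{x. \<psi> x > 0} \<in> sets M" unfolding M(1) using test_fun_borel[OF \<psi>] by measurable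
  ultimately show ?thesis by (simp add: nn_integral_indicator)
qed

text \<open>Gauss-Green yields integrals of differentiable functions only, hence this criterion. The
  positivity sets are closed under intersection, by taking products, and contain the whole space,
  which has finite measure; so uniqueness on a generator applies.\<close>

lemma measure_eqI_test_fun:
  fixes M N :: "(real^'n::finite) measure"
  assumes M: "sets M = sets borel" "emeasure M UNIV \<noteq> \<infinity>" and N: "sets N = sets borel"
    and eq: "\<And>\<psi>. test_fun \<psi> \<Longrightarrow> (\<integral>\<^sup>+x. ennreal (\<psi> x) \<partial>M) = (\<integral>\<^sup>+x. ennreal (\<psi> x) \<partial>N)"
  shows "M = N"
proof (rule measure_eqI_generator_eq[where E="{{x. \<psi> x > 0} | \<psi>. test_fun \<psi>}" and \<Omega>=UNIV and A="\<lambda>_. UNIV"])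
  let ?X = "{{x::real^'n. \<psi> x > 0} | \<psi>. test_fun \<psi>}"
  have bX: "borel = sigma UNIV ?X"
    by (rule second_countable_borel_measurable[OF open_generated_by_test_fun])
  have sb: "sets (borel :: (real^'n) measure) = sigma_sets UNIV ?X"
  proof -
    have "sets (borel :: (real^'n) measure) = sets (sigma UNIV ?X)" by (rule arg_cong[OF bX])
    also have "\<dots> = sigma_sets UNIV ?X" by (rule sets_measure_of) simp
    finally show ?thesis .
  qed
  show "sets M = sigma_sets UNIV ?X" "sets N = sigma_sets UNIV ?X" using M N sb by auto
  show "Int_stable ?X"
  proof (rule Int_stableI)
    fix a b assume "a \<in> ?X" "b \<in> ?X"
    then obtain \<psi> \<phi> where *: "a = {x. \<psi> x > 0}" "b = {x. \<phi> x > 0}" "test_fun \<psi>" "test_fun \<phi>" by blast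
    have "a \<inter> b = {x. \<psi> x * \<phi> x > 0}"
      using *(3,4) unfolding * test_fun_def by (auto simp: zero_less_mult_iff) (metis not_le)+
    then show "a \<inter> b \<in> ?X"
      using test_fun_mult[OF *(3,4)] by (intro CollectI exI[of _ "\<lambda>x. \<psi> x * \<phi> x"] conjI)
  qed
  show "?X \<subseteq> Pow UNIV" "(\<Union>i::nat. UNIV) = (UNIV :: (real^'n) set)" by auto
  show "range (\<lambda>_::nat. UNIV) \<subseteq> ?X"
    using test_fun_const by (auto intro!: exI[of _ "\<lambda>_. 1"])
  show "emeasure M UNIV \<noteq> \<infinity>" by fact
  fix S assume "S \<in> ?X"
  then obtain \<psi> where *: "S = {x. \<psi> x > 0}" "test_fun \<psi>" by blast
  have "test_fun (\<lambda>x. 1 - (1 - \<psi> x) ^ j)" for j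
    using * by (intro test_fun_compl test_fun_power)
  then have "(\<lambda>j. \<integral>\<^sup>+x. ennreal (1 - (1 - \<psi> x) ^ j) \<partial>M) = (\<lambda>j. \<integral>\<^sup>+x. ennreal (1 - (1 - \<psi> x) ^ j) \<partial>N)"
    using eq by blast
  then show "emeasure M S = emeasure N S"
    using emeasure_test_fun_pos[OF *(2) M(1)] emeasure_test_fun_pos[OF *(2) N] LIMSEQ_unique *(1) by metis
qed

text \<open>The cover is made disjoint, so that agreement inside each \<open>B j\<close> adds up. It
  is applied to chart domains and to balls.\<close>

lemma emeasure_eq_UN:
  fixes B :: "nat \<Rightarrow> 'a set"
  assumes s: "sets M = sets N" "range B \<subseteq> sets M"
    and eq: "\<And>j A. A \<in> sets M \<Longrightarrow> A \<subseteq> B j \<Longrightarrow> emeasure M A = emeasure N A"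
    and A: "A \<in> sets M" "A \<subseteq> (\<Union>j. B j)"
  shows "emeasure M A = emeasure N A"
proof -
  have D: "disjointed B j \<in> sets M" for j
    using sets.range_disjointed_sets[OF s(2)] by auto
  have dis: "disjoint_family (\<lambda>j. A \<inter> disjointed B j)"
    using disjoint_family_disjointed[of B] by (fastforce simp: disjoint_family_on_def)
  have UN: "(\<Union>j. A \<inter> disjointed B j) = A" using A(2) UN_disjointed_eq[of B] by blast
  have r: "range (\<lambda>j. A \<inter> disjointed B j) \<subseteq> sets M" using D A(1) by auto
  have "emeasure M A = (\<Sum>j. emeasure M (A \<inter> disjointed B j))"
    using suminf_emeasure[OF r dis] UN by simp
  also have "\<dots> = (\<Sum>j. emeasure N (A \<inter> disjointed B j))"
    using r disjointed_subset[of B] by (intro suminf_cong eq) blast+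
  also have "\<dots> = emeasure N A"
    using suminf_emeasure[OF _ dis, of N] r s UN by simp
  finally show ?thesis .
qed

section \<open>The area of a graph as a pushforward from the slab\<close>

definition chart_measure :: "'n::finite \<Rightarrow> (real^'n \<Rightarrow> real) \<Rightarrow> (real^'n) measure" where
  "chart_measure m \<gamma> = distr (density lborel (\<lambda>x. ennreal (sqrt (1 + (norm (grad \<gamma> x))\<^sup>2) * indicator (slab m) x)))
     borel (graph_point m \<gamma>)"

lemma sets_chart_measure [simp, measurable_cong]: "sets (chart_measure m \<gamma>) = sets borel"
  by (simp add: chart_measure_def)

lemma space_chart_measure [simp]: "space (chart_measure m \<gamma>) = UNIV"
  by (simp add: chart_measure_def)

lemma vec_nth_borel [measurable]: "(\<lambda>x::real^'n::finite. x $ k) \<in> borel_measurable borel"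
  by (intro borel_measurable_continuous_onI continuous_intros)

lemma nn_integral_chart_measure:
  fixes \<gamma> :: "real^'n::finite \<Rightarrow> real"
  assumes "C1 \<gamma>" and f [measurable]: "f \<in> borel_measurable borel"
  shows "(\<integral>\<^sup>+x. f x \<partial>chart_measure m \<gamma>) =
    (\<integral>\<^sup>+x. ennreal (sqrt (1 + (norm (grad \<gamma> x))\<^sup>2) * indicator (slab m) x) * f (graph_point m \<gamma> x) \<partial>lborel)"
proof -
  note [measurable] = C1_borel[OF assms(1)]
  have [measurable]: "graph_point m \<gamma> \<in> borel_measurable borel" by (rule graph_point_borel) measurable
  show ?thesis unfolding chart_measure_def by (subst nn_integral_distr) (auto simp: nn_integral_density)
qed

lemma vec_lambda_measurable_PiM:
  "(\<lambda>f. \<chi> k. f k) \<in> measurable (\<Pi>\<^sub>M k\<in>(UNIV::'n::finite set). lborel) (borel :: (real^'n) measure)"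
proof (rule borel_measurable_euclidean_space[THEN iffD2], intro ballI)
  fix b :: "real^'n" assume "b \<in> Basis"
  then obtain k where "b = axis k 1" by (auto simp: Basis_vec_def)
  then show "(\<lambda>f. (\<chi> k. f k) \<bullet> b) \<in> borel_measurable (\<Pi>\<^sub>M k\<in>(UNIV::'n set). lborel)"
    by (simp add: inner_axis)
qed

text \<open>Both measures give a box the product of its side lengths. This is the bridge from
  \<open>real^'n\<close> to the function space on which \<open>graph_area\<close>
  integrates.\<close>

lemma lborel_eq_PiM:
  "lborel = distr (\<Pi>\<^sub>M k\<in>(UNIV::'n::finite set). lborel) (borel :: (real^'n) measure) (\<lambda>f. \<chi> k. f k)"
proof (rule lborel_eqI)
  note [measurable] = vec_lambda_measurable_PiM
  interpret product_sigma_finite "\<lambda>_::'n. lborel :: real measure" ..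
  fix l u :: "real^'n" assume "\<And>b. b \<in> Basis \<Longrightarrow> l \<bullet> b \<le> u \<bullet> b"
  then have lu: "l $ k \<le> u $ k" for k by (metis axis_in_Basis_iff cart_eq_inner_axis one_neq_zero Basis_real_def insertI1)
  have "(\<lambda>f. \<chi> k. f k) -` box l u \<inter> space (\<Pi>\<^sub>M k\<in>(UNIV::'n set). lborel) = (\<Pi>\<^sub>E k\<in>UNIV. {l $ k<..<u $ k})"
    by (auto simp: mem_box_cart space_PiM PiE_UNIV_domain Pi_iff)
  then have "emeasure (distr (\<Pi>\<^sub>M k\<in>(UNIV::'n set). lborel) borel (\<lambda>f. \<chi> k. f k)) (box l u) = (\<Prod>k\<in>UNIV. ennreal (u $ k - l $ k))"
    by (subst emeasure_distr) (auto simp: emeasure_PiM lu)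
  also have "\<dots> = ennreal (\<Prod>k\<in>UNIV. u $ k - l $ k)" by (rule prod_ennreal) (use lu in auto)
  also have "(\<Prod>k\<in>UNIV. u $ k - l $ k) = (\<Prod>b\<in>Basis. (u - l) \<bullet> b)"
  proof -
    have "(\<Prod>b\<in>(\<lambda>k. axis k (1::real)) ` UNIV. (u - l) \<bullet> b) = (\<Prod>k\<in>UNIV. (u - l) \<bullet> axis k 1)"
      by (rule prod.reindex_cong[where l="\<lambda>k. axis k (1::real)"]) (auto simp: inj_on_def axis_eq_axis)
    moreover have "(Basis :: (real^'n) set) = (\<lambda>k. axis k (1::real)) ` UNIV" by (auto simp: Basis_vec_def)
    ultimately show ?thesis by (simp add: inner_axis)
  qed
  finally show "emeasure (distr (\<Pi>\<^sub>M k\<in>(UNIV::'n set). lborel) borel (\<lambda>f. \<chi> k. f k)) (box l u) = ennreal (\<Prod>b\<in>Basis. (u - l) \<bullet> b)" .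
qed simp

text \<open>Splitting off the m-th factor of the product measure leaves a vertical integral whose
  integrand depends on \<open>z\<close> only through the indicator of [0, 1], that is, of the
  slab.\<close>

lemma graph_area_eq:
  fixes \<gamma> :: "real^'n::finite \<Rightarrow> real"
  assumes \<gamma>: "C1 \<gamma>" and inv: "\<And>x h. \<gamma> (x + h *\<^sub>R axis m 1) = \<gamma> x" and A [measurable]: "A \<in> sets borel"
  shows "graph_area m \<gamma> A = emeasure (chart_measure m \<gamma>) A"
proof -
  interpret product_sigma_finite "\<lambda>_::'n. lborel :: real measure" ..
  note [measurable] = vec_lambda_measurable_PiM C1_borel[OF \<gamma>]
  have [measurable]: "graph_point m \<gamma> \<in> borel_measurable borel" by (rule graph_point_borel) measurable
  let ?J = "\<lambda>x. sqrt (1 + (norm (grad \<gamma> x))\<^sup>2)"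
  let ?f = "\<lambda>x. ennreal (?J x * indicator (slab m) x) * indicator A (graph_point m \<gamma> x)"
  have "emeasure (chart_measure m \<gamma>) A = (\<integral>\<^sup>+x. indicator A x \<partial>chart_measure m \<gamma>)"
    by (simp add: nn_integral_indicator)
  also have "\<dots> = (\<integral>\<^sup>+x. ?f x \<partial>lborel)"
    by (rule nn_integral_chart_measure[OF \<gamma>]) simp
  also have "\<dots> = (\<integral>\<^sup>+y. ?f (\<chi> k. y k) \<partial>(\<Pi>\<^sub>M k\<in>insert m (UNIV - {m}). lborel))"
    by (subst lborel_eq_PiM, subst nn_integral_distr) (simp_all add: insert_absorb)
  also have "\<dots> = (\<integral>\<^sup>+y. (\<integral>\<^sup>+z. ?f (\<chi> k. (y(m := z)) k) \<partial>lborel) \<partial>(\<Pi>\<^sub>M k\<in>UNIV - {m}. lborel))"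
  proof (rule product_nn_integral_insert)
    have "(\<lambda>y. ?f (\<chi> k. y k)) \<in> borel_measurable (\<Pi>\<^sub>M k\<in>(UNIV::'n set). lborel)" by measurable
    then show "(\<lambda>y. ?f (\<chi> k. y k)) \<in> borel_measurable (\<Pi>\<^sub>M k\<in>insert m (UNIV - {m}). lborel)"
      by (simp add: insert_absorb)
  qed auto
  also have "\<dots> = graph_area m \<gamma> A"
    unfolding graph_area_def Let_def
  proof (rule nn_integral_cong)
    fix y :: "'n \<Rightarrow> real"
    let ?p = "\<chi> k. if k = m then 0 else y k"
    have x: "(\<chi> k. (y(m := z)) k) = ?p + z *\<^sub>R axis m 1" for z
      by (auto simp: vec_eq_iff axis_def)
    have "?f (\<chi> k. (y(m := z)) k) = ennreal (?J ?p) * indicator A (?p + \<gamma> ?p *\<^sub>R axis m 1) * indicator {0..1} z" for z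
      unfolding x graph_point_def inv invariant_grad(1)[OF inv]
      by (auto simp: slab_def indicator_def algebra_simps)
    then show "(\<integral>\<^sup>+z. ?f (\<chi> k. (y(m := z)) k) \<partial>lborel) = ennreal (?J ?p) * indicator A (?p + \<gamma> ?p *\<^sub>R axis m 1)"
      by (simp add: nn_integral_cmult_indicator)
  qed
  finally show ?thesis ..
qed

text \<open>The slab points that project into \<open>K\<close> form a bounded set, on which the area
  density is bounded by continuity of the gradient.\<close>

lemma emeasure_chart_measure_compact:
  fixes \<gamma> :: "real^'n::finite \<Rightarrow> real"
  assumes \<gamma>: "C1 \<gamma>" and inv: "\<And>x h. \<gamma> (x + h *\<^sub>R axis m 1) = \<gamma> x" and K: "compact K"
  shows "emeasure (chart_measure m \<gamma>) K < \<infinity>"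
proof -
  obtain R where R: "\<And>x. x \<in> K \<Longrightarrow> norm x \<le> R" using compact_imp_bounded[OF K] unfolding bounded_iff by auto
  let ?J = "\<lambda>x. sqrt (1 + (norm (grad \<gamma> x))\<^sup>2)"
  have [measurable]: "K \<in> sets borel" using K by (simp add: borel_compact)
  \<comment> \<open>On the slab the projection moves \<open>x\<close> by |\<gamma> x - x_m| \<le> R
    + 1, because |\<gamma> x| is a coordinate of a point of \<open>K\<close> and hence at most
    R.\<close>
  have nb: "norm x \<le> 2 * R + 1" if "graph_point m \<gamma> x \<in> K" "x \<in> slab m" for x
  proof -
    have 1: "norm (graph_point m \<gamma> x) \<le> R" using R that by auto
    have 2: "\<bar>\<gamma> x\<bar> \<le> R" using component_le_norm_cart[of "graph_point m \<gamma> x" m] 1 invariant_graph_point[OF inv] by simp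
    have "x = graph_point m \<gamma> x - (\<gamma> x - x $ m) *\<^sub>R axis m 1" by (simp add: graph_point_def)
    then have "norm x \<le> norm (graph_point m \<gamma> x) + norm ((\<gamma> x - x $ m) *\<^sub>R axis m (1::real))"
      by (metis norm_triangle_ineq4)
    also have "norm ((\<gamma> x - x $ m) *\<^sub>R axis m (1::real)) = \<bar>\<gamma> x - x $ m\<bar>" by simp
    also have "\<dots> \<le> R + 1" using 2 that(2) by (auto simp: slab_def)
    finally show ?thesis using 1 by simp
  qed
  have "bounded (?J ` cball 0 (2*R+1))"
    using C1_continuous_grad[OF \<gamma>]
    by (intro compact_imp_bounded compact_continuous_image continuous_intros) (auto intro: continuous_on_subset)
  then obtain b where b: "\<And>x. norm x \<le> 2*R+1 \<Longrightarrow> ?J x \<le> b"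
    unfolding bounded_iff by (metis abs_le_D1 imageI mem_cball_0 real_norm_def)
  have "emeasure (chart_measure m \<gamma>) K = (\<integral>\<^sup>+x. indicator K x \<partial>chart_measure m \<gamma>)"
    by (simp add: nn_integral_indicator)
  also have "\<dots> = (\<integral>\<^sup>+x. ennreal (?J x * indicator (slab m) x) * indicator K (graph_point m \<gamma> x) \<partial>lborel)"
    by (rule nn_integral_chart_measure[OF \<gamma>]) simp
  also have "\<dots> \<le> (\<integral>\<^sup>+x. ennreal b * indicator (cball (0::real^'n) (2*R+1)) x \<partial>lborel)"
    by (intro nn_integral_mono) (use nb b in \<open>auto simp: indicator_def intro!: ennreal_leI\<close>)
  also have "\<dots> = ennreal b * emeasure lborel (cball (0::real^'n) (2*R+1))" by (simp add: nn_integral_cmult_indicator)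
  also have "\<dots> < \<infinity>" using emeasure_lborel_cball_finite[of "0::real^'n" "2*R+1"]
    by (simp add: ennreal_mult_less_top less_top)
  finally show ?thesis .
qed

text \<open>Every graph point in \<open>U\<close> is a boundary point, so the projection never hits
  \<open>A\<close>.\<close>

lemma emeasure_chart_measure_off_frontier:
  assumes ch: "boundary_chart \<Omega> U m s \<gamma>" and "open \<Omega>" and A: "A \<in> sets borel" "A \<subseteq> U" "A \<inter> frontier \<Omega> = {}"
  shows "emeasure (chart_measure m \<gamma>) A = 0"
proof -
  note c = boundary_chartD[OF ch]
  have "graph_point m \<gamma> x \<notin> A" for x
    using chart_frontier(1)[OF ch assms(2), of "graph_point m \<gamma> x"] A invariant_graph_point[OF c(5)] by auto
  then have "(\<integral>\<^sup>+x. indicator A x \<partial>chart_measure m \<gamma>) = 0"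
    using nn_integral_chart_measure[OF c(4), of "indicator A" m] A(1) by simp
  then show ?thesis using A by (simp add: nn_integral_indicator)
qed

subsection \<open>The outward unit normal\<close>

definition chart_normal :: "'n::finite \<Rightarrow> real \<Rightarrow> (real^'n \<Rightarrow> real) \<Rightarrow> real^'n \<Rightarrow> real^'n" where
  "chart_normal m s \<gamma> x = (s / sqrt (1 + (norm (grad \<gamma> x))\<^sup>2)) *\<^sub>R (axis m 1 - grad \<gamma> x)"

lemma norm_graph_normal:
  fixes \<gamma> :: "real^'n::finite \<Rightarrow> real"
  assumes inv: "\<And>x h. \<gamma> (x + h *\<^sub>R axis m 1) = \<gamma> x"
  shows "norm (axis m 1 - grad \<gamma> x) = sqrt (1 + (norm (grad \<gamma> x))\<^sup>2)"
proof -
  have "(axis m 1 - grad \<gamma> x) \<bullet> (axis m 1 - grad \<gamma> x) = 1 + grad \<gamma> x \<bullet> grad \<gamma> x"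
    using invariant_grad(2)[OF inv, of x]
    by (simp add: inner_diff inner_axis inner_axis' inner_axis_axis)
  then show ?thesis by (simp add: norm_eq_sqrt_inner)
qed

lemma norm_chart_normal:
  assumes "s = 1 \<or> s = -1" "\<And>x h. \<gamma> (x + h *\<^sub>R axis m 1) = \<gamma> x"
  shows "norm (chart_normal m s \<gamma> x) = 1"
proof -
  have "sqrt (1 + (norm (grad \<gamma> x))\<^sup>2) > 0" by (simp add: add_pos_nonneg)
  then show ?thesis
    unfolding chart_normal_def norm_scaleR norm_graph_normal[OF assms(2)] using assms(1) by auto
qed

lemma continuous_chart_normal:
  assumes "C1 \<gamma>" shows "continuous_on UNIV (chart_normal m s \<gamma>)"
proof -
  have "sqrt (1 + (norm (grad \<gamma> x))\<^sup>2) \<noteq> 0" for x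
    by (metis add_pos_nonneg less_irrefl real_sqrt_eq_zero_cancel_iff zero_le_power2 zero_less_one)
  then show ?thesis
    unfolding chart_normal_def[abs_def] using C1_continuous_grad[OF assms]
    by (intro continuous_intros) auto
qed

lemma chart_normal_nth:
  assumes "\<And>x h. \<gamma> (x + h *\<^sub>R axis m 1) = \<gamma> x"
  shows "chart_normal m s \<gamma> x $ m = s / sqrt (1 + (norm (grad \<gamma> x))\<^sup>2)"
  using invariant_grad(2)[OF assms, of x] by (simp add: chart_normal_def)

text \<open>Along a ray the defining function \<open>s * (x $ m - \<gamma> x)\<close> starts at
  zero, and its slope is a positive multiple of the product of \<open>h\<close> with the normal. The
  sign decides whether the ray enters \<Omega>, a property that does not refer to the chart.\<close>

lemma chart_inward_iff:
  fixes x :: "real^'n::finite"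
  assumes ch: "boundary_chart \<Omega> U m s \<gamma>" and "open \<Omega>" "x \<in> U" "x \<in> frontier \<Omega>"
  shows "h \<bullet> chart_normal m s \<gamma> x < 0 \<Longrightarrow> \<exists>d>0. \<forall>t. 0 < t \<and> t < d \<longrightarrow> x + t *\<^sub>R h \<in> \<Omega>"
    "h \<bullet> chart_normal m s \<gamma> x > 0 \<Longrightarrow> \<exists>d>0. \<forall>t. 0 < t \<and> t < d \<longrightarrow> x + t *\<^sub>R h \<notin> \<Omega>"
proof -
  note c = boundary_chartD[OF ch]
  define J where "J = sqrt (1 + (norm (grad \<gamma> x))\<^sup>2)"
  have J: "J > 0" unfolding J_def by (simp add: add_pos_nonneg)
  let ?\<phi> = "\<lambda>t. s * ((x + t *\<^sub>R h) $ m - \<gamma> (x + t *\<^sub>R h))"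
  have 0: "?\<phi> 0 = 0" using chart_frontier(1)[OF ch assms(2,3)] assms(4) by simp
  have D: "(?\<phi> has_real_derivative J * (h \<bullet> chart_normal m s \<gamma> x)) (at 0)"
  proof -
    have "((\<lambda>t. x + t *\<^sub>R h) has_derivative (\<lambda>t. t *\<^sub>R h)) (at 0)" by (auto intro!: derivative_eq_intros)
    moreover have "(\<gamma> has_derivative (\<lambda>h. h \<bullet> grad \<gamma> x)) (at (x + 0 *\<^sub>R h))"
      using C1_has_derivative[OF c(4)] by (simp add: gderiv_def)
    ultimately have "((\<lambda>t. \<gamma> (x + t *\<^sub>R h)) has_derivative (\<lambda>t. (t *\<^sub>R h) \<bullet> grad \<gamma> x)) (at 0)"
      by (rule has_derivative_compose)
    then have "((\<lambda>t. \<gamma> (x + t *\<^sub>R h)) has_real_derivative h \<bullet> grad \<gamma> x) (at 0)"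
      unfolding has_field_derivative_def by (simp add: mult.commute[of _ "h \<bullet> _"] fun_eq_iff)
    then have "(?\<phi> has_real_derivative s * (h $ m - h \<bullet> grad \<gamma> x)) (at 0)"
      by (auto intro!: derivative_eq_intros)
    moreover have "J * (h \<bullet> chart_normal m s \<gamma> x) = s * (h $ m - h \<bullet> grad \<gamma> x)"
      using J unfolding chart_normal_def J_def[symmetric] by (simp add: inner_diff inner_axis)
    ultimately show ?thesis by simp
  qed
  \<comment> \<open>The chart describes \<Omega> only inside \<open>U\<close>, so the ray is kept in
    a ball; adding 1 to the norm avoids a division by zero when \<open>h = 0\<close>.\<close>
  obtain d1 where d1: "d1 > 0" "\<And>t. 0 < t \<Longrightarrow> t < d1 \<Longrightarrow> x + t *\<^sub>R h \<in> U"
  proof -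
    obtain e where e: "e > 0" "ball x e \<subseteq> U" using c(1) assms(3) openE by blast
    have "x + t *\<^sub>R h \<in> U" if "0 < t" "t < e / (norm h + 1)" for t
    proof -
      have "t * norm h \<le> t * (norm h + 1)" using that by simp
      also have "\<dots> < e" using that by (simp add: field_simps add_pos_nonneg)
      finally have "dist x (x + t *\<^sub>R h) < e" using that by (simp add: dist_norm)
      then show ?thesis using e by auto
    qed
    then show ?thesis using that[of "e / (norm h + 1)"] e by (simp add: add_nonneg_pos)
  qed
  show "\<exists>d>0. \<forall>t. 0 < t \<and> t < d \<longrightarrow> x + t *\<^sub>R h \<in> \<Omega>" if "h \<bullet> chart_normal m s \<gamma> x < 0"
  proof -
    have "J * (h \<bullet> chart_normal m s \<gamma> x) < 0" using that J by (simp add: mult_pos_neg)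
    then obtain d where d: "d > 0" "\<And>t. t > 0 \<Longrightarrow> t < d \<Longrightarrow> ?\<phi> (0 + t) < ?\<phi> 0" using DERIV_neg_dec_right[OF D] by blast
    have "x + t *\<^sub>R h \<in> \<Omega>" if "0 < t" "t < min d d1" for t
    proof -
      have "?\<phi> t < 0" using d(2)[of t] that unfolding 0 by simp
      then show ?thesis using c(6)[OF d1(2)[of t]] that by simp
    qed
    then show ?thesis using d d1 by (intro exI[of _ "min d d1"]) auto
  qed
  show "\<exists>d>0. \<forall>t. 0 < t \<and> t < d \<longrightarrow> x + t *\<^sub>R h \<notin> \<Omega>" if "h \<bullet> chart_normal m s \<gamma> x > 0"
  proof -
    have "J * (h \<bullet> chart_normal m s \<gamma> x) > 0" using that J by simp
    then obtain d where d: "d > 0" "\<And>t. t > 0 \<Longrightarrow> t < d \<Longrightarrow> ?\<phi> 0 < ?\<phi> (0 + t)" using DERIV_pos_inc_right[OF D] by blast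
    have "x + t *\<^sub>R h \<notin> \<Omega>" if "0 < t" "t < min d d1" for t
    proof -
      have "?\<phi> t > 0" using d(2)[of t] that unfolding 0 by simp
      then show ?thesis using c(6)[OF d1(2)[of t]] that by simp
    qed
    then show ?thesis using d d1 by (intro exI[of _ "min d d1"]) auto
  qed
qed

text \<open>If unit normals n and n' differ, then n' - n has negative product with n and positive
  product with n': the ray in this direction enters \<Omega> according to one chart and avoids it
  according to the other.\<close>

lemma chart_normal_unique:
  fixes x :: "real^'n::finite"
  assumes ch: "boundary_chart \<Omega> U m s \<gamma>" "boundary_chart \<Omega> U' m' s' \<gamma>'" and \<Omega>: "open \<Omega>"
    and x: "x \<in> U" "x \<in> U'" "x \<in> frontier \<Omega>"
  shows "chart_normal m s \<gamma> x = chart_normal m' s' \<gamma>' x"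
proof (rule ccontr)
  let ?n = "chart_normal m s \<gamma> x" and ?n' = "chart_normal m' s' \<gamma>' x"
  assume ne: "?n \<noteq> ?n'"
  have 1: "norm ?n = 1" "norm ?n' = 1"
    using norm_chart_normal boundary_chartD(2,5)[OF ch(1)] boundary_chartD(2,5)[OF ch(2)] by blast+
  have "(norm (?n - ?n'))\<^sup>2 = 2 - 2 * (?n \<bullet> ?n')"
    using 1 by (simp add: power2_norm_eq_inner inner_diff inner_commute norm_eq_1)
  then have lt: "?n \<bullet> ?n' < 1" using ne by (smt (verit) right_minus_eq zero_less_norm_iff zero_less_power)
  have "(?n' - ?n) \<bullet> ?n < 0" "(?n' - ?n) \<bullet> ?n' > 0"
    using lt 1 by (simp_all add: inner_diff inner_commute norm_eq_1)
  then obtain d d' where d: "d > 0" "\<forall>t. 0 < t \<and> t < d \<longrightarrow> x + t *\<^sub>R (?n' - ?n) \<in> \<Omega>"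
    "d' > 0" "\<forall>t. 0 < t \<and> t < d' \<longrightarrow> x + t *\<^sub>R (?n' - ?n) \<notin> \<Omega>"
    using chart_inward_iff(1)[OF ch(1) \<Omega> x(1,3)] chart_inward_iff(2)[OF ch(2) \<Omega> x(2,3)] by blast
  have "0 < min d d' / 2 \<and> min d d' / 2 < d" "0 < min d d' / 2 \<and> min d d' / 2 < d'" using d by auto
  then show False using d by blast
qed

lemma outward_normal_eq:
  assumes ch: "boundary_chart \<Omega> U m s \<gamma>" and "open \<Omega>" "x \<in> U" "x \<in> frontier \<Omega>"
  shows "outward_normal \<Omega> x = chart_normal m s \<gamma> x"
  unfolding outward_normal_def chart_normal_def[symmetric]
  by (rule the_equality) (use assms chart_normal_unique in blast)+

lemma regular_boundaryE:
  assumes "x \<in> regular_boundary \<Omega>"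
  obtains U m s \<gamma> where "x \<in> U" "boundary_chart \<Omega> U m s \<gamma>" "x \<in> frontier \<Omega>"
  using assms unfolding regular_boundary_def by blast

lemma outward_normal_norm:
  assumes "open \<Omega>" "x \<in> regular_boundary \<Omega>" shows "norm (outward_normal \<Omega> x) = 1"
proof -
  obtain U m s \<gamma> where *: "x \<in> U" "boundary_chart \<Omega> U m s \<gamma>" "x \<in> frontier \<Omega>" using assms(2) by (rule regular_boundaryE)
  note c = boundary_chartD[OF *(2)]
  show ?thesis using outward_normal_eq[OF *(2) assms(1) *(1,3)] norm_chart_normal[OF c(2,5)] by simp
qed

text \<open>The regular boundary is relatively open in the boundary; its measurability and the
  compactness of the singular part rest on this.\<close>

lemma regular_boundary_open_cover:
  obtains W where "open W" "regular_boundary \<Omega> = frontier \<Omega> \<inter> W"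
proof
  show "open (\<Union>{U. \<exists>m s \<gamma>. boundary_chart \<Omega> U m s \<gamma>})"
    by (intro open_Union) (auto dest: boundary_chartD(1))
  show "regular_boundary \<Omega> = frontier \<Omega> \<inter> \<Union>{U. \<exists>m s \<gamma>. boundary_chart \<Omega> U m s \<gamma>}"
    unfolding regular_boundary_def by blast
qed

lemma regular_boundary_borel [measurable]: "regular_boundary \<Omega> \<in> sets borel"
proof -
  obtain W where W: "open W" "regular_boundary \<Omega> = frontier \<Omega> \<inter> W" by (rule regular_boundary_open_cover)
  show ?thesis unfolding W(2) using W(1) by (intro sets.Int) auto
qed

lemma continuous_on_outward_normal:
  assumes "open \<Omega>" shows "continuous_on (regular_boundary \<Omega>) (outward_normal \<Omega>)"
proof (rule continuous_on_eq_continuous_within[THEN iffD2], intro ballI)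
  fix x assume x: "x \<in> regular_boundary \<Omega>"
  then obtain U m s \<gamma> where *: "x \<in> U" "boundary_chart \<Omega> U m s \<gamma>" "x \<in> frontier \<Omega>" by (rule regular_boundaryE)
  note c = boundary_chartD[OF *(2)]
  have "continuous (at x within (regular_boundary \<Omega> \<inter> U)) (chart_normal m s \<gamma>)"
    using continuous_chart_normal[OF c(4)] x *(1) by (auto simp: continuous_on_eq_continuous_within intro: continuous_within_subset)
  moreover have "chart_normal m s \<gamma> y = outward_normal \<Omega> y" if "y \<in> regular_boundary \<Omega> \<inter> U" for y
    using outward_normal_eq[OF *(2) assms] that unfolding regular_boundary_def by auto
  moreover have "x \<in> regular_boundary \<Omega> \<inter> U" using x *(1) by auto
  ultimately have "continuous (at x within (regular_boundary \<Omega> \<inter> U)) (outward_normal \<Omega>)"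
    using continuous_transform_within[of x "regular_boundary \<Omega> \<inter> U" "chart_normal m s \<gamma>" 1 "outward_normal \<Omega>"] by auto
  moreover have "at x within regular_boundary \<Omega> = at x within (regular_boundary \<Omega> \<inter> U)"
    by (rule at_within_nhd[where S=U]) (use *(1) c(1) in auto)
  ultimately show "continuous (at x within regular_boundary \<Omega>) (outward_normal \<Omega>)" by simp
qed

lemma outward_normal_borel:
  assumes "open \<Omega>" shows "(\<lambda>x. outward_normal \<Omega> x $ k * indicator (regular_boundary \<Omega>) x) \<in> borel_measurable borel"
proof -
  have "(\<lambda>x. indicator (regular_boundary \<Omega>) x *\<^sub>R outward_normal \<Omega> x $ k) \<in> borel_measurable borel"
    by (intro borel_measurable_continuous_on_indicator continuous_on_component continuous_on_outward_normal assms) measurable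
  then show ?thesis by (simp add: mult.commute)
qed

lemma chart_frontier_regular:
  "boundary_chart \<Omega> U m s \<gamma> \<Longrightarrow> frontier \<Omega> \<inter> U \<subseteq> regular_boundary \<Omega>"
  unfolding regular_boundary_def by blast

text \<open>On its chart the density \<open>sqrt (1 + |\<nabla>\<gamma>|\<^sup>2)\<close> of the area cancels the denominator of the unit normal.\<close>

theorem chart_measure_gauss_green:
  fixes g :: "real^'n::finite \<Rightarrow> real"
  assumes ch: "boundary_chart \<Omega> U m s \<gamma>" and \<Omega>: "open \<Omega>" "bounded \<Omega>" and g: "C1_upto \<Omega> g G"
    and K: "compact K" "K \<subseteq> U" and g0: "\<And>x. x \<in> closure \<Omega> - K \<Longrightarrow> g x = 0"
  shows "(\<integral>x. G x $ k * indicator \<Omega> x \<partial>lborel) =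
    (\<integral>x. outward_normal \<Omega> x $ k * g x * indicator (K \<inter> frontier \<Omega>) x \<partial>chart_measure m \<gamma>)"
proof -
  note c = boundary_chartD[OF ch]
  let ?J = "\<lambda>x. sqrt (1 + (norm (grad \<gamma> x))\<^sup>2)"
  have J: "?J x > 0" for x by (simp add: add_pos_nonneg)
  note [measurable] = C1_borel[OF c(4)]
  have [measurable]: "graph_point m \<gamma> \<in> borel_measurable borel" by (rule graph_point_borel) measurable
  have cKF: "closed (K \<inter> frontier \<Omega>)" using K by (auto intro: compact_imp_closed)
  have sub: "K \<inter> frontier \<Omega> \<subseteq> regular_boundary \<Omega>" using chart_frontier_regular[OF ch] K by blast
  have "continuous_on (K \<inter> frontier \<Omega>) (\<lambda>x. outward_normal \<Omega> x $ k * g x)"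
    using continuous_on_outward_normal[OF \<Omega>(1)] sub C1_uptoD(1)[OF g]
    by (intro continuous_intros) (auto intro: continuous_on_subset simp: frontier_def)
  then have fm: "(\<lambda>x. outward_normal \<Omega> x $ k * g x * indicator (K \<inter> frontier \<Omega>) x) \<in> borel_measurable borel"
    using borel_measurable_continuous_on_indicator[of "K \<inter> frontier \<Omega>" "\<lambda>x. outward_normal \<Omega> x $ k * g x"] cKF
    by (simp add: mult.commute)
  have "(\<integral>x. outward_normal \<Omega> x $ k * g x * indicator (K \<inter> frontier \<Omega>) x \<partial>chart_measure m \<gamma>) =
      (\<integral>x. (?J x * indicator (slab m) x) *\<^sub>R (outward_normal \<Omega> (graph_point m \<gamma> x) $ k * g (graph_point m \<gamma> x) * indicator (K \<inter> frontier \<Omega>) (graph_point m \<gamma> x)) \<partial>lborel)"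
    unfolding chart_measure_def
    using measurable_compose[OF \<open>graph_point m \<gamma> \<in> borel_measurable borel\<close> fm] J fm
    by (subst integral_distr) (auto simp: integral_density less_imp_le)
  also have "\<dots> = (\<integral>x. indicator (slab m) x * (s * (axis m 1 - grad \<gamma> x) $ k *
       (g (graph_point m \<gamma> x) * indicator K (graph_point m \<gamma> x))) \<partial>lborel)"
  proof (rule Bochner_Integration.integral_cong[OF refl])
    fix x
    let ?p = "graph_point m \<gamma> x"
    show "(?J x * indicator (slab m) x) *\<^sub>R (outward_normal \<Omega> ?p $ k * g ?p * indicator (K \<inter> frontier \<Omega>) ?p) =
      indicator (slab m) x * (s * (axis m 1 - grad \<gamma> x) $ k * (g ?p * indicator K ?p))"
    proof (cases "?p \<in> K")
      case True
      then have pU: "?p \<in> U" using K by auto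
      have pF: "?p \<in> frontier \<Omega>" using chart_frontier(1)[OF ch \<Omega>(1) pU] invariant_graph_point[OF c(5)] by simp
      have "outward_normal \<Omega> ?p = chart_normal m s \<gamma> ?p" by (rule outward_normal_eq[OF ch \<Omega>(1) pU pF])
      also have "\<dots> = (s / ?J x) *\<^sub>R (axis m 1 - grad \<gamma> x)"
        unfolding chart_normal_def invariant_graph_point(2)[OF c(5)] ..
      finally have "?J x * outward_normal \<Omega> ?p $ k = s * (axis m 1 - grad \<gamma> x) $ k" using J[of x] by simp
      moreover have "(?J x * indicator (slab m) x) *\<^sub>R (outward_normal \<Omega> ?p $ k * g ?p * indicator (K \<inter> frontier \<Omega>) ?p) =
          indicator (slab m) x * ((?J x * outward_normal \<Omega> ?p $ k) * (g ?p * indicator K ?p))"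
        using True pF by (simp add: ac_simps)
      ultimately show ?thesis by simp
    qed (auto simp: indicator_def)
  qed
  also have "\<dots> = (\<integral>x. G x $ k * indicator \<Omega> x \<partial>lborel)"
    using chart_gauss_green[OF ch \<Omega> g K g0] by simp
  finally show ?thesis ..
qed

subsection \<open>Existence and uniqueness of the surface measure\<close>

text \<open>The weight is the reciprocal of the area density. Its positivity is what allows the area
  to be recovered from the m-th component of the flux.\<close>

lemma chart_normal_sign:
  assumes ch: "boundary_chart \<Omega> U m s \<gamma>" and "open \<Omega>" "x \<in> U" "x \<in> frontier \<Omega>"
  shows "0 < s * outward_normal \<Omega> x $ m" "s * outward_normal \<Omega> x $ m \<le> 1"
proof -
  note c = boundary_chartD[OF ch]
  have e: "s * outward_normal \<Omega> x $ m = 1 / sqrt (1 + (norm (grad \<gamma> x))\<^sup>2)"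
    using c(3) unfolding outward_normal_eq[OF assms] chart_normal_nth[OF c(5)] by simp
  show "0 < s * outward_normal \<Omega> x $ m" unfolding e by (simp add: add_pos_nonneg)
  have "1 \<le> sqrt (1 + (norm (grad \<gamma> x))\<^sup>2)" by simp
  then show "s * outward_normal \<Omega> x $ m \<le> 1" unfolding e
    by (subst divide_le_eq_1_pos) (auto intro: add_pos_nonneg)
qed

text \<open>Gauss-Green for the m-th component equates integrals over both graphs with the same
  integral over \<Omega>, so \<open>w\<close> times either area has the same integral against every
  test function. On the part of the boundary in \<open>A\<close> the weight \<open>w\<close> is
  positive and can be divided out; off the boundary both areas vanish in \<open>A\<close>.\<close>

lemma chart_measure_consistent_ball:
  fixes \<Omega> :: "(real^'n::finite) set"
  assumes ch: "boundary_chart \<Omega> U m s \<gamma>" "boundary_chart \<Omega> U' m' s' \<gamma>'"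
    and \<Omega>: "open \<Omega>" "bounded \<Omega>" and r: "r > 0" "cball c (2 * r) \<subseteq> U \<inter> U'"
    and A: "A \<in> sets borel" "A \<subseteq> ball c r"
  shows "emeasure (chart_measure m \<gamma>) A = emeasure (chart_measure m' \<gamma>') A"
proof -
  define K where "K = cball c (2 * r)"
  \<comment> \<open>The factor \<open>s\<close> and the index \<open>m\<close> are those of one
    chart, also when integrating against the area of the other. The two indicators make
    \<open>w\<close> Borel and supported in \<open>K\<close>.\<close>
  define w where "w = (\<lambda>x. s * (outward_normal \<Omega> x $ m * indicator (regular_boundary \<Omega>) x) * cutoff c r x * indicator (K \<inter> frontier \<Omega>) x)"
  let ?\<mu> = "chart_measure m \<gamma>" and ?\<mu>' = "chart_measure m' \<gamma>'"
  have K: "compact K" "K \<subseteq> U" "K \<subseteq> U'" using r by (auto simp: K_def)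
  have [measurable]: "(\<lambda>x. outward_normal \<Omega> x $ m * indicator (regular_boundary \<Omega>) x) \<in> borel_measurable borel"
    by (rule outward_normal_borel[OF \<Omega>(1)])
  have [measurable]: "cutoff c r \<in> borel_measurable borel" using test_fun_cutoff[OF r(1)] by (rule test_fun_borel)
  have [measurable]: "K \<in> sets borel" "frontier \<Omega> \<in> sets borel" using K by (auto simp: borel_compact)
  have wm [measurable]: "w \<in> borel_measurable borel" unfolding w_def by measurable
  have reg: "x \<in> regular_boundary \<Omega>" if "x \<in> K \<inter> frontier \<Omega>" for x
    using chart_frontier_regular[OF ch(1)] K that by blast
  have w0: "0 \<le> w x" and w1: "w x \<le> indicator K x" for x
  proof -
    have "0 \<le> w x \<and> w x \<le> indicator K x"
    proof (cases "x \<in> K \<inter> frontier \<Omega>")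
      case True
      have "0 < s * outward_normal \<Omega> x $ m" "s * outward_normal \<Omega> x $ m \<le> 1"
        using chart_normal_sign[OF ch(1) \<Omega>(1)] True K by auto
      then show ?thesis using True reg[OF True] cutoff_bounds[of c r x]
        by (auto simp: w_def mult_le_one)
    qed (auto simp: w_def indicator_def)
    then show "0 \<le> w x" "w x \<le> indicator K x" by auto
  qed
  have wpos: "w x > 0" if "x \<in> A \<inter> frontier \<Omega>" for x
  proof -
    have "x \<in> K" using that A(2) r by (auto simp: K_def)
    then have x: "x \<in> K \<inter> frontier \<Omega>" using that by auto
    have "0 < s * outward_normal \<Omega> x $ m" using chart_normal_sign[OF ch(1) \<Omega>(1)] x K by auto
    moreover have "cutoff c r x = 1" using that A(2) r by (intro cutoff_eq_1) auto
    ultimately show ?thesis using x reg[OF x] by (simp add: w_def)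
  qed
  have int: "integrable \<nu> (\<lambda>x. \<psi> x * w x)" if "\<nu> \<in> {?\<mu>, ?\<mu>'}" and tf: "test_fun \<psi>" for \<nu> \<psi>
  proof -
    have s: "sets \<nu> = sets borel" using that(1) by auto
    have "emeasure \<nu> K < \<infinity>"
      using emeasure_chart_measure_compact[OF boundary_chartD(4,5)[OF ch(1)] K(1)]
        emeasure_chart_measure_compact[OF boundary_chartD(4,5)[OF ch(2)] K(1)] that(1) by auto
    then have "integrable \<nu> (indicator K :: _ \<Rightarrow> real)"
      using s by (intro integrable_real_indicator) auto
    then show ?thesis
    proof (rule Bochner_Integration.integrable_bound)
      have "(\<lambda>x. \<psi> x * w x) \<in> borel_measurable borel" using test_fun_borel[OF that(2)] by measurable
      then show "(\<lambda>x. \<psi> x * w x) \<in> borel_measurable \<nu>" using s measurable_cong_sets by blast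
      have "norm (\<psi> x * w x) \<le> norm (indicator K x :: real)" for x
      proof -
        obtain \<Psi> where "0 \<le> \<psi> x" "\<psi> x \<le> 1" using tf by (rule test_funE) blast
        then have "\<psi> x * w x \<le> 1 * indicator K x" using w0 w1 by (intro mult_mono) auto
        then show ?thesis using w0[of x] \<open>0 \<le> \<psi> x\<close> by simp
      qed
      then show "AE x in \<nu>. norm (\<psi> x * w x) \<le> norm (indicator K x :: real)" by simp
    qed
  qed
  \<comment> \<open>The volume side of Gauss-Green does not mention the chart, and the closed ball
    of radius 2r, outside of which the cutoff vanishes, lies in both charts.\<close>
  have eqint: "(\<integral>x. \<psi> x * w x \<partial>?\<mu>) = (\<integral>x. \<psi> x * w x \<partial>?\<mu>')" if "test_fun \<psi>" for \<psi>
  proof -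
    obtain \<Psi> where \<psi>: "C1_upto UNIV \<psi> \<Psi>" using \<open>test_fun \<psi>\<close> by (rule test_funE) blast
    define g where "g = (\<lambda>x. \<psi> x * cutoff c r x)"
    obtain G where g: "C1_upto \<Omega> g G"
      using C1_upto_mult[OF C1_upto_subset[OF \<psi>] C1_upto_cutoff[OF r(1)]] unfolding g_def by blast
    have g0: "g x = 0" if "x \<in> closure \<Omega> - K" for x
      unfolding g_def using that r by (simp add: K_def cutoff_eq_0)
    have wg: "\<psi> x * w x = s * (outward_normal \<Omega> x $ m * g x * indicator (K \<inter> frontier \<Omega>) x)" for x
      using reg[of x] by (auto simp: w_def g_def indicator_def)
    have "(\<integral>x. \<psi> x * w x \<partial>?\<mu>) = s * (\<integral>x. outward_normal \<Omega> x $ m * g x * indicator (K \<inter> frontier \<Omega>) x \<partial>?\<mu>)"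
      unfolding wg by simp
    also have "\<dots> = s * (\<integral>x. outward_normal \<Omega> x $ m * g x * indicator (K \<inter> frontier \<Omega>) x \<partial>?\<mu>')"
      using chart_measure_gauss_green[OF ch(1) \<Omega> g K(1,2) g0, of m] chart_measure_gauss_green[OF ch(2) \<Omega> g K(1,3) g0, of m]
      by simp
    also have "\<dots> = (\<integral>x. \<psi> x * w x \<partial>?\<mu>')" unfolding wg by simp
    finally show ?thesis .
  qed
  have nn: "(\<integral>\<^sup>+x. ennreal (\<psi> x) \<partial>density \<nu> (\<lambda>x. ennreal (w x))) = ennreal (\<integral>x. \<psi> x * w x \<partial>\<nu>)"
    if "\<nu> \<in> {?\<mu>, ?\<mu>'}" "test_fun \<psi>" for \<nu> \<psi>
  proof -
    have s: "sets \<nu> = sets borel" using that(1) by auto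
    have [measurable]: "\<psi> \<in> borel_measurable \<nu>" "w \<in> borel_measurable \<nu>"
      using test_fun_borel[OF that(2)] wm s measurable_cong_sets by blast+
    have p0: "0 \<le> \<psi> x" for x using that(2) by (rule test_funE) blast
    have "(\<integral>\<^sup>+x. ennreal (\<psi> x) \<partial>density \<nu> (\<lambda>x. ennreal (w x))) = (\<integral>\<^sup>+x. ennreal (\<psi> x * w x) \<partial>\<nu>)"
      using w0 p0 by (subst nn_integral_density) (auto simp: ennreal_mult' mult.commute intro!: nn_integral_cong)
    also have "\<dots> = ennreal (\<integral>x. \<psi> x * w x \<partial>\<nu>)"
      by (rule nn_integral_eq_integral[OF int[OF that]]) (use w0 p0 in auto)
    finally show ?thesis .
  qed
  have "density ?\<mu> (\<lambda>x. ennreal (w x)) = density ?\<mu>' (\<lambda>x. ennreal (w x))"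
  proof (rule measure_eqI_test_fun)
    have "emeasure (density ?\<mu> (\<lambda>x. ennreal (w x))) UNIV = (\<integral>\<^sup>+x. ennreal 1 \<partial>density ?\<mu> (\<lambda>x. ennreal (w x)))"
      by simp
    also have "\<dots> \<noteq> \<infinity>" by (subst nn[OF _ test_fun_const]) auto
    finally show "emeasure (density ?\<mu> (\<lambda>x. ennreal (w x))) UNIV \<noteq> \<infinity>" .
    show "(\<integral>\<^sup>+x. ennreal (\<psi> x) \<partial>density ?\<mu> (\<lambda>x. ennreal (w x))) = (\<integral>\<^sup>+x. ennreal (\<psi> x) \<partial>density ?\<mu>' (\<lambda>x. ennreal (w x)))"
      if "test_fun \<psi>" for \<psi>
      using nn[OF _ that] eqint[OF that] by simp
  qed auto
  \<comment> \<open>Dividing by the density undoes it where \<open>w\<close> is positive.\<close>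
  moreover have rec: "emeasure \<nu> (A \<inter> frontier \<Omega>) = (\<integral>\<^sup>+x. ennreal (1 / w x) * indicator (A \<inter> frontier \<Omega>) x \<partial>density \<nu> (\<lambda>x. ennreal (w x)))"
    if "\<nu> \<in> {?\<mu>, ?\<mu>'}" for \<nu>
  proof -
    have s: "sets \<nu> = sets borel" using that(1) by auto
    have [measurable]: "w \<in> borel_measurable \<nu>" "A \<in> sets \<nu>" "frontier \<Omega> \<in> sets \<nu>"
      using wm s A measurable_cong_sets by auto
    have "(\<integral>\<^sup>+x. ennreal (1 / w x) * indicator (A \<inter> frontier \<Omega>) x \<partial>density \<nu> (\<lambda>x. ennreal (w x))) =
      (\<integral>\<^sup>+x. ennreal (w x) * (ennreal (1 / w x) * indicator (A \<inter> frontier \<Omega>) x) \<partial>\<nu>)"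
      by (subst nn_integral_density) auto
    also have "\<dots> = (\<integral>\<^sup>+x. indicator (A \<inter> frontier \<Omega>) x \<partial>\<nu>)"
    proof (rule nn_integral_cong)
      fix x show "ennreal (w x) * (ennreal (1 / w x) * indicator (A \<inter> frontier \<Omega>) x) = indicator (A \<inter> frontier \<Omega>) x"
      proof (cases "x \<in> A \<inter> frontier \<Omega>")
        case True
        then have "ennreal (w x) * ennreal (1 / w x) = 1"
          using wpos[OF True] by (simp add: ennreal_mult[symmetric])
        then show ?thesis using True by simp
      qed auto
    qed
    finally show ?thesis by simp
  qed
  moreover have "emeasure \<nu> A = emeasure \<nu> (A \<inter> frontier \<Omega>)" if "\<nu> \<in> {?\<mu>, ?\<mu>'}" for \<nu>
  proof -
    have s: "sets \<nu> = sets borel" using that(1) by auto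
    have "A \<subseteq> K" using A(2) r by (auto simp: K_def)
    then have "emeasure \<nu> (A - frontier \<Omega>) = 0"
      using emeasure_chart_measure_off_frontier[OF ch(1) \<Omega>(1), of "A - frontier \<Omega>"]
        emeasure_chart_measure_off_frontier[OF ch(2) \<Omega>(1), of "A - frontier \<Omega>"] that K A(1) by auto
    moreover have "emeasure \<nu> (A \<inter> frontier \<Omega>) + emeasure \<nu> (A - frontier \<Omega>) = emeasure \<nu> ((A \<inter> frontier \<Omega>) \<union> (A - frontier \<Omega>))"
      by (rule plus_emeasure) (use s A in auto)
    ultimately show ?thesis by (simp add: Int_Diff_Un)
  qed
  ultimately show ?thesis by simp
qed

text \<open>The doubled closed balls stay in \<open>W\<close>, which leaves room for a cutoff that
  is one on the ball and vanishes outside \<open>W\<close>. Countability comes from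
  Lindelof.\<close>

lemma open_UN_balls:
  fixes W :: "'a::euclidean_space set"
  assumes "open W" "W \<noteq> {}"
  obtains c :: "nat \<Rightarrow> 'a" and r where "\<And>j. r j > 0" "\<And>j. cball (c j) (2 * r j) \<subseteq> W" "W = (\<Union>j. ball (c j) (r j))"
proof -
  let ?P = "{(c, r). r > (0::real) \<and> cball c (2 * r) \<subseteq> W}"
  let ?F = "(\<lambda>(c, r). ball c r) ` ?P"
  have "W \<subseteq> \<Union>?F"
  proof
    fix x assume "x \<in> W"
    then obtain e where e: "e > 0" "cball x e \<subseteq> W" using assms(1) open_contains_cball by blast
    then have "(x, e/2) \<in> ?P" by simp
    moreover have "x \<in> ball x (e/2)" using e by simp
    ultimately show "x \<in> \<Union>?F" by blast
  qed
  moreover have "\<Union>?F \<subseteq> W"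
  proof
    fix y assume "y \<in> \<Union>?F"
    then obtain c r where "r > 0" "cball c (2 * r) \<subseteq> W" "y \<in> ball c r" by blast
    then show "y \<in> W" by (auto intro!: subsetD[of "cball c (2 * r)" W])
  qed
  ultimately have W: "W = \<Union>?F" by blast
  obtain F' where F': "F' \<subseteq> ?F" "countable F'" "\<Union>F' = \<Union>?F"
  proof (rule Lindelof[of ?F])
    show "open S" if "S \<in> ?F" for S using that by auto
  qed blast
  have ne: "F' \<noteq> {}" using F'(3) W assms(2) by auto
  define B where "B = from_nat_into F'"
  have rB: "range B = F'" unfolding B_def using F'(2) ne by (rule range_from_nat_into[rotated])
  have "\<exists>c r. r > 0 \<and> cball c (2 * r) \<subseteq> W \<and> B j = ball c r" for j
  proof -
    have "B j \<in> ?F" using rB F'(1) by blast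
    then show ?thesis by auto
  qed
  then obtain c r where cr: "\<And>j. r j > 0" "\<And>j. cball (c j) (2 * r j) \<subseteq> W" "\<And>j. B j = ball (c j) (r j)"
    by metis
  have "W = (\<Union>j. B j)" using W F'(3) rB by (simp only:)
  then show ?thesis using that[of r c] cr by simp
qed

text \<open>The overlap of the two charts is exhausted by countably many balls to which
  \<open>chart_measure_consistent_ball\<close> applies.\<close>

lemma chart_measure_consistent:
  fixes \<Omega> :: "(real^'n::finite) set"
  assumes ch: "boundary_chart \<Omega> U m s \<gamma>" "boundary_chart \<Omega> U' m' s' \<gamma>'"
    and \<Omega>: "open \<Omega>" "bounded \<Omega>" and A: "A \<in> sets borel" "A \<subseteq> U" "A \<subseteq> U'"
  shows "emeasure (chart_measure m \<gamma>) A = emeasure (chart_measure m' \<gamma>') A"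
proof (cases "U \<inter> U' = {}")
  case False
  have oW: "open (U \<inter> U')" using boundary_chartD(1)[OF ch(1)] boundary_chartD(1)[OF ch(2)] by auto
  obtain c r where cr: "\<And>j::nat. r j > 0" "\<And>j. cball (c j) (2 * r j) \<subseteq> U \<inter> U'" "U \<inter> U' = (\<Union>j. ball (c j) (r j))"
    by (rule open_UN_balls[OF oW False]) blast
  show ?thesis
  proof (rule emeasure_eq_UN[where B="\<lambda>j. ball (c j) (r j)"])
    show "emeasure (chart_measure m \<gamma>) A' = emeasure (chart_measure m' \<gamma>') A'"
      if "A' \<in> sets (chart_measure m \<gamma>)" "A' \<subseteq> ball (c j) (r j)" for j A'
      using chart_measure_consistent_ball[OF ch \<Omega> cr(1,2), of A' j] that by simp
    show "A \<subseteq> (\<Union>j. ball (c j) (r j))" using A cr(3) by blast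
  qed (use A in auto)
next
  case True
  then have "A = {}" using A(2,3) by blast
  then show ?thesis by simp
qed

text \<open>The predicate under the definite description in \<open>surface_measure\<close>, which
  has a meaning only once existence and uniqueness are known.\<close>

definition is_surface_measure :: "(real^'n::finite) set \<Rightarrow> (real^'n) measure \<Rightarrow> bool" where
  "is_surface_measure \<Omega> \<sigma> \<longleftrightarrow> sets \<sigma> = sets borel \<and> emeasure \<sigma> (- regular_boundary \<Omega>) = 0 \<and>
     (\<forall>U m s \<gamma> A. boundary_chart \<Omega> U m s \<gamma> \<and> A \<in> sets borel \<and> A \<subseteq> U \<longrightarrow>
           emeasure \<sigma> A = graph_area m \<gamma> A)"

lemma countable_chart_cover:
  fixes \<Omega> :: "(real^'n::finite) set"
  obtains U m s \<gamma> where "\<And>j::nat. boundary_chart \<Omega> (U j) (m j) (s j) (\<gamma> j)" "regular_boundary \<Omega> = frontier \<Omega> \<inter> (\<Union>j. U j)"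
proof -
  let ?F = "{U. \<exists>m s \<gamma>. boundary_chart \<Omega> U m s \<gamma>}"
  obtain F' where F': "F' \<subseteq> ?F" "countable F'" "\<Union>F' = \<Union>?F"
  proof (rule Lindelof[of ?F])
    show "open S" if "S \<in> ?F" for S using that by (auto dest: boundary_chartD(1))
  qed blast
  \<comment> \<open>The empty set is a chart domain, with \<gamma> = 0. It is added so that the
    family can be enumerated even if the countable subfamily is empty.\<close>
  have g0: "GDERIV (\<lambda>x::real^'n. 0) x :> 0" for x by (rule GDERIV_const)
  then have "grad (\<lambda>x::real^'n. 0) = (\<lambda>x. 0)" using GDERIV_imp_grad by blast
  then have "C1 (\<lambda>x::real^'n. 0)" by (simp add: C1_def)
  then have e: "{} \<in> ?F" unfolding boundary_chart_def by auto
  define B where "B = from_nat_into (insert {} F')"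
  have rB: "range B = insert {} F'" unfolding B_def using F'(2) by (intro range_from_nat_into) auto
  have "\<forall>j. \<exists>m s \<gamma>. boundary_chart \<Omega> (B j) m s \<gamma>"
  proof
    fix j
    have "B j \<in> insert {} F'" using rB by blast
    then have "B j \<in> ?F" using e F'(1) by (metis insert_iff subsetD)
    then show "\<exists>m s \<gamma>. boundary_chart \<Omega> (B j) m s \<gamma>" by simp
  qed
  then obtain m s \<gamma> where "\<And>j. boundary_chart \<Omega> (B j) (m j) (s j) (\<gamma> j)" by metis
  moreover have "regular_boundary \<Omega> = frontier \<Omega> \<inter> (\<Union>j. B j)"
    using rB F'(3) unfolding regular_boundary_def by auto
  ultimately show ?thesis using that by blast
qed

text \<open>A countable chart cover is made disjoint and the chart areas of the pieces are added. In
  any further chart the area formula holds piece by piece, by consistency.\<close>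

lemma surface_measure_exists:
  fixes \<Omega> :: "(real^'n::finite) set"
  assumes \<Omega>: "open \<Omega>" "bounded \<Omega>"
  shows "\<exists>\<sigma>. is_surface_measure \<Omega> \<sigma>"
proof -
  obtain U m s \<gamma> where ch: "\<And>j::nat. boundary_chart \<Omega> (U j) (m j) (s j) (\<gamma> j)"
    and reg: "regular_boundary \<Omega> = frontier \<Omega> \<inter> (\<Union>j. U j)" using countable_chart_cover by blast
  let ?\<mu> = "\<lambda>j. chart_measure (m j) (\<gamma> j)"
  define D where "D = disjointed U"
  have U: "U j \<in> sets borel" for j using boundary_chartD(1)[OF ch] by auto
  then have D [measurable]: "D j \<in> sets borel" for j
    unfolding D_def using sets.range_disjointed_sets[of U borel] by auto
  have DU: "D j \<subseteq> U j" for j unfolding D_def by (rule disjointed_subset)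
  have Ddis: "disjoint_family D" unfolding D_def by (rule disjoint_family_disjointed)
  have DUN: "(\<Union>j. D j) = (\<Union>j. U j)" unfolding D_def by (rule UN_disjointed_eq)
  define f where "f = (\<lambda>A. \<Sum>j. emeasure (?\<mu> j) (A \<inter> D j))"
  define \<sigma> where "\<sigma> = measure_of UNIV (sets (borel :: (real^'n) measure)) f"
  have ca: "countably_additive (sets borel) f"
    unfolding countably_additive_def
  proof (intro allI impI)
    fix A :: "nat \<Rightarrow> (real^'n) set"
    assume A: "range A \<subseteq> sets borel" "disjoint_family A" "(\<Union>i. A i) \<in> sets borel"
    \<comment> \<open>Summation is written as integration over the counting measure in order to
      interchange two series in \<open>ennreal\<close>.\<close>
    have "(\<Sum>i. f (A i)) = (\<Sum>i. \<integral>\<^sup>+j. emeasure (?\<mu> j) (A i \<inter> D j) \<partial>count_space UNIV)"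
      unfolding f_def by (simp add: nn_integral_count_space_nat)
    also have "\<dots> = (\<integral>\<^sup>+j. (\<Sum>i. emeasure (?\<mu> j) (A i \<inter> D j)) \<partial>count_space UNIV)"
      by (rule nn_integral_suminf[symmetric]) simp
    also have "\<dots> = (\<Sum>j. (\<Sum>i. emeasure (?\<mu> j) (A i \<inter> D j)))"
      by (simp add: nn_integral_count_space_nat)
    also have "\<dots> = (\<Sum>j. emeasure (?\<mu> j) ((\<Union>i. A i) \<inter> D j))"
    proof (rule suminf_cong)
      fix j
      have "(\<Sum>i. emeasure (?\<mu> j) (A i \<inter> D j)) = emeasure (?\<mu> j) (\<Union>i. A i \<inter> D j)"
        using A D by (intro suminf_emeasure) (auto simp: disjoint_family_on_def)
      then show "(\<Sum>i. emeasure (?\<mu> j) (A i \<inter> D j)) = emeasure (?\<mu> j) ((\<Union>i. A i) \<inter> D j)" by simp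
    qed
    finally show "(\<Sum>i. f (A i)) = f (\<Union>i. A i)" unfolding f_def .
  qed
  have em: "emeasure \<sigma> A = f A" if "A \<in> sets borel" for A
    unfolding \<sigma>_def
    by (rule emeasure_measure_of_sigma[OF _ _ ca that])
       (use sets.sigma_algebra_axioms[of "borel :: (real^'n) measure"] in \<open>auto simp: positive_def f_def\<close>)
  have ss: "sets \<sigma> = sets borel" unfolding \<sigma>_def
    using sets.sigma_sets_eq[of "borel :: (real^'n) measure"] by (simp add: sets_measure_of_conv)
  have "emeasure \<sigma> (- regular_boundary \<Omega>) = 0"
  proof -
    have "emeasure (?\<mu> j) (- regular_boundary \<Omega> \<inter> D j) = 0" for j
    proof (rule emeasure_chart_measure_off_frontier[OF ch \<Omega>(1)])
      show "- regular_boundary \<Omega> \<inter> D j \<in> sets borel" by measurable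
    qed (use DU[of j] reg in auto)
    then show ?thesis using regular_boundary_borel by (subst em) (auto simp: f_def)
  qed
  moreover have "emeasure \<sigma> A = graph_area m' \<gamma>' A"
    if ch': "boundary_chart \<Omega> U' m' s' \<gamma>'" and A: "A \<in> sets borel" "A \<subseteq> U'" for U' m' s' \<gamma>' A
  proof -
    let ?\<mu>' = "chart_measure m' \<gamma>'"
    have "f A = (\<Sum>j. emeasure ?\<mu>' (A \<inter> D j))"
      unfolding f_def
      by (intro suminf_cong chart_measure_consistent[OF ch ch' \<Omega>]) (use A DU D in auto)
    also have "\<dots> = emeasure ?\<mu>' (\<Union>j. A \<inter> D j)"
      using Ddis A D by (intro suminf_emeasure) (auto simp: disjoint_family_on_def)
    also have "(\<Union>j. A \<inter> D j) = A \<inter> (\<Union>j. U j)" using DUN by blast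
    \<comment> \<open>The part of \<open>A\<close> outside all chosen charts misses the boundary,
      because \<open>A\<close> lies in a chart and the chosen charts cover the regular boundary; so
      it is null for the new chart.\<close>
    also have "emeasure ?\<mu>' (A \<inter> (\<Union>j. U j)) = emeasure ?\<mu>' (A \<inter> (\<Union>j. U j)) + emeasure ?\<mu>' (A - (\<Union>j. U j))"
    proof -
      have "A \<inter> frontier \<Omega> \<subseteq> (\<Union>j. U j)"
        using chart_frontier_regular[OF ch'] A reg by blast
      then have "emeasure ?\<mu>' (A - (\<Union>j. U j)) = 0"
        by (intro emeasure_chart_measure_off_frontier[OF ch' \<Omega>(1)]) (use A U in auto)
      then show ?thesis by simp
    qed
    also have "\<dots> = emeasure ?\<mu>' ((A \<inter> (\<Union>j. U j)) \<union> (A - (\<Union>j. U j)))"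
      by (rule plus_emeasure) (use A U in auto)
    also have "\<dots> = emeasure ?\<mu>' A" by (simp add: Int_Diff_Un)
    also have "\<dots> = graph_area m' \<gamma>' A"
      using graph_area_eq[OF boundary_chartD(4,5)[OF ch'] A(1)] by simp
    finally show ?thesis using em A by simp
  qed
  ultimately have "is_surface_measure \<Omega> \<sigma>" unfolding is_surface_measure_def using ss by blast
  then show ?thesis ..
qed

lemma is_surface_measureD:
  assumes "is_surface_measure \<Omega> \<sigma>"
  shows "sets \<sigma> = sets borel" "emeasure \<sigma> (- regular_boundary \<Omega>) = 0"
    "\<And>U m s \<gamma> A. boundary_chart \<Omega> U m s \<gamma> \<Longrightarrow> A \<in> sets borel \<Longrightarrow> A \<subseteq> U \<Longrightarrow>
       emeasure \<sigma> A = emeasure (chart_measure m \<gamma>) A"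
  using assms unfolding is_surface_measure_def
  by (auto simp: graph_area_eq[OF boundary_chartD(4,5)])

text \<open>The area formula fixes the measure inside every chart domain, countably many of these
  cover the regular boundary, and the rest is null.\<close>

lemma surface_measure_unique:
  fixes \<Omega> :: "(real^'n::finite) set"
  assumes \<sigma>: "is_surface_measure \<Omega> \<sigma>" and \<tau>: "is_surface_measure \<Omega> \<tau>"
  shows "\<sigma> = \<tau>"
proof (rule measure_eqI)
  note a = is_surface_measureD[OF \<sigma>] and b = is_surface_measureD[OF \<tau>]
  show "sets \<sigma> = sets \<tau>" using a b by simp
  fix A assume "A \<in> sets \<sigma>"
  then have A: "A \<in> sets borel" using a by simp
  obtain U m s \<gamma> where ch: "\<And>j::nat. boundary_chart \<Omega> (U j) (m j) (s j) (\<gamma> j)"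
    and reg: "regular_boundary \<Omega> = frontier \<Omega> \<inter> (\<Union>j. U j)" using countable_chart_cover by blast
  have split: "emeasure \<nu> A = emeasure \<nu> (A \<inter> regular_boundary \<Omega>)"
    if "sets \<nu> = sets borel" "emeasure \<nu> (- regular_boundary \<Omega>) = 0" for \<nu> :: "(real^'n) measure"
  proof -
    have "emeasure \<nu> (A - regular_boundary \<Omega>) \<le> emeasure \<nu> (- regular_boundary \<Omega>)"
      by (rule emeasure_mono) (use that regular_boundary_borel[of \<Omega>] in auto)
    then have 0: "emeasure \<nu> (A - regular_boundary \<Omega>) = 0" using that(2) by simp
    have "emeasure \<nu> (A \<inter> regular_boundary \<Omega>) + emeasure \<nu> (A - regular_boundary \<Omega>) =
        emeasure \<nu> ((A \<inter> regular_boundary \<Omega>) \<union> (A - regular_boundary \<Omega>))"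
      by (rule plus_emeasure) (use that A regular_boundary_borel[of \<Omega>] in auto)
    then show ?thesis using 0 by (simp add: Int_Diff_Un)
  qed
  have "emeasure \<sigma> (A \<inter> regular_boundary \<Omega>) = emeasure \<tau> (A \<inter> regular_boundary \<Omega>)"
  proof (rule emeasure_eq_UN[where B=U])
    show "range U \<subseteq> sets \<sigma>" using a(1) boundary_chartD(1)[OF ch] by auto
    show "emeasure \<sigma> A = emeasure \<tau> A" if "A \<in> sets \<sigma>" "A \<subseteq> U j" for j A
      using a(3)[OF ch[of j], of A] b(3)[OF ch[of j], of A] that a(1) by simp
  qed (use a b A reg regular_boundary_borel[of \<Omega>] in auto)
  then show "emeasure \<sigma> A = emeasure \<tau> A" using split[OF a(1,2)] split[OF b(1,2)] by simp
qed

lemma surface_measure: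
  fixes \<Omega> :: "(real^'n::finite) set"
  assumes \<Omega>: "open \<Omega>" "bounded \<Omega>"
  shows "is_surface_measure \<Omega> (surface_measure \<Omega>)"
proof -
  obtain \<sigma> where \<sigma>: "is_surface_measure \<Omega> \<sigma>" using surface_measure_exists[OF \<Omega>] by blast
  have "surface_measure \<Omega> = (THE \<sigma>. is_surface_measure \<Omega> \<sigma>)"
    unfolding surface_measure_def is_surface_measure_def ..
  also have "is_surface_measure \<Omega> \<dots>"
    using \<sigma> by (rule theI) (rule surface_measure_unique[OF _ \<sigma>])
  finally show ?thesis .
qed

lemmas surface_measureD = is_surface_measureD[OF surface_measure]

text \<open>The two measures agree on Borel subsets of \<open>U\<close>, so they become equal after
  restriction by the density that is the indicator of \<open>U\<close>, and this restriction leaves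
  the integral of \<open>f\<close> unchanged.\<close>

lemma integral_surface_measure_chart:
  fixes \<Omega> :: "(real^'n::finite) set" and f :: "real^'n \<Rightarrow> real"
  assumes \<Omega>: "open \<Omega>" "bounded \<Omega>" and ch: "boundary_chart \<Omega> U m s \<gamma>"
    and f: "f \<in> borel_measurable borel" "\<And>x. x \<notin> U \<Longrightarrow> f x = 0"
  shows "(\<integral>x. f x \<partial>surface_measure \<Omega>) = (\<integral>x. f x \<partial>chart_measure m \<gamma>)"
proof -
  note S = surface_measureD[OF \<Omega>]
  have U: "U \<in> sets borel" using boundary_chartD(1)[OF ch] by simp
  have eq: "density (surface_measure \<Omega>) (\<lambda>x. ennreal (indicator U x)) = density (chart_measure m \<gamma>) (\<lambda>x. ennreal (indicator U x))"
  proof (rule measure_eqI)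
    fix A assume "A \<in> sets (density (surface_measure \<Omega>) (\<lambda>x. ennreal (indicator U x)))"
    then have A: "A \<in> sets borel" using S by simp
    have "emeasure (density \<nu> (\<lambda>x. ennreal (indicator U x))) A = emeasure \<nu> (U \<inter> A)" if "sets \<nu> = sets borel" for \<nu> :: "(real^'n) measure"
    proof -
      have [measurable]: "U \<in> sets \<nu>" "A \<in> sets \<nu>" using U A that by auto
      have "emeasure (density \<nu> (\<lambda>x. ennreal (indicator U x))) A = (\<integral>\<^sup>+x. ennreal (indicator U x) * indicator A x \<partial>\<nu>)"
        by (rule emeasure_density) auto
      also have "\<dots> = (\<integral>\<^sup>+x. indicator (U \<inter> A) x \<partial>\<nu>)"
        by (rule nn_integral_cong) (auto simp: indicator_def)
      also have "\<dots> = emeasure \<nu> (U \<inter> A)" by (rule nn_integral_indicator) auto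
      finally show ?thesis .
    qed
    then show "emeasure (density (surface_measure \<Omega>) (\<lambda>x. ennreal (indicator U x))) A = emeasure (density (chart_measure m \<gamma>) (\<lambda>x. ennreal (indicator U x))) A"
      using S(1) S(3)[OF ch, of "U \<inter> A"] U A by simp
  qed (use S in simp)
  have int: "(\<integral>x. f x \<partial>\<nu>) = (\<integral>x. f x \<partial>density \<nu> (\<lambda>x. ennreal (indicator U x)))" if "sets \<nu> = sets borel" for \<nu> :: "(real^'n) measure"
  proof -
    have "f \<in> borel_measurable \<nu>" "U \<in> sets \<nu>" using f U that measurable_cong_sets by blast+
    then have "(\<integral>x. f x \<partial>density \<nu> (\<lambda>x. ennreal (indicator U x))) = (\<integral>x. indicator U x *\<^sub>R f x \<partial>\<nu>)"
      by (intro integral_density) auto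
    also have "\<dots> = (\<integral>x. f x \<partial>\<nu>)" using f(2) by (intro Bochner_Integration.integral_cong) (auto simp: indicator_def)
    finally show ?thesis ..
  qed
  show ?thesis using int[of "surface_measure \<Omega>"] int[of "chart_measure m \<gamma>"] eq S by simp
qed

subsection \<open>The Gauss-Green formula\<close>

text \<open>The normal has unit length, so one constant bounds both the flux and \<open>g\<close>;
  it dominates the surface and the volume integrals in \<open>gauss_green\<close>.\<close>

lemma C1_upto_surface_bounded:
  fixes g :: "real^'n::finite \<Rightarrow> real"
  assumes "open \<Omega>" "C1_upto \<Omega> g G"
  obtains B where "B > 0" "\<And>x. \<bar>outward_normal \<Omega> x $ k * g x * indicator (regular_boundary \<Omega>) x\<bar> \<le> B * indicator (regular_boundary \<Omega>) x"
    "\<And>x. x \<in> closure \<Omega> \<Longrightarrow> \<bar>g x\<bar> \<le> B"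
proof -
  obtain b where "\<And>x. x \<in> closure \<Omega> \<Longrightarrow> \<bar>g x\<bar> \<le> b"
    using C1_uptoD(2)[OF assms(2)] unfolding bounded_iff by (metis imageI real_norm_def)
  then have b: "\<And>x. x \<in> closure \<Omega> \<Longrightarrow> \<bar>g x\<bar> \<le> max b 1" by (meson le_max_iff_disj)
  show ?thesis
  proof (rule that[of "max b 1"])
    fix x
    show "\<bar>outward_normal \<Omega> x $ k * g x * indicator (regular_boundary \<Omega>) x\<bar> \<le> max b 1 * indicator (regular_boundary \<Omega>) x"
    proof (cases "x \<in> regular_boundary \<Omega>")
      case True
      then have "\<bar>outward_normal \<Omega> x $ k\<bar> \<le> 1"
        using outward_normal_norm[OF assms(1) True] component_le_norm_cart[of "outward_normal \<Omega> x" k] by simp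
      moreover have "\<bar>g x\<bar> \<le> max b 1" using b True by (auto simp: regular_boundary_def frontier_def)
      ultimately have "\<bar>outward_normal \<Omega> x $ k\<bar> * \<bar>g x\<bar> \<le> 1 * max b 1" by (intro mult_mono) auto
      then show ?thesis using True by (simp add: abs_mult)
    qed simp
  qed (use b in auto)
qed

lemma C1_upto_surface_borel:
  fixes g :: "real^'n::finite \<Rightarrow> real"
  assumes "open \<Omega>" "continuous_on (closure \<Omega>) g"
  shows "(\<lambda>x. outward_normal \<Omega> x $ k * g x * indicator (regular_boundary \<Omega>) x) \<in> borel_measurable borel"
proof -
  have "regular_boundary \<Omega> \<subseteq> closure \<Omega>" by (auto simp: regular_boundary_def frontier_def)
  then have "(\<lambda>x. indicator (regular_boundary \<Omega>) x *\<^sub>R (outward_normal \<Omega> x $ k * g x)) \<in> borel_measurable borel"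
    by (intro borel_measurable_continuous_on_indicator regular_boundary_borel continuous_intros
        continuous_on_outward_normal assms(1) continuous_on_subset[OF assms(2)])
  then show ?thesis by (simp add: mult.commute)
qed

lemma C1_upto_surface_integrable:
  fixes g :: "real^'n::finite \<Rightarrow> real"
  assumes \<Omega>: "open \<Omega>" "bounded \<Omega>" and fin: "emeasure (surface_measure \<Omega>) (regular_boundary \<Omega>) < \<infinity>"
    and g: "C1_upto \<Omega> g G"
  shows "integrable (surface_measure \<Omega>) (\<lambda>x. outward_normal \<Omega> x $ k * g x * indicator (regular_boundary \<Omega>) x)"
proof -
  note S = surface_measureD[OF \<Omega>]
  obtain B where B: "\<And>x. \<bar>outward_normal \<Omega> x $ k * g x * indicator (regular_boundary \<Omega>) x\<bar> \<le> B * indicator (regular_boundary \<Omega>) x"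
    using C1_upto_surface_bounded[OF \<Omega>(1) g] by metis
  have "integrable (surface_measure \<Omega>) (\<lambda>x. B * indicator (regular_boundary \<Omega>) x)"
    using fin S(1) regular_boundary_borel[of \<Omega>] by (intro integrable_mult_right integrable_real_indicator) auto
  then show ?thesis
  proof (rule Bochner_Integration.integrable_bound)
    show "(\<lambda>x. outward_normal \<Omega> x $ k * g x * indicator (regular_boundary \<Omega>) x) \<in> borel_measurable (surface_measure \<Omega>)"
      using C1_upto_surface_borel[OF \<Omega>(1) C1_uptoD(1)[OF g]] S(1) measurable_cong_sets by blast
    show "AE x in surface_measure \<Omega>. norm (outward_normal \<Omega> x $ k * g x * indicator (regular_boundary \<Omega>) x) \<le> norm (B * indicator (regular_boundary \<Omega>) x)"
      using B by (auto intro!: AE_I2 order_trans[OF B])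
  qed
qed

text \<open>Boundary points in \<open>K\<close> are regular because they lie in the chart, and
  \<open>g\<close> vanishes at the others; hence the indicator of the regular boundary can be
  exchanged for that of \<open>K \<inter> frontier \<Omega>\<close>.\<close>

lemma gauss_green_in_chart:
  fixes g :: "real^'n::finite \<Rightarrow> real"
  assumes \<Omega>: "open \<Omega>" "bounded \<Omega>" and ch: "boundary_chart \<Omega> U m s \<gamma>" and g: "C1_upto \<Omega> g G"
    and K: "compact K" "K \<subseteq> U" and g0: "\<And>x. x \<in> closure \<Omega> - K \<Longrightarrow> g x = 0"
  shows "(\<integral>x. G x $ k * indicator \<Omega> x \<partial>lborel) =
    (\<integral>x. outward_normal \<Omega> x $ k * g x * indicator (regular_boundary \<Omega>) x \<partial>surface_measure \<Omega>)"
proof -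
  have reg: "x \<in> regular_boundary \<Omega>" if "x \<in> K \<inter> frontier \<Omega>" for x
    using chart_frontier_regular[OF ch] K that by blast
  have eq: "outward_normal \<Omega> x $ k * g x * indicator (regular_boundary \<Omega>) x = outward_normal \<Omega> x $ k * g x * indicator (K \<inter> frontier \<Omega>) x" for x
  proof (cases "x \<in> regular_boundary \<Omega>")
    case True
    then have x: "x \<in> frontier \<Omega>" "x \<in> closure \<Omega>" by (auto simp: regular_boundary_def frontier_def)
    then show ?thesis using True g0[of x] by (auto simp: indicator_def)
  next
    case False
    then show ?thesis using reg[of x] by (auto simp: indicator_def)
  qed
  have "(\<integral>x. outward_normal \<Omega> x $ k * g x * indicator (regular_boundary \<Omega>) x \<partial>surface_measure \<Omega>) =
      (\<integral>x. outward_normal \<Omega> x $ k * g x * indicator (regular_boundary \<Omega>) x \<partial>chart_measure m \<gamma>)"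
  proof (rule integral_surface_measure_chart[OF \<Omega> ch C1_upto_surface_borel[OF \<Omega>(1) C1_uptoD(1)[OF g]]])
    show "outward_normal \<Omega> x $ k * g x * indicator (regular_boundary \<Omega>) x = 0" if "x \<notin> U" for x
      unfolding eq using that K by (auto simp: indicator_def)
  qed
  then show ?thesis using chart_measure_gauss_green[OF ch \<Omega> g K g0, of k] unfolding eq by simp
qed

text \<open>Induction on the balls takes the place of a partition of unity: with the cutoff \<psi>
  of one ball, \<psi> g is supported in a single chart, and (1 - \<psi>) g vanishes on that ball,
  hence satisfies the hypothesis for the remaining ones.\<close>

lemma gauss_green_chart_balls:
  fixes g :: "real^'n::finite \<Rightarrow> real"
  assumes \<Omega>: "open \<Omega>" "bounded \<Omega>" and fin: "emeasure (surface_measure \<Omega>) (regular_boundary \<Omega>) < \<infinity>"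
    and I: "finite I" "\<And>c r. (c, r) \<in> I \<Longrightarrow> r > 0 \<and> (\<exists>U m s \<gamma>. boundary_chart \<Omega> U m s \<gamma> \<and> cball c (2 * r) \<subseteq> U)"
    and K: "compact K" "K \<subseteq> \<Omega>"
    and g: "C1_upto \<Omega> g G" and g0: "\<And>x. x \<in> closure \<Omega> - K - (\<Union>(c, r)\<in>I. ball c r) \<Longrightarrow> g x = 0"
  shows "(\<integral>x. G x $ k * indicator \<Omega> x \<partial>lborel) =
    (\<integral>x. outward_normal \<Omega> x $ k * g x * indicator (regular_boundary \<Omega>) x \<partial>surface_measure \<Omega>)"
  using I g g0
proof (induction I arbitrary: g G rule: finite_induct)
  case empty
  have z: "outward_normal \<Omega> x $ k * g x * indicator (regular_boundary \<Omega>) x = 0" for x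
  proof (cases "x \<in> regular_boundary \<Omega>")
    case True
    then have "x \<in> closure \<Omega> - K" using K(2) \<Omega>(1) by (auto simp: regular_boundary_def frontier_def interior_open)
    then show ?thesis using empty.prems(3) by simp
  qed simp
  have "(\<integral>x. G x $ k * indicator \<Omega> x \<partial>lborel) = 0"
    by (rule interior_gauss_green[OF \<Omega> empty.prems(2) K]) (use empty.prems(3) closure_subset in auto)
  then show ?case unfolding z by simp
next
  case (insert p I)
  obtain c r where p: "p = (c, r)" by fastforce
  from insert.prems(1)[of c r] p obtain U m s \<gamma> where r: "r > 0"
    and ch: "boundary_chart \<Omega> U m s \<gamma>" "cball c (2 * r) \<subseteq> U" by auto
  let ?\<psi> = "cutoff c r"
  have \<psi>: "C1_upto \<Omega> ?\<psi> (cutoff_grad c r)" by (rule C1_upto_cutoff[OF r])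
  note \<psi>c = C1_upto_diff[OF C1_upto_const[of \<Omega> 1] \<psi>]
  define G1 where "G1 = (\<lambda>x. ?\<psi> x *\<^sub>R G x + g x *\<^sub>R cutoff_grad c r x)"
  define G2 where "G2 = (\<lambda>x. (1 - ?\<psi> x) *\<^sub>R G x + g x *\<^sub>R (0 - cutoff_grad c r x))"
  have g1: "C1_upto \<Omega> (\<lambda>x. ?\<psi> x * g x) G1" unfolding G1_def by (rule C1_upto_mult[OF \<psi> insert.prems(2)])
  have g2: "C1_upto \<Omega> (\<lambda>x. (1 - ?\<psi> x) * g x) G2" unfolding G2_def by (rule C1_upto_mult[OF \<psi>c insert.prems(2)])
  have e1: "(\<integral>x. G1 x $ k * indicator \<Omega> x \<partial>lborel) =
    (\<integral>x. outward_normal \<Omega> x $ k * (?\<psi> x * g x) * indicator (regular_boundary \<Omega>) x \<partial>surface_measure \<Omega>)"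
    by (rule gauss_green_in_chart[OF \<Omega> ch(1) g1 compact_cball ch(2)]) (use r in \<open>auto simp: cutoff_eq_0\<close>)
  have e2: "(\<integral>x. G2 x $ k * indicator \<Omega> x \<partial>lborel) =
    (\<integral>x. outward_normal \<Omega> x $ k * ((1 - ?\<psi> x) * g x) * indicator (regular_boundary \<Omega>) x \<partial>surface_measure \<Omega>)"
  proof (rule insert.IH[OF _ g2])
    show "r > 0 \<and> (\<exists>U m s \<gamma>. boundary_chart \<Omega> U m s \<gamma> \<and> cball c (2 * r) \<subseteq> U)" if "(c, r) \<in> I" for c r
      using insert.prems(1) that by blast
    show "(1 - ?\<psi> x) * g x = 0" if "x \<in> closure \<Omega> - K - (\<Union>(c, r)\<in>I. ball c r)" for x
    proof (cases "x \<in> ball c r")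
      case True
      then show ?thesis using cutoff_eq_1[OF r, of c x] by simp
    next
      case False
      then have "g x = 0" using that by (intro insert.prems(3)) (auto simp: p)
      then show ?thesis by simp
    qed
  qed
  have "(\<integral>x. G x $ k * indicator \<Omega> x \<partial>lborel) = (\<integral>x. G1 x $ k * indicator \<Omega> x + G2 x $ k * indicator \<Omega> x \<partial>lborel)"
    by (rule Bochner_Integration.integral_cong) (auto simp: G1_def G2_def algebra_simps)
  also have "\<dots> = (\<integral>x. G1 x $ k * indicator \<Omega> x \<partial>lborel) + (\<integral>x. G2 x $ k * indicator \<Omega> x \<partial>lborel)"
    by (intro Bochner_Integration.integral_add bounded_borel_integrable C1_upto_bounded_borel[OF g1 \<Omega>] C1_upto_bounded_borel[OF g2 \<Omega>])
  also have "\<dots> = (\<integral>x. outward_normal \<Omega> x $ k * (?\<psi> x * g x) * indicator (regular_boundary \<Omega>) x +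
      outward_normal \<Omega> x $ k * ((1 - ?\<psi> x) * g x) * indicator (regular_boundary \<Omega>) x \<partial>surface_measure \<Omega>)"
    unfolding e1 e2
    by (intro Bochner_Integration.integral_add[symmetric] C1_upto_surface_integrable[OF \<Omega> fin g1] C1_upto_surface_integrable[OF \<Omega> fin g2])
  also have "\<dots> = (\<integral>x. outward_normal \<Omega> x $ k * g x * indicator (regular_boundary \<Omega>) x \<partial>surface_measure \<Omega>)"
    by (rule Bochner_Integration.integral_cong) (auto simp: algebra_simps)
  finally show ?case .
qed

section \<open>Cutoffs near the singular part of the boundary\<close>

lemma cutoff_product:
  fixes c :: "'i \<Rightarrow> real^'n::finite"
  assumes "finite I" "\<And>i. i \<in> I \<Longrightarrow> r i > 0"
  shows "\<exists>H. C1_upto UNIV (\<lambda>x. \<Prod>i\<in>I. 1 - cutoff (c i) (r i) x) H \<and>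
    (\<forall>x. norm (H x) \<le> (\<Sum>i\<in>I. norm (cutoff_grad (c i) (r i) x)))"
  using assms
proof (induction rule: finite_induct)
  case empty
  then show ?case using C1_upto_const[of UNIV 1] by auto
next
  case (insert i I)
  then obtain H where H: "C1_upto UNIV (\<lambda>x. \<Prod>i\<in>I. 1 - cutoff (c i) (r i) x) H"
    "\<And>x. norm (H x) \<le> (\<Sum>i\<in>I. norm (cutoff_grad (c i) (r i) x))" by auto
  have ri: "r i > 0" using insert.prems by auto
  note \<psi>c = C1_upto_diff[OF C1_upto_const[of UNIV 1] C1_upto_cutoff[OF ri, of UNIV "c i"]]
  let ?P = "\<lambda>x. \<Prod>i\<in>I. 1 - cutoff (c i) (r i) x"
  have P: "\<bar>?P x\<bar> \<le> 1" for x
    unfolding abs_prod by (intro prod_le_1) (use cutoff_bounds[of "c _" "r _" x] in auto)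
  \<comment> \<open>Product rule. Both scalar factors are at most one in absolute value, so the
    gradient norms merely add up.\<close>
  let ?H = "\<lambda>x. (1 - cutoff (c i) (r i) x) *\<^sub>R H x + ?P x *\<^sub>R (0 - cutoff_grad (c i) (r i) x)"
  have "norm (?H x) \<le> norm (H x) + norm (cutoff_grad (c i) (r i) x)" for x
  proof -
    have "norm (?H x) \<le> \<bar>1 - cutoff (c i) (r i) x\<bar> * norm (H x) + \<bar>?P x\<bar> * norm (cutoff_grad (c i) (r i) x)"
      by (rule order_trans[OF norm_triangle_ineq]) simp
    also have "\<dots> \<le> 1 * norm (H x) + 1 * norm (cutoff_grad (c i) (r i) x)"
      using cutoff_bounds[of "c i" "r i" x] P by (intro add_mono mult_right_mono) auto
    finally show ?thesis by simp
  qed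
  then have "\<forall>x. norm (?H x) \<le> (\<Sum>i\<in>insert i I. norm (cutoff_grad (c i) (r i) x))"
    using insert.hyps H(2) by (simp add: add.commute[of "norm (cutoff_grad _ _ _)"]) (meson add_right_mono order_trans)
  moreover have "C1_upto UNIV (\<lambda>x. \<Prod>i\<in>insert i I. 1 - cutoff (c i) (r i) x) ?H"
    using C1_upto_mult[OF \<psi>c H(1)] insert.hyps by simp
  ultimately show ?case by blast
qed

text \<open>The gradient is at most b / r and lives on a ball of volume v r^n. The resulting
  exponent n - 1 is that of \<open>codim1_null\<close>, which is why sets of this kind can be cut
  out.\<close>

lemma integral_cutoff_grad_bound:
  obtains B where "B > 0" "\<And>(c::real^'n::finite) r. r > 0 \<Longrightarrow>
    integrable lborel (\<lambda>x. norm (cutoff_grad c r x)) \<and>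
    (\<integral>x. norm (cutoff_grad c r x) \<partial>lborel) \<le> B * r ^ (CARD('n) - 1)"
proof -
  obtain b where b: "b > 0" "\<And>(c::real^'n) r x. r > 0 \<Longrightarrow> norm (cutoff_grad c r x) \<le> b / r"
    using cutoff_grad_bound by blast
  \<comment> \<open>The volume of the ball of radius 2, so that the ball of radius 2r has volume
    \<open>v * r ^ CARD('n)\<close>.\<close>
  define v where "v = unit_ball_vol (real CARD('n)) * 2 ^ CARD('n)"
  have v: "v > 0" unfolding v_def by simp
  show ?thesis
  proof (rule that[of "b * v"])
    fix c :: "real^'n" and r :: real assume r: "r > 0"
    have le: "norm (cutoff_grad c r x) \<le> (b / r) * indicator (cball c (2 * r)) x" for x
      using b(2)[OF r, of c x] cutoff_grad_eq_0[OF r, of c x] by (auto simp: indicator_def)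
    have i: "integrable lborel (\<lambda>x. (b / r) * indicator (cball c (2 * r)) x :: real)"
      using emeasure_lborel_cball_finite[of c "2 * r"]
      by (intro integrable_mult_right integrable_real_indicator) auto
    have "continuous_on UNIV (cutoff_grad c r)" using C1_uptoD(3)[OF C1_upto_cutoff[OF r, of UNIV c]] .
    then have [measurable]: "cutoff_grad c r \<in> borel_measurable borel" by (rule borel_measurable_continuous_onI)
    have i2: "integrable lborel (\<lambda>x. norm (cutoff_grad c r x))"
      by (rule Bochner_Integration.integrable_bound[OF i]) (use le order_trans[OF le abs_ge_self] in auto)
    have "(\<integral>x. norm (cutoff_grad c r x) \<partial>lborel) \<le> (\<integral>x. (b / r) * indicator (cball c (2 * r)) x \<partial>lborel)"
      by (rule integral_mono[OF i2 i]) (rule le)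
    also have "\<dots> = (b / r) * measure lborel (cball c (2 * r))" by simp
    also have "measure lborel (cball c (2 * r)) = v * r ^ CARD('n)"
      using r by (simp add: content_cball v_def power_mult_distrib)
    also have "(b / r) * (v * r ^ CARD('n)) = b * v * r ^ (CARD('n) - 1)"
      using r by (cases "CARD('n)") auto
    finally show "integrable lborel (\<lambda>x. norm (cutoff_grad c r x)) \<and>
      (\<integral>x. norm (cutoff_grad c r x) \<partial>lborel) \<le> b * v * r ^ (CARD('n) - 1)" using i2 by simp
  qed (use b v in simp)
qed

text \<open>Compactness leaves finitely many balls. Those that miss \<open>S\<close> are discarded,
  so the others stay close to \<open>S\<close> once their radii are small.\<close>

lemma codim1_null_finite_cover:
  fixes S :: "(real^'n::finite) set"
  assumes "codim1_null S" "compact S" "e > 0"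
  shows "\<exists>(I :: nat set) c r. finite I \<and> (\<forall>i. r i > 0) \<and> S \<subseteq> (\<Union>i\<in>I. ball (c i) (r i)) \<and>
    (\<forall>i\<in>I. ball (c i) (r i) \<inter> S \<noteq> {}) \<and> (\<Sum>i\<in>I. r i ^ (CARD('n) - 1)) < e"
proof -
  obtain c :: "nat \<Rightarrow> real^'n" and r where cr: "\<And>j. r j > 0" "S \<subseteq> (\<Union>j. ball (c j) (r j))"
    "summable (\<lambda>j. r j ^ (CARD('n) - 1))" "(\<Sum>j. r j ^ (CARD('n) - 1)) < e"
    using assms(1,3) unfolding codim1_null_def by blast
  obtain J where J: "finite J" "S \<subseteq> (\<Union>j\<in>J. ball (c j) (r j))"
    using compactE_image[OF assms(2), of UNIV "\<lambda>j. ball (c j) (r j)"] cr(2) by (metis open_ball)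
  define I where "I = {j\<in>J. ball (c j) (r j) \<inter> S \<noteq> {}}"
  show ?thesis
  proof (intro exI conjI)
    show "finite I" using J by (simp add: I_def)
    show "S \<subseteq> (\<Union>i\<in>I. ball (c i) (r i))" using J(2) unfolding I_def by blast
    have "(\<Sum>i\<in>I. r i ^ (CARD('n) - 1)) \<le> (\<Sum>j. r j ^ (CARD('n) - 1))"
      using \<open>finite I\<close> cr(1) by (intro sum_le_suminf cr(3)) (auto simp: less_imp_le)
    then show "(\<Sum>i\<in>I. r i ^ (CARD('n) - 1)) < e" using cr(4) by simp
  qed (use cr in \<open>auto simp: I_def\<close>)
qed

lemma frontier_minus_regular_compact:
  assumes "bounded \<Omega>" shows "compact (frontier \<Omega> - regular_boundary \<Omega>)"
proof -
  obtain W where W: "open W" "regular_boundary \<Omega> = frontier \<Omega> \<inter> W" by (rule regular_boundary_open_cover)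
  have "frontier \<Omega> - regular_boundary \<Omega> = frontier \<Omega> - W" using W by blast
  then show ?thesis using assms W(1) by (simp add: compact_diff compact_frontier_bounded)
qed

text \<open>The doubled closed ball has to lie in a chart because the cutoff of a ball extends to
  twice its radius.\<close>

lemma regular_boundary_ball_cover:
  fixes \<Omega> :: "(real^'n::finite) set"
  assumes "compact T" "T \<subseteq> regular_boundary \<Omega>"
  obtains I where "finite I" "T \<subseteq> (\<Union>(c, r)\<in>I. ball c r)"
    "\<And>c r. (c, r) \<in> I \<Longrightarrow> r > 0 \<and> (\<exists>U m s \<gamma>. boundary_chart \<Omega> U m s \<gamma> \<and> cball c (2 * r) \<subseteq> U)"
proof -
  let ?I = "{(c, r). r > (0::real) \<and> (\<exists>U m s \<gamma>. boundary_chart \<Omega> U m s \<gamma> \<and> cball c (2 * r) \<subseteq> U)}"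
  have cov: "T \<subseteq> (\<Union>p\<in>?I. ball (fst p) (snd p))"
  proof
    fix x assume "x \<in> T"
    then have "x \<in> regular_boundary \<Omega>" using assms(2) by blast
    then obtain U m s \<gamma> where x: "x \<in> U" "boundary_chart \<Omega> U m s \<gamma>" by (rule regular_boundaryE) blast
    obtain e where e: "e > 0" "cball x e \<subseteq> U"
      using boundary_chartD(1)[OF x(2)] x(1) by (auto simp: open_contains_cball)
    then have "(x, e/2) \<in> ?I" using x(2) by (intro CollectI case_prodI conjI exI[of _ U] exI[of _ m] exI[of _ s] exI[of _ \<gamma>]) auto
    moreover have "x \<in> ball x (e/2)" using e by simp
    ultimately show "x \<in> (\<Union>p\<in>?I. ball (fst p) (snd p))" by (intro UN_I[of "(x, e/2)"]) simp_all
  qed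
  obtain I where I: "I \<subseteq> ?I" "finite I" "T \<subseteq> (\<Union>p\<in>I. ball (fst p) (snd p))"
    by (rule compactE_image[OF assms(1) _ cov]) auto
  show ?thesis
  proof (rule that[of I])
    show "T \<subseteq> (\<Union>(c, r)\<in>I. ball c r)" using I(3) by (simp add: case_prod_beta')
    show "r > 0 \<and> (\<exists>U m s \<gamma>. boundary_chart \<Omega> U m s \<gamma> \<and> cball c (2 * r) \<subseteq> U)" if "(c, r) \<in> I" for c r
      using subsetD[OF I(1) that] by simp
  qed (rule I)
qed

text \<open>The formula for \<eta> g, with \<eta> the product of the complementary cutoffs, is
  passed to the limit. Since \<eta> tends to one off the singular part, dominated convergence
  handles the surface integral and the volume term with \<eta> \<open>G\<close>; the remaining
  volume term, with the gradient of \<eta>, tends to zero because \<open>g\<close> is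
  bounded.\<close>

theorem gauss_green:
  fixes \<Omega> :: "(real^'n::finite) set"
  assumes \<Omega>: "open \<Omega>" "bounded \<Omega>" and ps: "piecewise_smooth_boundary \<Omega>" and g: "C1_upto \<Omega> g G"
  shows "(\<integral>x. G x $ k * indicator \<Omega> x \<partial>lborel) =
    (\<integral>x. outward_normal \<Omega> x $ k * g x * indicator (regular_boundary \<Omega>) x \<partial>surface_measure \<Omega>)"
proof -
  define S where "S = frontier \<Omega> - regular_boundary \<Omega>"
  have fin: "emeasure (surface_measure \<Omega>) (regular_boundary \<Omega>) < \<infinity>" and null: "codim1_null S"
    using ps by (auto simp: piecewise_smooth_boundary_def S_def)
  have S: "compact S" unfolding S_def by (rule frontier_minus_regular_compact[OF \<Omega>(2)])
  note SM = surface_measureD[OF \<Omega>]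
  define P where "P = (\<lambda>(I::nat set) (c::nat \<Rightarrow> real^'n) r (j::nat). finite I \<and> (\<forall>i. r i > 0) \<and> S \<subseteq> (\<Union>i\<in>I. ball (c i) (r i)) \<and>
    (\<forall>i\<in>I. ball (c i) (r i) \<inter> S \<noteq> {}) \<and> (\<Sum>i\<in>I. r i ^ (CARD('n) - 1)) < 1 / real (Suc j))"
  have "\<exists>I c r. P I c r j" for j
  proof -
    have "(0::real) < 1 / real (Suc j)" by simp
    from codim1_null_finite_cover[OF null S this] show ?thesis unfolding P_def .
  qed
  then obtain I c r where Icr: "\<And>j. P (I j) (c j) (r j) j" by metis
  then have finI: "\<And>j. finite (I j)" and rpos: "\<And>j i. r j i > 0" and cover: "\<And>j. S \<subseteq> (\<Union>i\<in>I j. ball (c j i) (r j i))"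
    and meets: "\<And>j i. i \<in> I j \<Longrightarrow> ball (c j i) (r j i) \<inter> S \<noteq> {}"
    and small: "\<And>j. (\<Sum>i\<in>I j. r j i ^ (CARD('n) - 1)) < 1 / real (Suc j)"
    unfolding P_def by blast+
  define \<eta> where "\<eta> = (\<lambda>j x. \<Prod>i\<in>I j. 1 - cutoff (c j i) (r j i) x)"
  have "\<exists>H. C1_upto UNIV (\<eta> j) H \<and> (\<forall>x. norm (H x) \<le> (\<Sum>i\<in>I j. norm (cutoff_grad (c j i) (r j i) x)))" for j
    unfolding \<eta>_def by (rule cutoff_product[OF finI rpos])
  then obtain H where H: "\<And>j. C1_upto UNIV (\<eta> j) (H j)"
    "\<And>j x. norm (H j x) \<le> (\<Sum>i\<in>I j. norm (cutoff_grad (c j i) (r j i) x))" by metis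
  have \<eta>01: "0 \<le> \<eta> j x" "\<eta> j x \<le> 1" for j x
    unfolding \<eta>_def using cutoff_bounds by (auto intro!: prod_nonneg prod_le_1)
  \<comment> \<open>If a cutoff is nonzero at x, its centre is closer than 2r; its ball meets
    \<open>S\<close> within r of the centre, so \<open>S\<close> comes within 3r of x. Hence d / 3
    \<le> r, which the smallness of the sum of powers excludes for large j.\<close>
  have lim: "(\<lambda>j. \<eta> j x) \<longlonglongrightarrow> 1" if xS: "x \<notin> S" for x
  proof -
    have "open (- S)" using S by (simp add: compact_imp_closed open_Compl)
    then obtain d where d: "d > 0" "ball x d \<subseteq> - S" using xS by (auto elim: openE[of "- S" x])
    have ev: "\<forall>\<^sub>F j in sequentially. 1 / real (Suc j) < (d/3) ^ (CARD('n) - 1)"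
      by (rule order_tendstoD(2)[OF LIMSEQ_inverse_real_of_nat[unfolded inverse_eq_divide]]) (use d in simp)
    have "\<forall>\<^sub>F j in sequentially. \<eta> j x = 1"
      using ev
    proof eventually_elim
      case (elim j)
      have "cutoff (c j i) (r j i) x = 0" if i: "i \<in> I j" for i
      proof (rule ccontr)
        assume "cutoff (c j i) (r j i) x \<noteq> 0"
        then have 1: "dist (c j i) x < 2 * r j i" using cutoff_eq_0[OF rpos[of j i]] by force
        obtain y where y: "y \<in> S" "dist (c j i) y < r j i" using meets[OF i] by auto
        have "dist x y < 3 * r j i" using 1 y(2) dist_triangle3[of x y "c j i"] by simp
        moreover have "dist x y \<ge> d" using d(2) y(1) by (force simp: not_le[symmetric])
        ultimately have "d / 3 \<le> r j i" by simp
        then have "(d/3) ^ (CARD('n) - 1) \<le> r j i ^ (CARD('n) - 1)" using d by (intro power_mono) auto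
        also have "\<dots> \<le> (\<Sum>i\<in>I j. r j i ^ (CARD('n) - 1))"
          using finI i rpos by (intro member_le_sum) (auto simp: less_imp_le)
        also have "\<dots> < 1 / real (Suc j)" by (rule small)
        finally show False using elim by simp
      qed
      then show ?case by (simp add: \<eta>_def)
    qed
    then show ?thesis by (rule tendsto_eventually)
  qed
  obtain B where B: "B > 0" "\<And>x. \<bar>outward_normal \<Omega> x $ k * g x * indicator (regular_boundary \<Omega>) x\<bar> \<le> B * indicator (regular_boundary \<Omega>) x"
    "\<And>x. x \<in> closure \<Omega> \<Longrightarrow> \<bar>g x\<bar> \<le> B"
    using C1_upto_surface_bounded[OF \<Omega>(1) g] by blast
  define G' where "G' = (\<lambda>j x. \<eta> j x *\<^sub>R G x + g x *\<^sub>R H j x)"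
  have g': "C1_upto \<Omega> (\<lambda>x. \<eta> j x * g x) (G' j)" for j
    unfolding G'_def by (rule C1_upto_mult[OF C1_upto_subset[OF H(1)] g]) simp
  \<comment> \<open>On the balls around \<open>S\<close> the factor \<eta> is zero. The rest of the
    boundary is compact and regular, so finitely many chart balls cover it, and what remains of the
    closure is a compact part of \<Omega>.\<close>
  have gg: "(\<integral>x. G' j x $ k * indicator \<Omega> x \<partial>lborel) =
    (\<integral>x. outward_normal \<Omega> x $ k * (\<eta> j x * g x) * indicator (regular_boundary \<Omega>) x \<partial>surface_measure \<Omega>)" for j
  proof -
    let ?O = "\<Union>i\<in>I j. ball (c j i) (r j i)"
    have "compact (frontier \<Omega> - ?O)" using \<Omega> by (intro compact_diff compact_frontier_bounded open_UN) auto
    moreover have "frontier \<Omega> - ?O \<subseteq> regular_boundary \<Omega>" using cover[of j] unfolding S_def by blast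
    ultimately obtain J where J: "finite J" "frontier \<Omega> - ?O \<subseteq> (\<Union>(c, r)\<in>J. ball c r)"
      "\<And>c r. (c, r) \<in> J \<Longrightarrow> r > 0 \<and> (\<exists>U m s \<gamma>. boundary_chart \<Omega> U m s \<gamma> \<and> cball c (2 * r) \<subseteq> U)"
      by (rule regular_boundary_ball_cover) blast
    let ?K = "closure \<Omega> - ?O - (\<Union>(c, r)\<in>J. ball c r)"
    show ?thesis
    proof (rule gauss_green_chart_balls[OF \<Omega> fin J(1) J(3) _ _ g'])
      show "compact ?K" using \<Omega> by (intro compact_diff open_UN) auto
      show "?K \<subseteq> \<Omega>" using J(2) \<Omega>(1) unfolding frontier_def by (auto simp: interior_open)
      show "\<eta> j x * g x = 0" if "x \<in> closure \<Omega> - ?K - (\<Union>(c, r)\<in>J. ball c r)" for x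
      proof -
        have "x \<in> ?O" using that by blast
        then obtain i where i: "i \<in> I j" "x \<in> ball (c j i) (r j i)" by blast
        then have "cutoff (c j i) (r j i) x = 1" using rpos by (intro cutoff_eq_1) auto
        then have "\<eta> j x = 0" unfolding \<eta>_def using finI i(1) by (intro prod_zero) auto
        then show ?thesis by simp
      qed
    qed auto
  qed
  have "(\<lambda>j. \<integral>x. outward_normal \<Omega> x $ k * (\<eta> j x * g x) * indicator (regular_boundary \<Omega>) x \<partial>surface_measure \<Omega>)
    \<longlonglongrightarrow> (\<integral>x. outward_normal \<Omega> x $ k * g x * indicator (regular_boundary \<Omega>) x \<partial>surface_measure \<Omega>)"
  proof (rule integral_dominated_convergence[where w="\<lambda>x. B * indicator (regular_boundary \<Omega>) x"])
    show "(\<lambda>x. outward_normal \<Omega> x $ k * g x * indicator (regular_boundary \<Omega>) x) \<in> borel_measurable (surface_measure \<Omega>)"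
      using C1_upto_surface_integrable[OF \<Omega> fin g] by (rule borel_measurable_integrable)
    show "(\<lambda>x. outward_normal \<Omega> x $ k * (\<eta> j x * g x) * indicator (regular_boundary \<Omega>) x) \<in> borel_measurable (surface_measure \<Omega>)" for j
      using C1_upto_surface_integrable[OF \<Omega> fin g'] by (rule borel_measurable_integrable)
    show "integrable (surface_measure \<Omega>) (\<lambda>x. B * indicator (regular_boundary \<Omega>) x)"
      using fin SM(1) regular_boundary_borel[of \<Omega>] by (intro integrable_mult_right integrable_real_indicator) auto
    have "(\<lambda>j. outward_normal \<Omega> x $ k * (\<eta> j x * g x) * indicator (regular_boundary \<Omega>) x)
      \<longlonglongrightarrow> outward_normal \<Omega> x $ k * (1 * g x) * indicator (regular_boundary \<Omega>) x" for x
    proof (cases "x \<in> regular_boundary \<Omega>")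
      case True
      then show ?thesis by (intro tendsto_intros lim) (simp add: S_def)
    qed simp
    then show "AE x in surface_measure \<Omega>. (\<lambda>j. outward_normal \<Omega> x $ k * (\<eta> j x * g x) * indicator (regular_boundary \<Omega>) x)
      \<longlonglongrightarrow> outward_normal \<Omega> x $ k * g x * indicator (regular_boundary \<Omega>) x" by simp
    have "norm (outward_normal \<Omega> x $ k * (\<eta> j x * g x) * indicator (regular_boundary \<Omega>) x) \<le> B * indicator (regular_boundary \<Omega>) x" for j x
    proof -
      have "norm (outward_normal \<Omega> x $ k * (\<eta> j x * g x) * indicator (regular_boundary \<Omega>) x) =
        \<eta> j x * \<bar>outward_normal \<Omega> x $ k * g x * indicator (regular_boundary \<Omega>) x\<bar>"
        using \<eta>01[of j x] by (simp add: abs_mult)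
      also have "\<dots> \<le> 1 * (B * indicator (regular_boundary \<Omega>) x)" using \<eta>01[of j x] B(2)[of x] by (intro mult_mono) auto
      finally show ?thesis by simp
    qed
    then show "AE x in surface_measure \<Omega>. norm (outward_normal \<Omega> x $ k * (\<eta> j x * g x) * indicator (regular_boundary \<Omega>) x) \<le> B * indicator (regular_boundary \<Omega>) x" for j
      by simp
  qed
  moreover have "(\<lambda>j. \<integral>x. G' j x $ k * indicator \<Omega> x \<partial>lborel) \<longlonglongrightarrow> (\<integral>x. G x $ k * indicator \<Omega> x \<partial>lborel)"
  proof -
    have bG: "bounded_borel (\<lambda>x. G x $ k * indicator \<Omega> x)" by (rule C1_upto_bounded_borel[OF g \<Omega>])
    note [measurable] = bounded_borel_measurable[OF bG]
    have \<eta>m [measurable]: "\<eta> j \<in> borel_measurable borel" for j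
      using C1_uptoD(1)[OF H(1)[of j]] by (intro borel_measurable_continuous_onI) simp
    have Hm [measurable]: "(\<lambda>x. H j x $ k) \<in> borel_measurable borel" for j
      using C1_uptoD(3)[OF H(1)[of j]] by (intro borel_measurable_continuous_onI continuous_intros)
    note [measurable] = C1_upto_borel(2)[OF g \<Omega>(1)]
    have iG: "integrable lborel (\<lambda>x. G x $ k * indicator \<Omega> x)" using bounded_borel_integrable[OF bG] .
    have i1: "integrable lborel (\<lambda>x. \<eta> j x * (G x $ k * indicator \<Omega> x))" for j
      by (rule Bochner_Integration.integrable_bound[OF iG])
         (use \<eta>01 in \<open>auto simp: abs_mult intro!: mult_left_le_one_le\<close>)
    have t1: "(\<lambda>j. \<integral>x. \<eta> j x * (G x $ k * indicator \<Omega> x) \<partial>lborel) \<longlonglongrightarrow> (\<integral>x. G x $ k * indicator \<Omega> x \<partial>lborel)"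
    proof (rule integral_dominated_convergence[where w="\<lambda>x. \<bar>G x $ k * indicator \<Omega> x\<bar>"])
      show "integrable lborel (\<lambda>x. \<bar>G x $ k * indicator \<Omega> x\<bar>)" using iG by (rule integrable_abs)
      have "(\<lambda>j. \<eta> j x * (G x $ k * indicator \<Omega> x)) \<longlonglongrightarrow> 1 * (G x $ k * indicator \<Omega> x)" for x
      proof (cases "x \<in> \<Omega>")
        case True
        then have "x \<notin> S" using \<Omega>(1) by (auto simp: S_def frontier_def interior_open)
        then show ?thesis by (intro tendsto_intros lim)
      qed simp
      then show "AE x in lborel. (\<lambda>j. \<eta> j x * (G x $ k * indicator \<Omega> x)) \<longlonglongrightarrow> G x $ k * indicator \<Omega> x" by simp
      show "AE x in lborel. norm (\<eta> j x * (G x $ k * indicator \<Omega> x)) \<le> \<bar>G x $ k * indicator \<Omega> x\<bar>" for j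
        using \<eta>01 by (auto simp: abs_mult intro!: AE_I2 mult_left_le_one_le)
    qed measurable
    obtain b where b: "b > 0" "\<And>(c::real^'n) r. r > 0 \<Longrightarrow>
        integrable lborel (\<lambda>x. norm (cutoff_grad c r x)) \<and>
        (\<integral>x. norm (cutoff_grad c r x) \<partial>lborel) \<le> b * r ^ (CARD('n) - 1)"
      using integral_cutoff_grad_bound by blast
    have iN: "integrable lborel (\<lambda>x. B * (\<Sum>i\<in>I j. norm (cutoff_grad (c j i) (r j i) x)))" for j
      by (intro integrable_mult_right Bochner_Integration.integrable_sum) (use b(2) rpos in blast)
    have le: "\<bar>g x * indicator \<Omega> x * H j x $ k\<bar> \<le> B * (\<Sum>i\<in>I j. norm (cutoff_grad (c j i) (r j i) x))" for j x
    proof -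
      have "\<bar>g x * indicator \<Omega> x\<bar> \<le> B" using B(3)[of x] B(1) closure_subset[of \<Omega>] by (auto simp: indicator_def)
      moreover have "\<bar>H j x $ k\<bar> \<le> (\<Sum>i\<in>I j. norm (cutoff_grad (c j i) (r j i) x))"
        using component_le_norm_cart H(2) order_trans by blast
      ultimately show ?thesis unfolding abs_mult[of "g x * indicator \<Omega> x"] using B(1) by (intro mult_mono) auto
    qed
    have i2: "integrable lborel (\<lambda>x. g x * indicator \<Omega> x * H j x $ k)" for j
      by (rule Bochner_Integration.integrable_bound[OF iN[of j]]) (use order_trans[OF le abs_ge_self] in auto)
    \<comment> \<open>The L^1 norm of the gradient is at most b times the sum of the powers r^(n-1),
      which is below 1 / (j + 1) by the choice of the covers.\<close>
    have t2: "(\<lambda>j. \<integral>x. g x * indicator \<Omega> x * H j x $ k \<partial>lborel) \<longlonglongrightarrow> 0"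
    proof (rule Lim_null_comparison)
      have "norm (\<integral>x. g x * indicator \<Omega> x * H j x $ k \<partial>lborel) \<le> B * b * (1 / real (Suc j))" for j
      proof -
        have "norm (\<integral>x. g x * indicator \<Omega> x * H j x $ k \<partial>lborel) \<le> (\<integral>x. norm (g x * indicator \<Omega> x * H j x $ k) \<partial>lborel)"
          by (rule integral_norm_bound)
        also have "\<dots> \<le> (\<integral>x. B * (\<Sum>i\<in>I j. norm (cutoff_grad (c j i) (r j i) x)) \<partial>lborel)"
          by (intro integral_mono integrable_norm i2 iN) (use le in simp)
        also have "\<dots> = B * (\<Sum>i\<in>I j. \<integral>x. norm (cutoff_grad (c j i) (r j i) x) \<partial>lborel)"
          using b(2) rpos by (subst Bochner_Integration.integral_mult_right_zero, subst Bochner_Integration.integral_sum) auto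
        also have "\<dots> \<le> B * (\<Sum>i\<in>I j. b * r j i ^ (CARD('n) - 1))"
          using b(2) rpos B(1) by (intro mult_left_mono sum_mono) (auto simp: less_imp_le)
        also have "\<dots> = B * b * (\<Sum>i\<in>I j. r j i ^ (CARD('n) - 1))" by (simp add: sum_distrib_left mult.assoc)
        also have "\<dots> \<le> B * b * (1 / real (Suc j))"
          using small[of j] B(1) b(1) by (intro mult_left_mono) auto
        finally show ?thesis .
      qed
      then show "\<forall>\<^sub>F j in sequentially. norm (\<integral>x. g x * indicator \<Omega> x * H j x $ k \<partial>lborel) \<le> B * b * (1 / real (Suc j))" by simp
      have "(\<lambda>j. B * b * (1 / real (Suc j))) \<longlonglongrightarrow> B * b * 0"
        by (intro tendsto_intros LIMSEQ_inverse_real_of_nat[unfolded inverse_eq_divide])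
      then show "(\<lambda>j. B * b * (1 / real (Suc j))) \<longlonglongrightarrow> 0" by simp
    qed
    have "(\<integral>x. G' j x $ k * indicator \<Omega> x \<partial>lborel) =
       (\<integral>x. \<eta> j x * (G x $ k * indicator \<Omega> x) \<partial>lborel) + (\<integral>x. g x * indicator \<Omega> x * H j x $ k \<partial>lborel)" for j
      unfolding Bochner_Integration.integral_add[OF i1 i2, symmetric]
      by (rule Bochner_Integration.integral_cong) (auto simp: G'_def algebra_simps)
    then show ?thesis using tendsto_add[OF t1 t2] by simp
  qed
  ultimately show ?thesis unfolding gg using LIMSEQ_unique by blast
qed

subsection \<open>Leibniz rule, mixed derivatives and boundary values\<close>

lemma bounded_borel_continuous_closure:
  fixes f :: "real^'n::finite \<Rightarrow> real"
  assumes "open \<Omega>" "bounded \<Omega>" "continuous_on (closure \<Omega>) f"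
  shows "bounded_borel (\<lambda>x. f x * indicator \<Omega> x)"
proof -
  have "bounded (f ` closure \<Omega>)"
    using assms by (intro compact_imp_bounded compact_continuous_image) auto
  then obtain B where B: "\<And>x. x \<in> closure \<Omega> \<Longrightarrow> \<bar>f x\<bar> \<le> B" unfolding bounded_iff by (metis imageI real_norm_def)
  obtain R where R: "\<And>x. x \<in> \<Omega> \<Longrightarrow> norm x \<le> R" using assms(2) unfolding bounded_iff by auto
  have "(\<lambda>x. indicator \<Omega> x *\<^sub>R f x) \<in> borel_measurable borel"
    using assms(1) by (intro borel_measurable_continuous_on_indicator continuous_on_subset[OF assms(3) closure_subset]) auto
  then show ?thesis
    using B R closure_subset[of \<Omega>]
    by (intro bounded_borelI[where B="\<bar>B\<bar>" and R=R]) (auto simp: mult.commute indicator_def split: if_splits intro: order_trans[OF _ abs_ge_self])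
qed

lemma continuous_on_slice:
  assumes "continuous_on (UNIV \<times> S) (\<lambda>(t, x). f t x)" shows "continuous_on S (f s)"
proof -
  have "continuous_on S (\<lambda>x. (\<lambda>(t, x). f t x) (s, x))"
    by (rule continuous_on_compose2[OF assms]) (auto intro!: continuous_on_Pair continuous_on_const continuous_on_id)
  then show ?thesis by simp
qed

lemma set_integral_eq: "(LINT x:A|M. f x) = (\<integral>x. f x * indicator A x \<partial>M)" for f :: "'a \<Rightarrow> real"
  by (simp add: set_lebesgue_integral_def mult.commute)

text \<open>The derivative is bounded on the compact product of [t - 1, t + 1] with the closure; by
  the mean value inequality the same bound dominates the difference quotients with step at most
  one.\<close>

lemma leibniz_rule_closure:
  fixes f f' :: "real \<Rightarrow> real^'n::finite \<Rightarrow> real"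
  assumes \<Omega>: "open \<Omega>" "bounded \<Omega>"
    and der: "\<And>t x. x \<in> \<Omega> \<Longrightarrow> ((\<lambda>s. f s x) has_real_derivative f' t x) (at t)"
    and cf: "continuous_on (UNIV \<times> closure \<Omega>) (\<lambda>(t, x). f t x)"
    and cf': "continuous_on (UNIV \<times> closure \<Omega>) (\<lambda>(t, x). f' t x)"
  shows "((\<lambda>t. LINT x:\<Omega>|lborel. f t x) has_real_derivative (LINT x:\<Omega>|lborel. f' t x)) (at t)"
  unfolding set_integral_eq DERIV_def
proof (subst tendsto_at_iff_sequentially, intro allI impI)
  have c1: "continuous_on (closure \<Omega>) (f s)" "continuous_on (closure \<Omega>) (f' s)" for s
    by (rule continuous_on_slice[OF cf]) (rule continuous_on_slice[OF cf'])
  note b1 = bounded_borel_continuous_closure[OF \<Omega> c1(1)] and b2 = bounded_borel_continuous_closure[OF \<Omega> c1(2)]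
  note [measurable] = bounded_borel_measurable[OF b1] bounded_borel_measurable[OF b2]
  have "compact ({t-1..t+1} \<times> closure \<Omega>)" using \<Omega>(2) by (intro compact_Times) auto
  then have "bounded ((\<lambda>(t, x). f' t x) ` ({t-1..t+1} \<times> closure \<Omega>))"
    by (intro compact_imp_bounded compact_continuous_image continuous_on_subset[OF cf']) auto
  then obtain B where B: "\<And>p. p \<in> {t-1..t+1} \<times> closure \<Omega> \<Longrightarrow> \<bar>(\<lambda>(t, x). f' t x) p\<bar> \<le> B"
    unfolding bounded_iff by (metis imageI real_norm_def)
  have Bx: "\<bar>f' s x\<bar> \<le> B" if "\<bar>s - t\<bar> \<le> 1" "x \<in> \<Omega>" for s x
  proof -
    have "s \<in> {t-1..t+1}" using that(1) by (simp add: abs_le_iff)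
    moreover have "x \<in> closure \<Omega>" using that(2) closure_subset by blast
    ultimately show ?thesis using B[of "(s, x)"] by simp
  qed
  have quot: "\<bar>(f (t + h) x - f t x) / h\<bar> \<le> B" if h: "\<bar>h\<bar> \<le> 1" "h \<noteq> 0" and x: "x \<in> \<Omega>" for h x
  proof -
    have "norm (f (t + h) x - f t x) \<le> B * norm (t + h - t)"
      by (rule field_differentiable_bound[where S="{t-1..t+1}" and f="\<lambda>s. f s x" and f'="\<lambda>s. f' s x"])
         (use h x Bx in \<open>auto intro: DERIV_subset[OF der]\<close>)
    then show ?thesis using h by (simp add: abs_divide divide_le_eq)
  qed
  fix X :: "nat \<Rightarrow> real" assume X: "\<forall>i. X i \<in> UNIV - {0}" "X \<longlonglongrightarrow> 0"
  have "\<forall>\<^sub>F i in sequentially. \<bar>X i\<bar> < 1"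
    using order_tendstoD(2)[OF tendsto_rabs_zero[OF X(2)], of 1] by simp
  then obtain N where N: "\<And>i. i \<ge> N \<Longrightarrow> \<bar>X i\<bar> \<le> 1" unfolding eventually_sequentially by (metis less_imp_le)
  \<comment> \<open>Dropping the first \<open>N\<close> terms makes all steps at most one.\<close>
  define Y where "Y = (\<lambda>i. X (i + N))"
  have Y: "Y i \<noteq> 0" "\<bar>Y i\<bar> \<le> 1" "Y \<longlonglongrightarrow> 0" for i
    using X N unfolding Y_def by (auto intro: LIMSEQ_ignore_initial_segment)
  have "(\<lambda>i. \<integral>x. (f (t + Y i) x * indicator \<Omega> x - f t x * indicator \<Omega> x) / Y i \<partial>lborel) \<longlonglongrightarrow> (\<integral>x. f' t x * indicator \<Omega> x \<partial>lborel)"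
  proof (rule integral_dominated_convergence[where w="\<lambda>x. B * indicator \<Omega> x"])
    show "integrable lborel (\<lambda>x. B * indicator \<Omega> x)"
      using emeasure_bounded_finite[OF \<Omega>(2)] \<Omega>(1) by (intro integrable_mult_right integrable_real_indicator) auto
    have "(\<lambda>i. (f (t + Y i) x * indicator \<Omega> x - f t x * indicator \<Omega> x) / Y i) \<longlonglongrightarrow> f' t x * indicator \<Omega> x" for x
    proof (cases "x \<in> \<Omega>")
      case True
      have "((\<lambda>h. (f (t + h) x - f t x) / h) \<longlongrightarrow> f' t x) (at 0)" using der[OF True, of t] unfolding DERIV_def .
      then have "((\<lambda>h. (f (t + h) x - f t x) / h) \<circ> Y) \<longlonglongrightarrow> f' t x"
        using Y(1,3) unfolding tendsto_at_iff_sequentially by blast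
      then show ?thesis using True by (simp add: o_def)
    qed simp
    then show "AE x in lborel. (\<lambda>i. (f (t + Y i) x * indicator \<Omega> x - f t x * indicator \<Omega> x) / Y i) \<longlonglongrightarrow> f' t x * indicator \<Omega> x" by simp
    show "AE x in lborel. norm ((f (t + Y i) x * indicator \<Omega> x - f t x * indicator \<Omega> x) / Y i) \<le> B * indicator \<Omega> x" for i
    proof (rule AE_I2)
      fix x show "norm ((f (t + Y i) x * indicator \<Omega> x - f t x * indicator \<Omega> x) / Y i) \<le> B * indicator \<Omega> x"
        using quot[OF Y(2,1), of x] by (cases "x \<in> \<Omega>") auto
    qed
  qed measurable
  moreover have "(\<integral>x. (f (t + Y i) x * indicator \<Omega> x - f t x * indicator \<Omega> x) / Y i \<partial>lborel) =
      ((\<integral>x. f (t + Y i) x * indicator \<Omega> x \<partial>lborel) - (\<integral>x. f t x * indicator \<Omega> x \<partial>lborel)) / Y i" for i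
    using bounded_borel_integrable[OF b1] by simp
  ultimately have "(\<lambda>i. ((\<integral>x. f (t + Y i) x * indicator \<Omega> x \<partial>lborel) - (\<integral>x. f t x * indicator \<Omega> x \<partial>lborel)) / Y i)
    \<longlonglongrightarrow> (\<integral>x. f' t x * indicator \<Omega> x \<partial>lborel)" by (simp only:)
  then have "(\<lambda>i. ((\<lambda>h. ((\<integral>x. f (t + h) x * indicator \<Omega> x \<partial>lborel) - (\<integral>x. f t x * indicator \<Omega> x \<partial>lborel)) / h) \<circ> X) (i + N))
    \<longlonglongrightarrow> (\<integral>x. f' t x * indicator \<Omega> x \<partial>lborel)" unfolding Y_def o_def .
  then show "((\<lambda>h. ((\<integral>x. f (t + h) x * indicator \<Omega> x \<partial>lborel) - (\<integral>x. f t x * indicator \<Omega> x \<partial>lborel)) / h) \<circ> X)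
    \<longlonglongrightarrow> (\<integral>x. f' t x * indicator \<Omega> x \<partial>lborel)" by (rule LIMSEQ_offset)
qed

section \<open>Symmetry of mixed derivatives\<close>

lemma second_difference_mean_value:
  fixes f f1 f12 :: "real \<Rightarrow> real \<Rightarrow> real"
  assumes h: "h > 0"
    and d1: "\<And>a b. a \<in> {0..h} \<Longrightarrow> b \<in> {0..h} \<Longrightarrow> ((\<lambda>a. f a b) has_real_derivative f1 a b) (at a)"
    and d12: "\<And>a b. a \<in> {0..h} \<Longrightarrow> b \<in> {0..h} \<Longrightarrow> ((\<lambda>b. f1 a b) has_real_derivative f12 a b) (at b)"
  obtains a b where "a \<in> {0..h}" "b \<in> {0..h}" "f h h - f h 0 - f 0 h + f 0 0 = h * (h * f12 a b)"
proof -
  have "\<exists>z>0. z < h \<and> (\<lambda>a. f a h - f a 0) h - (\<lambda>a. f a h - f a 0) 0 = (h - 0) * (f1 z h - f1 z 0)"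
    by (rule MVT2[OF h]) (use d1 in \<open>auto intro!: derivative_eq_intros\<close>)
  then obtain a where a: "0 < a" "a < h" "f h h - f h 0 - (f 0 h - f 0 0) = h * (f1 a h - f1 a 0)" by auto
  have "\<exists>z>0. z < h \<and> f1 a h - f1 a 0 = (h - 0) * f12 a z"
    by (rule MVT2[OF h]) (use d12 a in auto)
  then obtain b where b: "0 < b" "b < h" "f1 a h - f1 a 0 = h * f12 a b" by auto
  show ?thesis by (rule that[of a b]) (use a b in auto)
qed

text \<open>The second difference over a small parallelogram is symmetric in the two directions and
  equals h^2 times either mixed derivative at some nearby point. The directions are arbitrary
  vectors, so that one statement serves for two space derivatives and, on \<real> \<times> \<Omega>,
  for one in time and one in space.\<close>

lemma mixed_derivatives_eq:
  fixes f f1 f2 f12 f21 :: "'a::real_normed_vector \<Rightarrow> real"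
  assumes D: "open D" "p \<in> D"
    and d1: "\<And>q. q \<in> D \<Longrightarrow> ((\<lambda>s. f (q + s *\<^sub>R e1)) has_real_derivative f1 q) (at 0)"
    and d2: "\<And>q. q \<in> D \<Longrightarrow> ((\<lambda>s. f (q + s *\<^sub>R e2)) has_real_derivative f2 q) (at 0)"
    and d12: "\<And>q. q \<in> D \<Longrightarrow> ((\<lambda>s. f1 (q + s *\<^sub>R e2)) has_real_derivative f12 q) (at 0)"
    and d21: "\<And>q. q \<in> D \<Longrightarrow> ((\<lambda>s. f2 (q + s *\<^sub>R e1)) has_real_derivative f21 q) (at 0)"
    and c: "continuous_on D f12" "continuous_on D f21"
  shows "f12 p = f21 p"
proof (rule ccontr)
  assume ne: "f12 p \<noteq> f21 p"
  \<comment> \<open>Half the gap: a value strictly within \<open>e\<close> of \<open>f12 p\<close>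
    cannot be strictly within \<open>e\<close> of \<open>f21 p\<close>.\<close>
  define e where "e = \<bar>f12 p - f21 p\<bar> / 2"
  have e: "e > 0" using ne by (simp add: e_def)
  have "continuous (at p) f12" "continuous (at p) f21" using c D continuous_on_eq_continuous_at by blast+
  then obtain r1 r2 where r: "r1 > 0" "\<And>q. dist q p < r1 \<Longrightarrow> dist (f12 q) (f12 p) < e"
    "r2 > 0" "\<And>q. dist q p < r2 \<Longrightarrow> dist (f21 q) (f21 p) < e"
    using e unfolding continuous_at_eps_delta by metis
  obtain r3 where r3: "r3 > 0" "ball p r3 \<subseteq> D" using D openE by blast
  define \<rho> where "\<rho> = min r1 (min r2 r3)"
  define N where "N = norm e1 + norm e2 + 1"
  \<comment> \<open>Then h N = \<rho> / 2, so the whole parallelogram lies in the ball of radius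
    \<rho>.\<close>
  define h where "h = \<rho> / (2 * N)"
  have \<rho>: "\<rho> > 0" using r r3 by (simp add: \<rho>_def)
  have n: "N > 0" by (simp add: N_def add_nonneg_pos)
  have h: "h > 0" using \<rho> n by (simp add: h_def)
  let ?q = "\<lambda>a b. p + a *\<^sub>R e1 + b *\<^sub>R e2"
  have near: "dist (?q a b) p < \<rho>" if "a \<in> {0..h}" "b \<in> {0..h}" for a b
  proof -
    have "dist (?q a b) p \<le> norm (a *\<^sub>R e1) + norm (b *\<^sub>R e2)"
      by (simp add: dist_norm add.assoc) (metis norm_scaleR norm_triangle_ineq)
    also have "\<dots> \<le> h * norm e1 + h * norm e2" using that by (auto intro!: add_mono mult_right_mono)
    also have "\<dots> \<le> h * N" using h by (simp add: N_def algebra_simps)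
    also have "\<dots> = \<rho> / 2" using n by (simp add: h_def)
    also have "\<dots> < \<rho>" using \<rho> by simp
    finally show ?thesis .
  qed
  have inD: "?q a b \<in> D" if "a \<in> {0..h}" "b \<in> {0..h}" for a b
    using near[OF that] r3 by (auto simp: \<rho>_def dist_commute)
  have shift: "((\<lambda>a. k a) has_real_derivative d) (at a)" if "((\<lambda>s. k (a + s)) has_real_derivative d) (at 0)" for k :: "real \<Rightarrow> real" and a d
    using that DERIV_shift[of k d 0 a] by (simp add: add.commute)
  have A: "((\<lambda>a. f (?q a b)) has_real_derivative f1 (?q a b)) (at a)" if "a \<in> {0..h}" "b \<in> {0..h}" for a b
    by (rule shift) (use d1[OF inD[OF that]] in \<open>simp add: algebra_simps\<close>)
  have B: "((\<lambda>b. f1 (?q a b)) has_real_derivative f12 (?q a b)) (at b)" if "a \<in> {0..h}" "b \<in> {0..h}" for a b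
    by (rule shift) (use d12[OF inD[OF that]] in \<open>simp add: algebra_simps\<close>)
  have A': "((\<lambda>b. f (?q a b)) has_real_derivative f2 (?q a b)) (at b)" if "b \<in> {0..h}" "a \<in> {0..h}" for a b
    by (rule shift) (use d2[OF inD[OF that(2,1)]] in \<open>simp add: algebra_simps\<close>)
  have B': "((\<lambda>a. f2 (?q a b)) has_real_derivative f21 (?q a b)) (at a)" if "b \<in> {0..h}" "a \<in> {0..h}" for a b
    by (rule shift) (use d21[OF inD[OF that(2,1)]] in \<open>simp add: algebra_simps\<close>)
  obtain a b where ab: "a \<in> {0..h}" "b \<in> {0..h}"
    "f (?q h h) - f (?q h 0) - f (?q 0 h) + f (?q 0 0) = h * (h * f12 (?q a b))"
    using second_difference_mean_value[OF h, of "\<lambda>a b. f (?q a b)" "\<lambda>a b. f1 (?q a b)" "\<lambda>a b. f12 (?q a b)"] A B by blast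
  obtain b' a' where ab': "b' \<in> {0..h}" "a' \<in> {0..h}"
    "f (?q h h) - f (?q 0 h) - f (?q h 0) + f (?q 0 0) = h * (h * f21 (?q a' b'))"
    using second_difference_mean_value[OF h, of "\<lambda>b a. f (?q a b)" "\<lambda>b a. f2 (?q a b)" "\<lambda>b a. f21 (?q a b)"] A' B' by blast
  have "h * (h * f12 (?q a b)) = h * (h * f21 (?q a' b'))" using ab(3) ab'(3) by linarith
  then have "f12 (?q a b) = f21 (?q a' b')" using h by simp
  moreover have "dist (f12 (?q a b)) (f12 p) < e" using r(2) near[OF ab(1,2)] by (simp add: \<rho>_def)
  moreover have "dist (f21 (?q a' b')) (f21 p) < e" using r(4) near[OF ab'(2,1)] by (simp add: \<rho>_def)
  ultimately show False unfolding e_def dist_real_def by (simp add: abs_if split: if_splits)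
qed

text \<open>In the applications \<open>w n\<close> follows curves inside \<Omega> that approach a
  curve in the boundary, and \<open>c\<close> is the boundary value of the derivative. If
  \<open>c\<close> were nonzero, the increment of \<open>w n\<close> over [0, \<delta>] would exceed
  \<delta> |c| / 2 in absolute value, although \<open>w n\<close> tends to zero at both
  ends.\<close>

lemma derivative_zero_of_vanishing_limit:
  fixes w w' :: "nat \<Rightarrow> real \<Rightarrow> real"
  assumes d: "\<And>e. e > 0 \<Longrightarrow> \<exists>\<delta>>0. (\<forall>\<^sub>F n in sequentially. \<forall>\<tau>\<in>{0..\<delta>}. (w n has_real_derivative w' n \<tau>) (at \<tau>) \<and> \<bar>w' n \<tau> - c\<bar> < e) \<and>
      (\<lambda>n. w n \<delta>) \<longlonglongrightarrow> 0"
    and w0: "(\<lambda>n. w n 0) \<longlonglongrightarrow> 0"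
  shows "c = 0"
proof (rule ccontr)
  assume "c \<noteq> 0"
  then have "\<bar>c\<bar> / 2 > 0" by simp
  from d[OF this] obtain \<delta> where \<delta>: "\<delta> > 0"
    and ev: "\<forall>\<^sub>F n in sequentially. \<forall>\<tau>\<in>{0..\<delta>}. (w n has_real_derivative w' n \<tau>) (at \<tau>) \<and> \<bar>w' n \<tau> - c\<bar> < \<bar>c\<bar> / 2"
    and l: "(\<lambda>n. w n \<delta>) \<longlonglongrightarrow> 0" by blast
  have "(\<lambda>n. \<bar>w n \<delta> - w n 0\<bar>) \<longlonglongrightarrow> \<bar>0 - 0\<bar>" by (intro tendsto_intros l w0)
  then have "\<forall>\<^sub>F n in sequentially. \<bar>w n \<delta> - w n 0\<bar> < \<delta> * (\<bar>c\<bar> / 2)"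
    using \<delta> \<open>c \<noteq> 0\<close> by (intro order_tendstoD(2)) auto
  with ev have "\<forall>\<^sub>F n in sequentially. False"
  proof eventually_elim
    case (elim n)
    have "\<exists>z>0. z < \<delta> \<and> w n \<delta> - w n 0 = (\<delta> - 0) * w' n z"
      by (rule MVT2[OF \<delta>]) (use elim(1) in auto)
    then obtain z where z: "0 < z" "z < \<delta>" "w n \<delta> - w n 0 = \<delta> * w' n z" by auto
    have "\<bar>w' n z - c\<bar> < \<bar>c\<bar> / 2" using elim(1) z by auto
    then have "\<bar>w' n z\<bar> > \<bar>c\<bar> / 2" by linarith
    then have "\<delta> * (\<bar>c\<bar> / 2) < \<bar>w n \<delta> - w n 0\<bar>" unfolding z(3) abs_mult using \<delta> by simp
    then show ?case using elim(2) by simp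
  qed
  then show False by simp
qed

section \<open>Boundary values of derivatives of functions that vanish on the boundary\<close>

lemma closure_approx_seq:
  fixes x :: "real^'n::finite"
  assumes "x \<in> closure \<Omega>"
  obtains X where "\<And>n. X n \<in> \<Omega>" "X \<longlonglongrightarrow> x"
  using assms unfolding closure_sequential by blast

text \<open>At a boundary point \<open>f'\<close> is a limit from inside and not given as the time
  derivative of \<open>f\<close>; so the vanishing is transported from points of \<Omega> that
  converge to \<open>x\<close>.\<close>

lemma time_derivative_zero_on_frontier:
  fixes f f' :: "real \<Rightarrow> real^'n::finite \<Rightarrow> real"
  assumes der: "\<And>t x. x \<in> \<Omega> \<Longrightarrow> ((\<lambda>s. f s x) has_real_derivative f' t x) (at t)"
    and cf: "continuous_on (UNIV \<times> closure \<Omega>) (\<lambda>(t, x). f t x)"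
    and cf': "continuous_on (UNIV \<times> closure \<Omega>) (\<lambda>(t, x). f' t x)"
    and z: "\<And>t. f t x = 0" and x: "x \<in> closure \<Omega>"
  shows "f' t x = 0"
proof -
  obtain X where X: "\<And>n. X n \<in> \<Omega>" "X \<longlonglongrightarrow> x" using closure_approx_seq[OF x] by blast
  have XC: "X n \<in> closure \<Omega>" for n using X(1) closure_subset by blast
  have lim: "(\<lambda>n. f s (X n)) \<longlonglongrightarrow> 0" for s
    using continuous_on_tendsto_compose[OF continuous_on_slice[OF cf] X(2) x] XC z by simp
  show ?thesis
  proof (rule derivative_zero_of_vanishing_limit[where w="\<lambda>n \<tau>. f (t + \<tau>) (X n)" and w'="\<lambda>n \<tau>. f' (t + \<tau>) (X n)"])
    show "(\<lambda>n. f (t + 0) (X n)) \<longlonglongrightarrow> 0" using lim by simp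
    fix e :: real assume e: "e > 0"
    have "(t, x) \<in> UNIV \<times> closure \<Omega>" using x by simp
    then obtain d where d: "d > 0" "\<And>p. p \<in> UNIV \<times> closure \<Omega> \<Longrightarrow> dist p (t, x) < d \<Longrightarrow> dist ((\<lambda>(t, x). f' t x) p) (f' t x) < e"
      using cf'[unfolded continuous_on_iff, rule_format, OF _ e, of "(t, x)"] by auto
    \<comment> \<open>Time will move by at most d / 3 and space by less than d / 2, together less
      than d.\<close>
    have ev: "\<forall>\<^sub>F n in sequentially. dist (X n) x < d / 2" using X(2) d(1) by (intro tendstoD) auto
    have "\<forall>\<^sub>F n in sequentially. \<forall>\<tau>\<in>{0..d/3}. ((\<lambda>\<tau>. f (t + \<tau>) (X n)) has_real_derivative f' (t + \<tau>) (X n)) (at \<tau>) \<and>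
        \<bar>f' (t + \<tau>) (X n) - f' t x\<bar> < e"
      using ev
    proof eventually_elim
      case (elim n)
      show ?case
      proof (intro ballI conjI)
        fix \<tau> assume \<tau>: "\<tau> \<in> {0..d/3}"
        show "((\<lambda>\<tau>. f (t + \<tau>) (X n)) has_real_derivative f' (t + \<tau>) (X n)) (at \<tau>)"
          using DERIV_shift[of "\<lambda>s. f s (X n)" "f' (t + \<tau>) (X n)" \<tau> t] der[OF X(1)] by (simp add: add.commute)
        have "dist (t + \<tau>, X n) (t, x) \<le> dist (t + \<tau>) t + dist (X n) x"
          unfolding dist_Pair_Pair by (rule sqrt_sum_squares_le_sum) auto
        also have "\<dots> < d" using elim \<tau> d(1) by (simp add: dist_real_def)
        finally show "\<bar>f' (t + \<tau>) (X n) - f' t x\<bar> < e" using d(2)[of "(t + \<tau>, X n)"] XC by (simp add: dist_real_def)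
      qed
    qed
    then show "\<exists>\<delta>>0. (\<forall>\<^sub>F n in sequentially. \<forall>\<tau>\<in>{0..\<delta>}. ((\<lambda>\<tau>. f (t + \<tau>) (X n)) has_real_derivative f' (t + \<tau>) (X n)) (at \<tau>) \<and>
        \<bar>f' (t + \<tau>) (X n) - f' t x\<bar> < e) \<and> (\<lambda>n. f (t + \<delta>) (X n)) \<longlonglongrightarrow> 0"
      using d(1) lim by (intro exI[of _ "d/3"] conjI) auto
  qed
qed

text \<open>The combination is the derivative of \<open>g\<close> along the curve in the graph over
  the line p + \<tau> e_k. There \<open>g\<close> is zero, but differentiability is given only
  inside, so the curve is pushed into \<Omega> by the small amount \<open>h n\<close>.\<close>

lemma tangential_derivative_zero:
  fixes g :: "real^'n::finite \<Rightarrow> real"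
  assumes ch: "boundary_chart \<Omega> U m s \<gamma>" and \<Omega>: "open \<Omega>"
    and cg: "continuous_on (closure \<Omega>) g" and cG: "continuous_on (closure \<Omega>) G"
    and der: "\<And>x. x \<in> \<Omega> \<Longrightarrow> GDERIV g x :> G x"
    and z: "\<And>x. x \<in> frontier \<Omega> \<Longrightarrow> g x = 0" and p: "p \<in> U" "p \<in> frontier \<Omega>" and km: "k \<noteq> m"
  shows "G p $ k + grad \<gamma> p $ k * G p $ m = 0"
proof -
  note c = boundary_chartD[OF ch]
  define \<Phi> where "\<Phi> = (\<lambda>x. G x $ k + grad \<gamma> x $ k * G x $ m)"
  have c\<Phi>: "continuous_on (closure \<Omega>) \<Phi>"
    unfolding \<Phi>_def using cG continuous_on_subset[OF C1_continuous_grad[OF c(4)]] by (intro continuous_intros) auto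
  have pg: "p $ m = \<gamma> p" using chart_frontier(1)[OF ch \<Omega> p(1)] p(2) by simp
  \<comment> \<open>The curve on the graph; the correction along e_m keeps its m-th coordinate equal
    to the value of \<gamma>.\<close>
  define y where "y = (\<lambda>\<tau>. p + \<tau> *\<^sub>R axis k 1 + (\<gamma> (p + \<tau> *\<^sub>R axis k 1) - \<gamma> p) *\<^sub>R axis m 1)"
  define h where "h = (\<lambda>n. 1 / real (Suc n))"
  \<comment> \<open>Shifted against \<open>s\<close>, hence in \<Omega> as long as it stays in
    \<open>U\<close>. Its tangent is that of the boundary curve, since \<gamma> ignores the
    shift.\<close>
  define X where "X = (\<lambda>n \<tau>. y \<tau> - (s * h n) *\<^sub>R axis m 1)"
  have h: "h n > 0" "h \<longlonglongrightarrow> 0" for n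
    unfolding h_def using LIMSEQ_inverse_real_of_nat by (auto simp: inverse_eq_divide)
  have y0: "y 0 = p" by (simp add: y_def)
  have cy: "continuous_on UNIV y"
    unfolding y_def by (intro continuous_intros continuous_on_compose2[OF C1_continuous[OF c(4)]]) auto
  have y\<gamma>: "\<gamma> (y \<tau>) = \<gamma> (p + \<tau> *\<^sub>R axis k 1)" for \<tau> unfolding y_def by (simp add: c(5))
  have ym: "y \<tau> $ m = \<gamma> (y \<tau>)" for \<tau> unfolding y\<gamma> using pg km by (simp add: y_def axis_def)
  have X\<gamma>: "\<gamma> (X n \<tau>) = \<gamma> (y \<tau>)" "grad \<gamma> (X n \<tau>) = grad \<gamma> (p + \<tau> *\<^sub>R axis k 1)" for n \<tau>
  proof -
    have e: "X n \<tau> = p + \<tau> *\<^sub>R axis k 1 + (\<gamma> (p + \<tau> *\<^sub>R axis k 1) - \<gamma> p - s * h n) *\<^sub>R axis m 1"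
      unfolding X_def y_def by (simp add: algebra_simps)
    show "\<gamma> (X n \<tau>) = \<gamma> (y \<tau>)" unfolding e y\<gamma> by (simp add: c(5))
    show "grad \<gamma> (X n \<tau>) = grad \<gamma> (p + \<tau> *\<^sub>R axis k 1)" unfolding e by (rule invariant_grad(1)[OF c(5)])
  qed
  have Xin: "X n \<tau> \<in> \<Omega>" if "X n \<tau> \<in> U" for n \<tau>
  proof -
    have "s * (X n \<tau> $ m - \<gamma> (X n \<tau>)) = - (s * s) * h n" unfolding X\<gamma> by (simp add: X_def ym)
    then show ?thesis using c(6)[OF that] h(1)[of n] c(3) by simp
  qed
  have dX: "(X n has_derivative (\<lambda>z. z *\<^sub>R axis k 1 + (grad \<gamma> (X n \<tau>) $ k * z) *\<^sub>R axis m 1)) (at \<tau>)" for n \<tau>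
  proof -
    have "((\<lambda>\<tau>. \<gamma> (p + \<tau> *\<^sub>R axis k 1)) has_real_derivative grad \<gamma> (p + \<tau> *\<^sub>R axis k 1) $ k) (at \<tau>)"
      by (rule GDERIV_line) (rule C1_has_derivative[OF c(4)])
    then have "((\<lambda>\<tau>. \<gamma> (p + \<tau> *\<^sub>R axis k 1)) has_derivative (\<lambda>z. grad \<gamma> (X n \<tau>) $ k * z)) (at \<tau>)"
      unfolding X\<gamma> by (simp add: has_field_derivative_def)
    then show ?thesis unfolding X_def[abs_def] y_def
      by (auto intro!: derivative_eq_intros)
  qed
  have dgX: "((\<lambda>\<tau>. g (X n \<tau>)) has_real_derivative \<Phi> (X n \<tau>)) (at \<tau>)" if "X n \<tau> \<in> U" for n \<tau>
  proof -
    have "(g has_derivative (\<lambda>h. h \<bullet> G (X n \<tau>))) (at (X n \<tau>))" using der[OF Xin[OF that]] by (simp add: gderiv_def)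
    from has_derivative_compose[OF dX this] show ?thesis
      unfolding has_field_derivative_def \<Phi>_def
      by (rule has_derivative_eq_rhs) (simp add: inner_add_left inner_axis' algebra_simps fun_eq_iff)
  qed
  have Xlim: "(\<lambda>n. X n \<tau>) \<longlonglongrightarrow> y \<tau>" for \<tau>
  proof -
    have "(\<lambda>n. X n \<tau>) \<longlonglongrightarrow> y \<tau> - (s * 0) *\<^sub>R axis m 1" unfolding X_def by (intro tendsto_intros h)
    then show ?thesis by simp
  qed
  have glim: "(\<lambda>n. g (X n \<tau>)) \<longlonglongrightarrow> 0" if "y \<tau> \<in> U" for \<tau>
  proof -
    have yF: "y \<tau> \<in> frontier \<Omega>" using chart_frontier(1)[OF ch \<Omega> that] ym by simp
    have "\<forall>\<^sub>F n in sequentially. X n \<tau> \<in> U" using topological_tendstoD[OF Xlim c(1) that] .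
    then have "\<forall>\<^sub>F n in sequentially. X n \<tau> \<in> closure \<Omega>"
      by eventually_elim (use Xin closure_subset in blast)
    then have "(\<lambda>n. g (X n \<tau>)) \<longlonglongrightarrow> g (y \<tau>)"
      using yF by (intro continuous_on_tendsto_compose[OF cg Xlim]) (auto simp: frontier_def)
    then show ?thesis using z[OF yF] by simp
  qed
  have "\<Phi> p = 0"
  proof (rule derivative_zero_of_vanishing_limit[where w="\<lambda>n \<tau>. g (X n \<tau>)" and w'="\<lambda>n \<tau>. \<Phi> (X n \<tau>)"])
    show "(\<lambda>n. g (X n 0)) \<longlonglongrightarrow> 0" using glim[of 0] y0 p(1) by simp
    fix e :: real assume e: "e > 0"
    have pC: "p \<in> closure \<Omega>" using p(2) by (auto simp: frontier_def)
    obtain d1 where d1: "d1 > 0" "\<And>q. q \<in> closure \<Omega> \<Longrightarrow> dist q p < d1 \<Longrightarrow> dist (\<Phi> q) (\<Phi> p) < e"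
      using c\<Phi>[unfolded continuous_on_iff, rule_format, OF pC e] by auto
    obtain d2 where d2: "d2 > 0" "ball p d2 \<subseteq> U" using c(1) p(1) openE by blast
    define d where "d = min d1 d2"
    have d: "d > 0" using d1 d2 by (simp add: d_def)
    have "continuous (at 0) y" using cy by (simp add: continuous_on_eq_continuous_at)
    then obtain \<delta> where \<delta>: "\<delta> > 0" "\<And>\<tau>. dist \<tau> 0 < \<delta> \<Longrightarrow> dist (y \<tau>) (y 0) < d / 2"
      unfolding continuous_at_eps_delta using d by (metis half_gt_zero)
    have yd: "dist (y \<tau>) p < d / 2" if "\<tau> \<in> {0..\<delta>/2}" for \<tau> using \<delta>(2)[of \<tau>] that \<delta>(1) y0 by simp
    have ev: "\<forall>\<^sub>F n in sequentially. h n < d / 2" using h(2) d by (intro order_tendstoD(2)) auto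
    have "\<forall>\<^sub>F n in sequentially. \<forall>\<tau>\<in>{0..\<delta>/2}. ((\<lambda>\<tau>. g (X n \<tau>)) has_real_derivative \<Phi> (X n \<tau>)) (at \<tau>) \<and> \<bar>\<Phi> (X n \<tau>) - \<Phi> p\<bar> < e"
      using ev
    proof eventually_elim
      case (elim n)
      show ?case
      proof
        fix \<tau> assume \<tau>: "\<tau> \<in> {0..\<delta>/2}"
        have "dist (X n \<tau>) (y \<tau>) = h n" using c(2) h(1)[of n] by (auto simp: X_def dist_norm)
        then have "dist (X n \<tau>) p < d" using elim yd[OF \<tau>] dist_triangle[of "X n \<tau>" p "y \<tau>"] by simp
        then have XU: "X n \<tau> \<in> U" and near: "dist (X n \<tau>) p < d1" using d2 by (auto simp: d_def dist_commute)
        have "X n \<tau> \<in> closure \<Omega>" using Xin[OF XU] closure_subset by blast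
        then show "((\<lambda>\<tau>. g (X n \<tau>)) has_real_derivative \<Phi> (X n \<tau>)) (at \<tau>) \<and> \<bar>\<Phi> (X n \<tau>) - \<Phi> p\<bar> < e"
          using dgX[OF XU] d1(2) near by (simp add: dist_real_def)
      qed
    qed
    moreover have "y (\<delta>/2) \<in> U" using yd[of "\<delta>/2"] \<delta>(1) d2 d by (auto simp: d_def dist_commute intro!: subsetD[OF d2(2)])
    ultimately show "\<exists>\<delta>>0. (\<forall>\<^sub>F n in sequentially. \<forall>\<tau>\<in>{0..\<delta>}. ((\<lambda>\<tau>. g (X n \<tau>)) has_real_derivative \<Phi> (X n \<tau>)) (at \<tau>) \<and> \<bar>\<Phi> (X n \<tau>) - \<Phi> p\<bar> < e) \<and>
      (\<lambda>n. g (X n \<delta>)) \<longlonglongrightarrow> 0"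
      using \<delta>(1) glim by (intro exI[of _ "\<delta>/2"] conjI) auto
  qed
  then show ?thesis by (simp add: \<Phi>_def)
qed

text \<open>Each G_k is G_m times the k-th entry of e_m - grad \<gamma>, of which the normal is a
  multiple. Parallelism is expressed by vanishing two-by-two minors, which avoids a proportionality
  factor.\<close>

lemma gradient_parallel_normal:
  fixes g :: "real^'n::finite \<Rightarrow> real"
  assumes \<Omega>: "open \<Omega>"
    and cg: "continuous_on (closure \<Omega>) g" and cG: "continuous_on (closure \<Omega>) G"
    and der: "\<And>x. x \<in> \<Omega> \<Longrightarrow> GDERIV g x :> G x"
    and z: "\<And>x. x \<in> frontier \<Omega> \<Longrightarrow> g x = 0" and x: "x \<in> regular_boundary \<Omega>"
  shows "G x $ j * outward_normal \<Omega> x $ k = G x $ k * outward_normal \<Omega> x $ j"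
proof -
  obtain U m s \<gamma> where *: "x \<in> U" "boundary_chart \<Omega> U m s \<gamma>" "x \<in> frontier \<Omega>" using x by (rule regular_boundaryE)
  note c = boundary_chartD[OF *(2)]
  define N where "N = axis m 1 - grad \<gamma> x"
  have a: "G x $ k = G x $ m * N $ k" for k
  proof (cases "k = m")
    case True then show ?thesis using invariant_grad(2)[OF c(5)] by (simp add: N_def)
  next
    case False
    then show ?thesis using tangential_derivative_zero[OF *(2) \<Omega> cg cG der z *(1,3) False]
      by (simp add: N_def axis_def algebra_simps)
  qed
  have b: "outward_normal \<Omega> x $ k = (s / sqrt (1 + (norm (grad \<gamma> x))\<^sup>2)) * N $ k" for k
    unfolding outward_normal_eq[OF *(2) \<Omega> *(1,3)] by (simp add: chart_normal_def N_def)
  show ?thesis unfolding b a[of j] a[of k] by (simp only: mult_ac)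
qed

subsection \<open>The pointwise conservation law\<close>

text \<open>The stress tensor of the displacement gradient \<open>a\<close>, where
  \<open>a j l\<close> is the derivative of the j-th component in direction l; the elastic form is
  its contraction with \<open>a\<close>.\<close>

definition stress :: "('n::finite \<Rightarrow> 'n \<Rightarrow> 'n \<Rightarrow> 'n \<Rightarrow> real) \<Rightarrow> ('n \<Rightarrow> 'n \<Rightarrow> real) \<Rightarrow> 'n \<Rightarrow> 'n \<Rightarrow> real" where
  "stress C a k i = (\<Sum>j\<in>UNIV. \<Sum>l\<in>UNIV. C k l i j * a j l)"

lemma elastic_form_stress:
  "(\<Sum>i\<in>UNIV. \<Sum>j\<in>UNIV. \<Sum>k\<in>UNIV. \<Sum>l\<in>UNIV. C k l i j * a i k * c j l) =
   (\<Sum>i\<in>UNIV. \<Sum>k\<in>UNIV. stress C c k i * a i k)"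
proof (rule sum.cong[OF refl])
  fix i
  have "(\<Sum>j\<in>UNIV. \<Sum>k\<in>UNIV. \<Sum>l\<in>UNIV. C k l i j * a i k * c j l) =
      (\<Sum>k\<in>UNIV. \<Sum>j\<in>UNIV. \<Sum>l\<in>UNIV. C k l i j * a i k * c j l)" by (rule sum.swap)
  also have "\<dots> = (\<Sum>k\<in>UNIV. stress C c k i * a i k)"
    unfolding stress_def sum_distrib_right by (simp only: mult_ac)
  finally show "(\<Sum>j\<in>UNIV. \<Sum>k\<in>UNIV. \<Sum>l\<in>UNIV. C k l i j * a i k * c j l) = (\<Sum>k\<in>UNIV. stress C c k i * a i k)" .
qed

text \<open>The symmetry under exchange of the two index pairs makes the elastic form a symmetric
  bilinear form. This gives the factor 2 in the time and space derivatives of the quadratic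
  form.\<close>

lemma stress_sym:
  fixes C :: "'n::finite \<Rightarrow> 'n \<Rightarrow> 'n \<Rightarrow> 'n \<Rightarrow> real"
  assumes "\<And>k l i j. C k l i j = C l k j i"
  shows "(\<Sum>i\<in>UNIV. \<Sum>k\<in>UNIV. stress C c k i * a i k) = (\<Sum>i\<in>UNIV. \<Sum>k\<in>UNIV. stress C a k i * c i k)"
proof -
  have "(\<Sum>i\<in>UNIV. \<Sum>k\<in>UNIV. stress C c k i * a i k) =
      (\<Sum>i\<in>UNIV. \<Sum>j\<in>UNIV. \<Sum>k\<in>UNIV. \<Sum>l\<in>UNIV. C k l i j * a i k * c j l)"
    by (rule elastic_form_stress[symmetric])
  also have "\<dots> = (\<Sum>j\<in>UNIV. \<Sum>i\<in>UNIV. \<Sum>k\<in>UNIV. \<Sum>l\<in>UNIV. C k l i j * a i k * c j l)" by (rule sum.swap)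
  also have "\<dots> = (\<Sum>j\<in>UNIV. \<Sum>i\<in>UNIV. \<Sum>l\<in>UNIV. \<Sum>k\<in>UNIV. C k l i j * a i k * c j l)"
    by (intro sum.cong refl sum.swap)
  also have "\<dots> = (\<Sum>j\<in>UNIV. \<Sum>i\<in>UNIV. \<Sum>l\<in>UNIV. \<Sum>k\<in>UNIV. C l k j i * c j l * a i k)"
    by (intro sum.cong refl) (subst assms, simp)
  also have "\<dots> = (\<Sum>i\<in>UNIV. \<Sum>k\<in>UNIV. stress C a k i * c i k)" by (rule elastic_form_stress)
  finally show ?thesis .
qed

text \<open>The pointwise identity behind the theorem: \<open>p, q, b\<close> stand for \<open>u, u\<^sub>t, u\<^sub>t\<^sub>t\<close>, \<open>a, c\<close> for the gradients
  of \<open>u, u\<^sub>t\<close>, and \<open>d i k l\<close> for the second derivatives of \<open>u\<^sup>i\<close>. The left-hand side is the time derivative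
  of the integrand, the first sum on the right is the divergence of the flux
  \<open>Y\<^sub>k = stress\<^sub>k\<^sub>i Z\<^sub>i + x\<^sub>k (F + |q|\<^sup>2/2 - W/2)\<close> with \<open>Z\<^sub>i = t q\<^sub>i + a\<^sub>i\<^sub>m x\<^sub>m + (n-1)/2 p\<^sub>i\<close>.\<close>

lemma virial_identity:
  fixes C :: "'n::finite \<Rightarrow> 'n \<Rightarrow> 'n \<Rightarrow> 'n \<Rightarrow> real" and a c :: "'n \<Rightarrow> 'n \<Rightarrow> real"
    and d :: "'n \<Rightarrow> 'n \<Rightarrow> 'n \<Rightarrow> real" and p q b f x :: "'n \<Rightarrow> real" and t Fu n :: real
  defines "S \<equiv> stress C a"
    and "W \<equiv> (\<Sum>i\<in>UNIV. \<Sum>k\<in>UNIV. stress C a k i * a i k)"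
    and "Q \<equiv> (\<Sum>i\<in>UNIV. q i * q i)"
    and "Z \<equiv> \<lambda>i. t * q i + (\<Sum>m\<in>UNIV. a i m * x m) + (n - 1) / 2 * p i"
    and "Zd \<equiv> \<lambda>i k. t * c i k + (\<Sum>m\<in>UNIV. x m * d i m k) + a i k + (n - 1) / 2 * a i k"
    and "Sd \<equiv> \<lambda>k i m. stress C (\<lambda>j l. d j l m) k i"
    and "Md \<equiv> \<lambda>k. (\<Sum>i\<in>UNIV. f i * a i k) + (\<Sum>i\<in>UNIV. q i * c i k) - (\<Sum>i\<in>UNIV. \<Sum>m\<in>UNIV. stress C a m i * d i m k)"
  assumes dsym: "\<And>i k l. d i k l = d i l k" and n: "n = real CARD('n)"
    and pde: "\<And>i. b i = (\<Sum>j\<in>UNIV. \<Sum>k\<in>UNIV. \<Sum>l\<in>UNIV. C k l i j * d j k l) + f i"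
  shows "(1/2 * (W + Q) - Fu) + t * ((\<Sum>i\<in>UNIV. \<Sum>k\<in>UNIV. S k i * c i k) + (\<Sum>i\<in>UNIV. q i * b i) - (\<Sum>i\<in>UNIV. f i * q i))
      + (\<Sum>i\<in>UNIV. \<Sum>k\<in>UNIV. (b i * a i k + q i * c i k) * x k) + (n - 1) / 2 * (\<Sum>i\<in>UNIV. q i * q i + p i * b i) =
    (\<Sum>k\<in>UNIV. (\<Sum>i\<in>UNIV. S k i * Zd i k + Z i * Sd k i k) + x k * Md k + (Fu + 1/2 * Q - 1/2 * W))
      + ((n - 1) / 2 * (\<Sum>i\<in>UNIV. p i * f i) - (n + 1) * Fu)"
proof -
  \<comment> \<open>The sums that occur are named as atoms, which leaves a polynomial identity at
    the end.\<close>
  define T1 where "T1 = (\<Sum>i\<in>UNIV. \<Sum>k\<in>UNIV. b i * a i k * x k)"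
  define T2 where "T2 = (\<Sum>i\<in>UNIV. \<Sum>k\<in>UNIV. q i * c i k * x k)"
  define T3 where "T3 = (\<Sum>i\<in>UNIV. \<Sum>k\<in>UNIV. S k i * c i k)"
  define T4 where "T4 = (\<Sum>i\<in>UNIV. \<Sum>k\<in>UNIV. \<Sum>m\<in>UNIV. S k i * (x m * d i m k))"
  define T5 where "T5 = (\<Sum>i\<in>UNIV. \<Sum>k\<in>UNIV. f i * a i k * x k)"
  define pb where "pb = (\<Sum>i\<in>UNIV. p i * b i)"
  define pf where "pf = (\<Sum>i\<in>UNIV. p i * f i)"
  define qb where "qb = (\<Sum>i\<in>UNIV. q i * b i)"
  define fq where "fq = (\<Sum>i\<in>UNIV. f i * q i)"
  \<comment> \<open>The divergence of the stress is b - f by the equation, once the two spatial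
    derivatives are exchanged.\<close>
  have Sdk: "(\<Sum>k\<in>UNIV. Sd k i k) = b i - f i" for i
  proof -
    have "(\<Sum>k\<in>UNIV. Sd k i k) = (\<Sum>j\<in>UNIV. \<Sum>k\<in>UNIV. \<Sum>l\<in>UNIV. C k l i j * d j l k)"
      unfolding Sd_def stress_def by (rule sum.swap)
    also have "\<dots> = (\<Sum>j\<in>UNIV. \<Sum>k\<in>UNIV. \<Sum>l\<in>UNIV. C k l i j * d j k l)"
      by (intro sum.cong refl) (subst dsym, rule refl)
    finally show ?thesis using pde[of i] by simp
  qed
  have A: "(\<Sum>k\<in>UNIV. \<Sum>i\<in>UNIV. S k i * Zd i k) = t * T3 + T4 + W + (n - 1) / 2 * W"
  proof -
    have "(\<Sum>k\<in>UNIV. \<Sum>i\<in>UNIV. S k i * Zd i k) = (\<Sum>i\<in>UNIV. \<Sum>k\<in>UNIV. S k i * Zd i k)" by (rule sum.swap)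
    also have "\<dots> = (\<Sum>i\<in>UNIV. \<Sum>k\<in>UNIV. t * (S k i * c i k) + (\<Sum>m\<in>UNIV. S k i * (x m * d i m k)) + S k i * a i k + (n - 1) / 2 * (S k i * a i k))"
      unfolding Zd_def by (simp add: algebra_simps sum_distrib_left)
    also have "\<dots> = t * T3 + T4 + W + (n - 1) / 2 * W"
      unfolding T3_def T4_def W_def S_def[symmetric] by (simp only: sum.distrib sum_distrib_left)
    finally show ?thesis .
  qed
  have B: "(\<Sum>k\<in>UNIV. \<Sum>i\<in>UNIV. Z i * Sd k i k) = t * (qb - fq) + (T1 - T5) + (n - 1) / 2 * (pb - pf)"
  proof -
    have "(\<Sum>k\<in>UNIV. \<Sum>i\<in>UNIV. Z i * Sd k i k) = (\<Sum>i\<in>UNIV. \<Sum>k\<in>UNIV. Z i * Sd k i k)" by (rule sum.swap)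
    also have "\<dots> = (\<Sum>i\<in>UNIV. Z i * (b i - f i))" by (simp add: sum_distrib_left[symmetric] Sdk)
    also have "\<dots> = (\<Sum>i\<in>UNIV. t * (q i * b i - f i * q i) + ((\<Sum>k\<in>UNIV. b i * a i k * x k) - (\<Sum>k\<in>UNIV. f i * a i k * x k)) + (n - 1) / 2 * (p i * b i - p i * f i))"
    proof (rule sum.cong[OF refl])
      fix i
      have e: "(\<Sum>m\<in>UNIV. a i m * x m) * (b i - f i) = (\<Sum>k\<in>UNIV. b i * a i k * x k) - (\<Sum>k\<in>UNIV. f i * a i k * x k)"
        unfolding sum_distrib_right sum_subtractf[symmetric] by (intro sum.cong refl) (simp add: algebra_simps)
      have "Z i * (b i - f i) = t * q i * (b i - f i) + (\<Sum>m\<in>UNIV. a i m * x m) * (b i - f i) + (n - 1) / 2 * p i * (b i - f i)"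
        unfolding Z_def by (simp only: distrib_right)
      moreover have "t * q' * (b' - f') + (X - Y) + r * p' * (b' - f') = t * (q' * b' - f' * q') + (X - Y) + r * (p' * b' - p' * f')"
        for r X Y q' b' f' p' :: real by (simp add: algebra_simps)
      ultimately show "Z i * (b i - f i) = t * (q i * b i - f i * q i) + ((\<Sum>k\<in>UNIV. b i * a i k * x k) - (\<Sum>k\<in>UNIV. f i * a i k * x k)) + (n - 1) / 2 * (p i * b i - p i * f i)"
        unfolding e by (simp only:)
    qed
    also have "\<dots> = t * (qb - fq) + (T1 - T5) + (n - 1) / 2 * (pb - pf)"
      unfolding qb_def fq_def T1_def T5_def pb_def pf_def
      by (simp only: sum.distrib sum_distrib_left sum_subtractf right_diff_distrib)
    finally show ?thesis .
  qed
  \<comment> \<open>\<open>T4\<close> returns with the opposite sign: x_k times the derivative of -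
    W/2 cancels what the derivative of a_im x_m contributes against the stress. Likewise
    \<open>T5\<close> cancels the force term from the divergence of the stress.\<close>
  have M: "(\<Sum>k\<in>UNIV. x k * Md k) = T5 + T2 - T4"
  proof -
    have "(\<Sum>k\<in>UNIV. x k * Md k) = (\<Sum>k\<in>UNIV. (\<Sum>i\<in>UNIV. f i * a i k * x k) + (\<Sum>i\<in>UNIV. q i * c i k * x k) - (\<Sum>i\<in>UNIV. \<Sum>m\<in>UNIV. S m i * (x k * d i k m)))"
    proof (rule sum.cong[OF refl])
      fix k
      have "x k * (\<Sum>i\<in>UNIV. \<Sum>m\<in>UNIV. stress C a m i * d i m k) = (\<Sum>i\<in>UNIV. \<Sum>m\<in>UNIV. S m i * (x k * d i k m))"
        unfolding sum_distrib_left S_def by (intro sum.cong refl) (subst dsym, simp)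
      moreover have "x k * (\<Sum>i\<in>UNIV. f i * a i k) = (\<Sum>i\<in>UNIV. f i * a i k * x k)"
        "x k * (\<Sum>i\<in>UNIV. q i * c i k) = (\<Sum>i\<in>UNIV. q i * c i k * x k)"
        unfolding sum_distrib_left by (simp_all only: mult_ac)
      ultimately show "x k * Md k = (\<Sum>i\<in>UNIV. f i * a i k * x k) + (\<Sum>i\<in>UNIV. q i * c i k * x k) - (\<Sum>i\<in>UNIV. \<Sum>m\<in>UNIV. S m i * (x k * d i k m))"
        unfolding Md_def by (simp only: distrib_left right_diff_distrib)
    qed
    also have "\<dots> = (\<Sum>k\<in>UNIV. \<Sum>i\<in>UNIV. f i * a i k * x k) + (\<Sum>k\<in>UNIV. \<Sum>i\<in>UNIV. q i * c i k * x k) - (\<Sum>k\<in>UNIV. \<Sum>i\<in>UNIV. \<Sum>m\<in>UNIV. S m i * (x k * d i k m))"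
      by (simp only: sum.distrib sum_subtractf)
    also have "(\<Sum>k\<in>UNIV. \<Sum>i\<in>UNIV. f i * a i k * x k) = T5" unfolding T5_def by (rule sum.swap)
    also have "(\<Sum>k\<in>UNIV. \<Sum>i\<in>UNIV. q i * c i k * x k) = T2" unfolding T2_def by (rule sum.swap)
    also have "(\<Sum>k\<in>UNIV. \<Sum>i\<in>UNIV. \<Sum>m\<in>UNIV. S m i * (x k * d i k m)) = (\<Sum>i\<in>UNIV. \<Sum>k\<in>UNIV. \<Sum>m\<in>UNIV. S m i * (x k * d i k m))"
      by (rule sum.swap)
    also have "\<dots> = T4" unfolding T4_def by (intro sum.cong refl sum.swap)
    finally show ?thesis .
  qed
  have L: "(\<Sum>i\<in>UNIV. \<Sum>k\<in>UNIV. (b i * a i k + q i * c i k) * x k) = T1 + T2"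
    unfolding T1_def T2_def by (simp only: distrib_right sum.distrib)
  have R: "(\<Sum>k\<in>UNIV. (\<Sum>i\<in>UNIV. S k i * Zd i k + Z i * Sd k i k) + x k * Md k + (Fu + 1/2 * Q - 1/2 * W)) =
    (t * T3 + T4 + W + (n - 1) / 2 * W) + (t * (qb - fq) + (T1 - T5) + (n - 1) / 2 * (pb - pf)) + (T5 + T2 - T4) + n * (Fu + 1/2 * Q - 1/2 * W)"
  proof -
    have "(\<Sum>k\<in>UNIV. (\<Sum>i\<in>UNIV. S k i * Zd i k + Z i * Sd k i k) + x k * Md k + (Fu + 1/2 * Q - 1/2 * W)) =
        (\<Sum>k\<in>UNIV. \<Sum>i\<in>UNIV. S k i * Zd i k) + (\<Sum>k\<in>UNIV. \<Sum>i\<in>UNIV. Z i * Sd k i k) + (\<Sum>k\<in>UNIV. x k * Md k)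
        + n * (Fu + 1/2 * Q - 1/2 * W)"
      by (simp add: sum.distrib n)
    then show ?thesis unfolding A B M .
  qed
  \<comment> \<open>The coefficients balance: W has 1 + (n-1)/2 - n/2 = 1/2, Q has n/2 = 1/2 +
    (n-1)/2, and F has n - (n+1) = -1. This is where the weight (n-1)/2 of the last term of the
    integrand comes from.\<close>
  show ?thesis
    unfolding R L
    unfolding T3_def[symmetric] qb_def[symmetric] fq_def[symmetric] pf_def[symmetric] sum.distrib pb_def[symmetric] Q_def[symmetric]
    by (simp add: field_simps)
qed

section \<open>From smoothness up to the boundary to \<open>C1_upto\<close>\<close>

lemma C1_upto_cong:
  "C1_upto S g G \<Longrightarrow> (\<And>x. x \<in> S \<Longrightarrow> G x = G' x) \<Longrightarrow> C1_upto S g G'"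
  unfolding C1_upto_def by (auto cong: continuous_on_cong simp: image_def)

text \<open>Continuity up to the compact closure supplies the bounds that \<open>C1_upto\<close>
  asks for.\<close>

lemma C1_upto_continuous_gradient:
  fixes g :: "real^'n::finite \<Rightarrow> real"
  assumes "bounded S" "continuous_on (closure S) g" "continuous_on (closure S) G" "\<And>x. x \<in> S \<Longrightarrow> GDERIV g x :> G x"
  shows "C1_upto S g G"
proof (rule C1_uptoI)
  have "compact (closure S)" using assms(1) by simp
  then show "bounded (g ` closure S)"
    using assms(2) compact_continuous_image compact_imp_bounded by blast
  have "bounded (G ` closure S)"
    using \<open>compact (closure S)\<close> assms(3) compact_continuous_image compact_imp_bounded by blast
  then show "bounded (G ` S)" by (rule bounded_subset) (use closure_subset in blast)
  show "continuous_on S G" using assms(3) closure_subset by (rule continuous_on_subset)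
qed (use assms in auto)

lemma has_derivative_vec_lambda:
  fixes f :: "'n::finite \<Rightarrow> 'a::real_normed_vector \<Rightarrow> real"
  assumes "\<And>i. (f i has_derivative f' i) (at x)"
  shows "((\<lambda>x. \<chi> i. f i x) has_derivative (\<lambda>h. \<chi> i. f' i h)) (at x)"
proof (subst has_derivative_componentwise_within, intro ballI)
  fix b :: "real^'n" assume "b \<in> Basis"
  then obtain i where "b = axis i 1" by (auto simp: Basis_vec_def)
  then show "((\<lambda>x. (\<chi> i. f i x) \<bullet> b) has_derivative (\<lambda>h. (\<chi> i. f' i h) \<bullet> b)) (at x)"
    using assms[of i] by (simp add: inner_axis)
qed

text \<open>Space and time derivatives come from one joint derivative \<open>D\<close>, restricted
  to the two slices through (t, x); inside \<Omega> the extended derivatives are the ordinary ones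
  by definition.\<close>

lemma C1_up_to_boundaryD:
  fixes v :: "real \<Rightarrow> real^'n::finite \<Rightarrow> real^'n"
  assumes v: "C1_up_to_boundary \<Omega> v" and x: "x \<in> \<Omega>"
  shows "GDERIV (\<lambda>x. v t x $ i) x :> (\<chi> k. deriv_x \<Omega> k v t x $ i)"
    "((\<lambda>s. v s x $ i) has_real_derivative deriv_t \<Omega> v t x $ i) (at t)"
proof -
  obtain D where D: "((\<lambda>(s, y). v s y) has_derivative D) (at (t, x))"
    using v x unfolding C1_up_to_boundary_def differentiable_def by blast
  have "((\<lambda>y. (t, y)) has_derivative (\<lambda>h. (0, h))) (at x)" by (auto intro!: derivative_eq_intros)
  from has_derivative_compose[OF this D] have Dx: "(v t has_derivative (\<lambda>h. D (0, h))) (at x)" by simp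
  have dx: "deriv_x \<Omega> k v t x = D (0, axis k 1)" for k
    using x by (simp add: deriv_x_def extend_to_boundary_def partial_deriv_eq[OF Dx])
  have Dxi: "((\<lambda>y. v t y $ i) has_derivative (\<lambda>h. D (0, h) $ i)) (at x)"
    by (rule bounded_linear.has_derivative[OF bounded_linear_vec_nth Dx])
  have "(\<lambda>h. D (0, h) $ i) = (\<lambda>h. h \<bullet> (\<chi> k. deriv_x \<Omega> k v t x $ i))"
    unfolding dx using linear_eq_inner_axis[OF has_derivative_linear[OF Dxi]] by blast
  with Dxi show "GDERIV (\<lambda>x. v t x $ i) x :> (\<chi> k. deriv_x \<Omega> k v t x $ i)" by (simp add: gderiv_def)
  have "((\<lambda>s. (s, x)) has_derivative (\<lambda>h. (h, 0))) (at t)" by (auto intro!: derivative_eq_intros)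
  from has_derivative_compose[OF this D] have Dt: "((\<lambda>s. v s x) has_derivative (\<lambda>h. D (h, 0))) (at t)" by simp
  have l: "D (h, 0) = h *\<^sub>R D (1, 0)" for h
    using linear_cmul[OF has_derivative_linear[OF Dt], of h 1] by simp
  have vd: "((\<lambda>s. v s x) has_vector_derivative D (1, 0)) (at t)"
    unfolding has_vector_derivative_def by (rule has_derivative_eq_rhs[OF Dt ext]) (rule l)
  have dt: "deriv_t \<Omega> v t x = D (1, 0)"
    using x vector_derivative_at[OF vd] by (simp add: deriv_t_def extend_to_boundary_def)
  have D: "((\<lambda>s. v s x $ i) has_derivative (\<lambda>h. D (h, 0) $ i)) (at t)"
    by (rule bounded_linear.has_derivative[OF bounded_linear_vec_nth Dt])
  have "D (h, 0) $ i = D (1, 0) $ i * h" for h by (simp only: l[of h]) simp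
  then show "((\<lambda>s. v s x $ i) has_real_derivative deriv_t \<Omega> v t x $ i) (at t)"
    unfolding has_field_derivative_def dt by (intro has_derivative_eq_rhs[OF D ext])
qed

lemma C1_up_to_boundary_continuous:
  assumes "C1_up_to_boundary \<Omega> v"
  shows "continuous_on (UNIV \<times> closure \<Omega>) (\<lambda>p. v (fst p) (snd p) $ i)"
    "continuous_on (UNIV \<times> closure \<Omega>) (\<lambda>p. deriv_t \<Omega> v (fst p) (snd p) $ i)"
    "continuous_on (UNIV \<times> closure \<Omega>) (\<lambda>p. deriv_x \<Omega> k v (fst p) (snd p) $ i)"
  using assms unfolding C1_up_to_boundary_def case_prod_beta' by (auto intro!: continuous_on_component)

lemma continuous_on_time_slice:
  assumes "continuous_on (UNIV \<times> S) (\<lambda>p. f (fst p) (snd p))" shows "continuous_on S (f t)"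
  using continuous_on_slice[of S f t] assms by (simp add: case_prod_beta')

lemma C1_up_to_boundary_C1_upto:
  fixes v :: "real \<Rightarrow> real^'n::finite \<Rightarrow> real^'n"
  assumes "C1_up_to_boundary \<Omega> v" "bounded \<Omega>"
  shows "C1_upto \<Omega> (\<lambda>x. v t x $ i) (\<lambda>x. \<chi> k. deriv_x \<Omega> k v t x $ i)"
proof (rule C1_upto_continuous_gradient[OF assms(2)])
  show "continuous_on (closure \<Omega>) (\<lambda>x. v t x $ i)"
    by (rule continuous_on_time_slice[where f="\<lambda>t x. v t x $ i"]) (rule C1_up_to_boundary_continuous[OF assms(1)])
  show "continuous_on (closure \<Omega>) (\<lambda>x. \<chi> k. deriv_x \<Omega> k v t x $ i)"
    by (intro continuous_on_vec_lambda continuous_on_time_slice[where f="\<lambda>t x. deriv_x \<Omega> _ v t x $ i"])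
       (rule C1_up_to_boundary_continuous[OF assms(1)])
qed (rule C1_up_to_boundaryD[OF assms(1)])

text \<open>\<open>mixed_derivatives_eq\<close> on the open set \<real> \<times> \<Omega>, with the
  directions (1, 0) in time and (0, e_k) in space.\<close>

lemma C2_mixed_derivatives:
  fixes u :: "real \<Rightarrow> real^'n::finite \<Rightarrow> real^'n"
  assumes u: "C2_up_to_boundary \<Omega> u" and \<Omega>: "open \<Omega>" and x: "x \<in> \<Omega>"
  shows "deriv_t \<Omega> (deriv_x \<Omega> k u) t x $ i = deriv_x \<Omega> k (deriv_t \<Omega> u) t x $ i"
    "deriv_x \<Omega> l (deriv_x \<Omega> k u) t x $ i = deriv_x \<Omega> k (deriv_x \<Omega> l u) t x $ i"
proof -
  have u0: "C1_up_to_boundary \<Omega> u" and ut: "C1_up_to_boundary \<Omega> (deriv_t \<Omega> u)" and ux: "\<And>k. C1_up_to_boundary \<Omega> (deriv_x \<Omega> k u)"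
    using u by (auto simp: C2_up_to_boundary_def)
  let ?D = "(UNIV :: real set) \<times> \<Omega>"
  have D: "open ?D" using \<Omega> by (intro open_Times) auto
  have p: "(t, x) \<in> ?D" using x by simp
  have sub: "?D \<subseteq> UNIV \<times> closure \<Omega>" using closure_subset by blast
  have dx: "((\<lambda>s. (\<lambda>p. v (fst p) (snd p) $ i) (q + s *\<^sub>R (0, axis k 1))) has_real_derivative deriv_x \<Omega> k v (fst q) (snd q) $ i) (at 0)"
    if "C1_up_to_boundary \<Omega> v" "q \<in> ?D" for v q k
  proof -
    have "snd q \<in> \<Omega>" using that(2) by auto
    have "((\<lambda>s. v (fst q) (snd q + s *\<^sub>R axis k 1) $ i) has_real_derivative (\<chi> k. deriv_x \<Omega> k v (fst q) (snd q) $ i) $ k) (at 0)"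
      by (rule GDERIV_line) (use C1_up_to_boundaryD(1)[OF that(1) \<open>snd q \<in> \<Omega>\<close>, of "fst q" i] in simp)
    then show ?thesis by simp
  qed
  have dt: "((\<lambda>s. (\<lambda>p. v (fst p) (snd p) $ i) (q + s *\<^sub>R (1, 0))) has_real_derivative deriv_t \<Omega> v (fst q) (snd q) $ i) (at 0)"
    if "C1_up_to_boundary \<Omega> v" "q \<in> ?D" for v q
  proof -
    have "snd q \<in> \<Omega>" using that(2) by auto
    from C1_up_to_boundaryD(2)[OF that(1) this, of i "fst q"]
    have "((\<lambda>s. v (s + fst q) (snd q) $ i) has_real_derivative deriv_t \<Omega> v (fst q) (snd q) $ i) (at 0)"
      using DERIV_shift[of "\<lambda>s. v s (snd q) $ i" "deriv_t \<Omega> v (fst q) (snd q) $ i" 0 "fst q"] by simp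
    then show ?thesis by (simp add: add.commute)
  qed
  note cont = C1_up_to_boundary_continuous[THEN continuous_on_subset[OF _ sub]]
  show "deriv_t \<Omega> (deriv_x \<Omega> k u) t x $ i = deriv_x \<Omega> k (deriv_t \<Omega> u) t x $ i"
    using mixed_derivatives_eq[OF D p dx[OF u0, where k=k] dt[OF u0] dt[OF ux[of k]] dx[OF ut, where k=k] cont(2)[OF ux] cont(3)[OF ut]]
    by simp
  show "deriv_x \<Omega> l (deriv_x \<Omega> k u) t x $ i = deriv_x \<Omega> k (deriv_x \<Omega> l u) t x $ i"
    using mixed_derivatives_eq[OF D p dx[OF u0, where k=k] dx[OF u0, where k=l] dx[OF ux[of k], where k=l] dx[OF ux[of l], where k=k] cont(3)[OF ux] cont(3)[OF ux]]
    by simp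
qed

lemma C1_upto_coordinate:
  fixes S :: "(real^'n::finite) set"
  assumes "bounded S" shows "C1_upto S (\<lambda>x. x $ k) (\<lambda>x. axis k 1)"
proof (rule C1_upto_continuous_gradient[OF assms])
  show "GDERIV (\<lambda>x. x $ k) x :> axis k 1" for x :: "real^'n"
    unfolding gderiv_def using bounded_linear.has_derivative[OF bounded_linear_vec_nth has_derivative_ident, of k "at x"]
    by (simp add: inner_axis)
qed (intro continuous_intros)+

text \<open>The chain rule through the components of \<open>v\<close>; for v = u the entries of
  \<open>grad F\<close> are the forces f_i of the equation.\<close>

lemma C1_compose:
  fixes F :: "real^'n::finite \<Rightarrow> real"
  assumes F: "C1 F" and v: "C1_up_to_boundary \<Omega> v" and \<Omega>: "bounded \<Omega>"
  shows "C1_upto \<Omega> (\<lambda>x. F (v t x)) (\<lambda>x. \<chi> k. \<Sum>i\<in>UNIV. grad F (v t x) $ i * deriv_x \<Omega> k v t x $ i)"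
    "x \<in> \<Omega> \<Longrightarrow> ((\<lambda>t. F (v t x)) has_real_derivative (\<Sum>i\<in>UNIV. grad F (v t x) $ i * deriv_t \<Omega> v t x $ i)) (at t)"
proof -
  have cv: "continuous_on (closure \<Omega>) (v t)"
    using v continuous_on_slice unfolding C1_up_to_boundary_def by blast
  have cdx: "continuous_on (closure \<Omega>) (\<lambda>x. deriv_x \<Omega> k v t x $ i)" for k i
    by (rule continuous_on_time_slice[where f="\<lambda>t x. deriv_x \<Omega> k v t x $ i"]) (rule C1_up_to_boundary_continuous[OF v])
  have DF: "(F has_derivative (\<lambda>h. h \<bullet> grad F y)) (at y)" for y
    using C1_has_derivative[OF F] by (simp add: gderiv_def)
  show "C1_upto \<Omega> (\<lambda>x. F (v t x)) (\<lambda>x. \<chi> k. \<Sum>i\<in>UNIV. grad F (v t x) $ i * deriv_x \<Omega> k v t x $ i)"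
  proof (rule C1_upto_continuous_gradient[OF \<Omega>])
    show "continuous_on (closure \<Omega>) (\<lambda>x. F (v t x))"
      by (rule continuous_on_compose2[OF C1_continuous[OF F] cv]) simp
    have "continuous_on (closure \<Omega>) (\<lambda>x. grad F (v t x))"
      by (rule continuous_on_compose2[OF C1_continuous_grad[OF F] cv]) simp
    then show "continuous_on (closure \<Omega>) (\<lambda>x. \<chi> k. \<Sum>i\<in>UNIV. grad F (v t x) $ i * deriv_x \<Omega> k v t x $ i)"
      by (intro continuous_on_vec_lambda continuous_on_sum continuous_on_mult continuous_on_component cdx)
    fix x assume x: "x \<in> \<Omega>"
    have "((\<lambda>x. \<chi> i. v t x $ i) has_derivative (\<lambda>h. \<chi> i. h \<bullet> (\<chi> k. deriv_x \<Omega> k v t x $ i))) (at x)"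
      using C1_up_to_boundaryD(1)[OF v x] unfolding gderiv_def by (intro has_derivative_vec_lambda) simp
    then have "(v t has_derivative (\<lambda>h. \<chi> i. h \<bullet> (\<chi> k. deriv_x \<Omega> k v t x $ i))) (at x)" by simp
    from has_derivative_compose[OF this DF]
    show "GDERIV (\<lambda>x. F (v t x)) x :> (\<chi> k. \<Sum>i\<in>UNIV. grad F (v t x) $ i * deriv_x \<Omega> k v t x $ i)"
      unfolding gderiv_def
    proof (rule has_derivative_eq_rhs, intro ext)
      fix h :: "real^'n"
      have "(\<chi> i. h \<bullet> (\<chi> k. deriv_x \<Omega> k v t x $ i)) \<bullet> grad F (v t x) = (\<Sum>i\<in>UNIV. \<Sum>k\<in>UNIV. h $ k * (grad F (v t x) $ i * deriv_x \<Omega> k v t x $ i))"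
        by (simp add: inner_vec_def sum_distrib_right sum_distrib_left mult_ac)
      also have "\<dots> = h \<bullet> (\<chi> k. \<Sum>i\<in>UNIV. grad F (v t x) $ i * deriv_x \<Omega> k v t x $ i)"
        by (subst sum.swap) (simp add: inner_vec_def sum_distrib_left)
      finally show "(\<chi> i. h \<bullet> (\<chi> k. deriv_x \<Omega> k v t x $ i)) \<bullet> grad F (v t x) = h \<bullet> (\<chi> k. \<Sum>i\<in>UNIV. grad F (v t x) $ i * deriv_x \<Omega> k v t x $ i)" .
    qed
  qed
  assume x: "x \<in> \<Omega>"
  have "((\<lambda>s. \<chi> i. v s x $ i) has_derivative (\<lambda>h. \<chi> i. deriv_t \<Omega> v t x $ i * h)) (at t)"
    using C1_up_to_boundaryD(2)[OF v x] unfolding has_field_derivative_def by (intro has_derivative_vec_lambda) simp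
  then have "((\<lambda>s. v s x) has_derivative (\<lambda>h. \<chi> i. deriv_t \<Omega> v t x $ i * h)) (at t)" by simp
  from has_derivative_compose[OF this DF]
  show "((\<lambda>t. F (v t x)) has_real_derivative (\<Sum>i\<in>UNIV. grad F (v t x) $ i * deriv_t \<Omega> v t x $ i)) (at t)"
    unfolding has_field_derivative_def
    by (rule has_derivative_eq_rhs) (simp add: inner_vec_def sum_distrib_right sum_distrib_left mult_ac fun_eq_iff)
qed

subsection \<open>The integral identity\<close>

text \<open>Off the regular boundary \<open>outward_normal\<close> is \<open>THE\<close> of an empty predicate, hence one fixed vector.\<close>

lemma outward_normal_borel_measurable:
  assumes "open \<Omega>" shows "outward_normal \<Omega> \<in> borel_measurable borel"
proof -
  define v :: "real^'a" where "v = (THE \<nu>. False)"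
  have off: "outward_normal \<Omega> x = v" if "x \<notin> regular_boundary \<Omega>" for x
    unfolding v_def outward_normal_def
    by (rule arg_cong[where f=The]) (use that in \<open>auto simp: regular_boundary_def fun_eq_iff\<close>)
  note [measurable] = regular_boundary_borel[of \<Omega>]
  have [measurable]: "(\<lambda>x. indicator (regular_boundary \<Omega>) x *\<^sub>R outward_normal \<Omega> x) \<in> borel_measurable borel"
    by (intro borel_measurable_continuous_on_indicator continuous_on_outward_normal assms) measurable
  have "outward_normal \<Omega> = (\<lambda>x. indicator (regular_boundary \<Omega>) x *\<^sub>R outward_normal \<Omega> x + indicator (- regular_boundary \<Omega>) x *\<^sub>R v)"
    by (rule ext) (auto simp: off indicator_def)
  also have "\<dots> \<in> borel_measurable borel" by measurable
  finally show ?thesis .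
qed

text \<open>As the rows of \<open>a\<close> are parallel to \<nu>, \<nu>_k a_im x_m = a_ik (x,
  \<nu>). The stress part then contributes W (x, \<nu>), and the other part takes half of it
  away.\<close>

lemma flux_on_boundary:
  fixes S a :: "'n::finite \<Rightarrow> 'n \<Rightarrow> real" and \<nu> x :: "real^'n"
  assumes par: "\<And>i j k. a i j * \<nu> $ k = a i k * \<nu> $ j"
    and W: "W = (\<Sum>i\<in>UNIV. \<Sum>k\<in>UNIV. S k i * a i k)"
  shows "(\<Sum>k\<in>UNIV. \<nu> $ k * ((\<Sum>i\<in>UNIV. S k i * (\<Sum>m\<in>UNIV. a i m * x $ m)) + x $ k * (- (1/2 * W)))) = 1/2 * W * (x \<bullet> \<nu>)"
proof -
  have A: "\<nu> $ k * (\<Sum>m\<in>UNIV. a i m * x $ m) = a i k * (x \<bullet> \<nu>)" for i k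
  proof -
    have "\<nu> $ k * (\<Sum>m\<in>UNIV. a i m * x $ m) = (\<Sum>m\<in>UNIV. (a i m * \<nu> $ k) * x $ m)"
      by (simp add: sum_distrib_left mult_ac)
    also have "\<dots> = (\<Sum>m\<in>UNIV. (a i k * \<nu> $ m) * x $ m)" by (intro sum.cong refl) (subst par, rule refl)
    also have "\<dots> = a i k * (x \<bullet> \<nu>)" by (simp add: inner_vec_def sum_distrib_left mult_ac)
    finally show ?thesis .
  qed
  have "(\<Sum>k\<in>UNIV. \<nu> $ k * (\<Sum>i\<in>UNIV. S k i * (\<Sum>m\<in>UNIV. a i m * x $ m))) =
      (\<Sum>k\<in>UNIV. \<Sum>i\<in>UNIV. S k i * (a i k * (x \<bullet> \<nu>)))"
  proof (rule sum.cong[OF refl])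
    fix k
    show "\<nu> $ k * (\<Sum>i\<in>UNIV. S k i * (\<Sum>m\<in>UNIV. a i m * x $ m)) = (\<Sum>i\<in>UNIV. S k i * (a i k * (x \<bullet> \<nu>)))"
      by (subst sum_distrib_left) (simp only: mult.left_commute[of "\<nu> $ k"] A)
  qed
  also have "\<dots> = (\<Sum>i\<in>UNIV. \<Sum>k\<in>UNIV. S k i * (a i k * (x \<bullet> \<nu>)))" by (rule sum.swap)
  also have "\<dots> = W * (x \<bullet> \<nu>)" unfolding W by (simp add: sum_distrib_right mult.assoc)
  finally have 1: "(\<Sum>k\<in>UNIV. \<nu> $ k * (\<Sum>i\<in>UNIV. S k i * (\<Sum>m\<in>UNIV. a i m * x $ m))) = W * (x \<bullet> \<nu>)" .
  have 2: "(\<Sum>k\<in>UNIV. \<nu> $ k * (x $ k * (- (1/2 * W)))) = - (1/2 * W) * (x \<bullet> \<nu>)"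
    by (simp add: inner_vec_def sum_distrib_left sum_negf mult_ac)
  show ?thesis unfolding distrib_left sum.distrib 1 2 by simp
qed

theorem theorem3:
  fixes \<Omega> :: "(real^'n::finite) set"
    and C :: "'n \<Rightarrow> 'n \<Rightarrow> 'n \<Rightarrow> 'n \<Rightarrow> real"
    and F :: "real^'n \<Rightarrow> real"
    and u :: "real \<Rightarrow> real^'n \<Rightarrow> real^'n"
    and t :: real
  assumes "CARD('n) \<ge> 2"
    and "open \<Omega>" "connected \<Omega>" "\<Omega> \<noteq> {}" "bounded \<Omega>"
    and "piecewise_smooth_boundary \<Omega>"
    and "elastic_moduli C"
    and "C1 F" "F 0 = 0"
    and "C2_up_to_boundary \<Omega> u"
    and "\<forall>t. \<forall>x\<in>\<Omega>. \<forall>i.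
           - (deriv_t \<Omega> (deriv_t \<Omega> u) t x $ i)
           + (\<Sum>j\<in>UNIV. \<Sum>k\<in>UNIV. \<Sum>l\<in>UNIV. C k l i j * deriv_x \<Omega> l (deriv_x \<Omega> k u) t x $ j)
           + partial_deriv i F (u t x) = 0"
    and "\<forall>t. \<forall>x\<in>frontier \<Omega>. u t x = 0"
  shows "((\<lambda>t. LINT x:\<Omega>|lborel.
             t * energy_density \<Omega> C F u t x
             + (\<Sum>i\<in>UNIV. \<Sum>k\<in>UNIV. deriv_t \<Omega> u t x $ i * deriv_x \<Omega> k u t x $ i * x $ k)
             + (real CARD('n) - 1) / 2 * (\<Sum>i\<in>UNIV. u t x $ i * deriv_t \<Omega> u t x $ i))
          has_real_derivative
            (LINT x:\<Omega>|lborel.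
               (real CARD('n) - 1) / 2 * (\<Sum>k\<in>UNIV. u t x $ k * partial_deriv k F (u t x))
               - (real CARD('n) + 1) * F (u t x))
          + (LINT x:frontier \<Omega>|surface_measure \<Omega>.
               1/2 * (elastic_form \<Omega> C u t x
                      + 1/2 * (\<Sum>i\<in>UNIV. deriv_t \<Omega> u t x $ i * deriv_t \<Omega> u t x $ i))
                   * (x \<bullet> outward_normal \<Omega> x)
               + t * (\<Sum>i\<in>UNIV. \<Sum>j\<in>UNIV. \<Sum>k\<in>UNIV. \<Sum>l\<in>UNIV.
                        C k l i j * deriv_t \<Omega> u t x $ i * deriv_x \<Omega> l u t x $ j
                        * outward_normal \<Omega> x $ k)))
         (at t)"
proof -
  note \<Omega> = assms(2,5)
  have u0: "C1_up_to_boundary \<Omega> u" and ut: "C1_up_to_boundary \<Omega> (deriv_t \<Omega> u)" and ux: "\<And>k. C1_up_to_boundary \<Omega> (deriv_x \<Omega> k u)"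
    using assms(10) by (auto simp: C2_up_to_boundary_def)
  have Csym: "\<And>k l i j. C k l i j = C l k j i" using assms(7) unfolding elastic_moduli_def by blast
  have fin: "emeasure (surface_measure \<Omega>) (regular_boundary \<Omega>) < \<infinity>"
    using assms(6) by (simp add: piecewise_smooth_boundary_def)
  note SM = surface_measureD[OF \<Omega>]
  \<comment> \<open>Index notation as in \<open>virial_identity\<close>, with time and space as
    additional arguments.\<close>
  define n where "n = real CARD('n)"
  define p where "p = (\<lambda>t x i. u t x $ i)"
  define q where "q = (\<lambda>t x i. deriv_t \<Omega> u t x $ i)"
  define a where "a = (\<lambda>t x i k. deriv_x \<Omega> k u t x $ i)"
  define b where "b = (\<lambda>t x i. deriv_t \<Omega> (deriv_t \<Omega> u) t x $ i)"
  define c where "c = (\<lambda>t x i k. deriv_x \<Omega> k (deriv_t \<Omega> u) t x $ i)"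
  define d where "d = (\<lambda>t x i k l. deriv_x \<Omega> l (deriv_x \<Omega> k u) t x $ i)"
  define f where "f = (\<lambda>t x i. grad F (u t x) $ i)"
  define S where "S = (\<lambda>t x k i. stress C (a t x) k i)"
  define W where "W = (\<lambda>t x. \<Sum>i\<in>UNIV. \<Sum>k\<in>UNIV. S t x k i * a t x i k)"
  define Q where "Q = (\<lambda>t x. \<Sum>i\<in>UNIV. q t x i * q t x i)"
  \<comment> \<open>\<open>I\<close> is the integrand of the theorem and \<open>J\<close> its time
    derivative, in which u_tt is still present as \<open>b\<close>.\<close>
  define I where "I = (\<lambda>t x. t * (1/2 * (W t x + Q t x) - F (u t x)) + (\<Sum>i\<in>UNIV. \<Sum>k\<in>UNIV. q t x i * a t x i k * x $ k)
      + (n - 1) / 2 * (\<Sum>i\<in>UNIV. p t x i * q t x i))"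
  define J where "J = (\<lambda>t x. (1/2 * (W t x + Q t x) - F (u t x))
      + t * ((\<Sum>i\<in>UNIV. \<Sum>k\<in>UNIV. S t x k i * c t x i k) + (\<Sum>i\<in>UNIV. q t x i * b t x i) - (\<Sum>i\<in>UNIV. f t x i * q t x i))
      + (\<Sum>i\<in>UNIV. \<Sum>k\<in>UNIV. (b t x i * a t x i k + q t x i * c t x i k) * x $ k)
      + (n - 1) / 2 * (\<Sum>i\<in>UNIV. q t x i * q t x i + p t x i * b t x i))"

  have dp: "((\<lambda>s. p s x i) has_real_derivative q t x i) (at t)" if "x \<in> \<Omega>" for t x i
    unfolding p_def q_def by (rule C1_up_to_boundaryD(2)[OF u0 that])
  have dq: "((\<lambda>s. q s x i) has_real_derivative b t x i) (at t)" if "x \<in> \<Omega>" for t x i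
    unfolding b_def q_def by (rule C1_up_to_boundaryD(2)[OF ut that])
  \<comment> \<open>The time derivative of a spatial derivative is identified with the spatial
    derivative of u_t, the form in which it appears in the gradient of \<open>q\<close> as
    well.\<close>
  have da: "((\<lambda>s. a s x i k) has_real_derivative c t x i k) (at t)" if "x \<in> \<Omega>" for t x i k
    using C1_up_to_boundaryD(2)[OF ux[of k] that, of i t] C2_mixed_derivatives(1)[OF assms(10) \<Omega>(1) that, of k t i]
    unfolding a_def c_def by simp
  have dS: "((\<lambda>s. S s x k i) has_real_derivative stress C (c t x) k i) (at t)" if "x \<in> \<Omega>" for t x k i
    unfolding S_def stress_def by (intro DERIV_sum DERIV_cmult da that)
  have dF: "((\<lambda>s. F (u s x)) has_real_derivative (\<Sum>i\<in>UNIV. f t x i * q t x i)) (at t)" if "x \<in> \<Omega>" for t x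
    unfolding f_def q_def by (rule C1_compose(2)[OF assms(8) u0 \<Omega>(2) that])
  have dW: "((\<lambda>s. W s x) has_real_derivative 2 * (\<Sum>i\<in>UNIV. \<Sum>k\<in>UNIV. S t x k i * c t x i k)) (at t)" if "x \<in> \<Omega>" for t x
  proof -
    have "((\<lambda>s. W s x) has_real_derivative (\<Sum>i\<in>UNIV. \<Sum>k\<in>UNIV. stress C (c t x) k i * a t x i k + c t x i k * S t x k i)) (at t)"
      unfolding W_def by (intro DERIV_sum DERIV_mult dS da that)
    moreover have "(\<Sum>i\<in>UNIV. \<Sum>k\<in>UNIV. stress C (c t x) k i * a t x i k + c t x i k * S t x k i) = 2 * (\<Sum>i\<in>UNIV. \<Sum>k\<in>UNIV. S t x k i * c t x i k)"
      using stress_sym[OF Csym, where c="c t x" and a="a t x"] unfolding S_def by (simp add: sum.distrib mult.commute)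
    ultimately show ?thesis by simp
  qed
  have dI: "((\<lambda>s. I s x) has_real_derivative J t x) (at t)" if x: "x \<in> \<Omega>" for t x
  proof -
    have dQ: "((\<lambda>s. Q s x) has_real_derivative (\<Sum>i\<in>UNIV. b t x i * q t x i + b t x i * q t x i)) (at t)"
      unfolding Q_def by (intro DERIV_sum DERIV_mult dq x)
    have dE: "((\<lambda>s. 1/2 * (W s x + Q s x) - F (u s x)) has_real_derivative
        1/2 * (2 * (\<Sum>i\<in>UNIV. \<Sum>k\<in>UNIV. S t x k i * c t x i k) + (\<Sum>i\<in>UNIV. b t x i * q t x i + b t x i * q t x i)) - (\<Sum>i\<in>UNIV. f t x i * q t x i)) (at t)"
      by (intro DERIV_diff DERIV_cmult DERIV_add dW dQ dF x)
    have d2: "((\<lambda>s. \<Sum>i\<in>UNIV. \<Sum>k\<in>UNIV. q s x i * a s x i k * x $ k) has_real_derivative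
        (\<Sum>i\<in>UNIV. \<Sum>k\<in>UNIV. (b t x i * a t x i k + c t x i k * q t x i) * x $ k)) (at t)"
      by (intro DERIV_sum DERIV_cmult_right DERIV_mult dq da x)
    have d3: "((\<lambda>s. (n - 1) / 2 * (\<Sum>i\<in>UNIV. p s x i * q s x i)) has_real_derivative
        (n - 1) / 2 * (\<Sum>i\<in>UNIV. q t x i * q t x i + b t x i * p t x i)) (at t)"
      by (intro DERIV_cmult DERIV_sum DERIV_mult dp dq x)
    from DERIV_add[OF DERIV_add[OF DERIV_mult[OF DERIV_ident dE] d2] d3]
    show ?thesis unfolding I_def
      by (rule DERIV_cong) (simp add: J_def sum.distrib sum_distrib_left algebra_simps)
  qed

  let ?D = "(UNIV :: real set) \<times> closure \<Omega>"
  have cp: "continuous_on ?D (\<lambda>z. p (fst z) (snd z) i)" for i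
    unfolding p_def by (rule C1_up_to_boundary_continuous(1)[OF u0])
  have cq: "continuous_on ?D (\<lambda>z. q (fst z) (snd z) i)" for i
    unfolding q_def by (rule C1_up_to_boundary_continuous(2)[OF u0])
  have ca: "continuous_on ?D (\<lambda>z. a (fst z) (snd z) i k)" for i k
    unfolding a_def by (rule C1_up_to_boundary_continuous(3)[OF u0])
  have cb: "continuous_on ?D (\<lambda>z. b (fst z) (snd z) i)" for i
    unfolding b_def by (rule C1_up_to_boundary_continuous(2)[OF ut])
  have cc: "continuous_on ?D (\<lambda>z. c (fst z) (snd z) i k)" for i k
    unfolding c_def by (rule C1_up_to_boundary_continuous(3)[OF ut])
  have cu: "continuous_on ?D (\<lambda>z. u (fst z) (snd z))"
    using u0 unfolding C1_up_to_boundary_def case_prod_beta' by blast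
  have cF: "continuous_on ?D (\<lambda>z. F (u (fst z) (snd z)))"
    by (rule continuous_on_compose2[OF C1_continuous[OF assms(8)] cu]) simp
  have cf: "continuous_on ?D (\<lambda>z. f (fst z) (snd z) i)" for i
    unfolding f_def by (intro continuous_on_component continuous_on_compose2[OF C1_continuous_grad[OF assms(8)] cu]) simp
  have cS: "continuous_on ?D (\<lambda>z. S (fst z) (snd z) k i)" for k i
    unfolding S_def stress_def by (intro continuous_intros ca)
  have cW: "continuous_on ?D (\<lambda>z. W (fst z) (snd z))"
    unfolding W_def by (intro continuous_intros cS ca)
  have cQ: "continuous_on ?D (\<lambda>z. Q (fst z) (snd z))"
    unfolding Q_def by (intro continuous_intros cq)
  have cI: "continuous_on ?D (\<lambda>(t, x). I t x)"
    unfolding I_def case_prod_beta' by (intro continuous_intros cp cq ca cW cQ cF)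
  have cJ: "continuous_on ?D (\<lambda>(t, x). J t x)"
    unfolding J_def case_prod_beta' by (intro continuous_intros cp cq ca cb cc cf cS cW cQ cF)

  have deriv: "((\<lambda>t. LINT x:\<Omega>|lborel. I t x) has_real_derivative (LINT x:\<Omega>|lborel. J t x)) (at t)"
    by (rule leibniz_rule_closure[OF \<Omega> dI cI cJ])

  \<comment> \<open>From here on \<open>t\<close> is the fixed time of the statement.
    \<open>Zd\<close>, \<open>Sd\<close> and \<open>Md\<close> are spatial derivatives;
    \<open>Y k\<close> is the k-th flux component and \<open>G k\<close> its gradient, whose k-th
    entry enters the divergence.\<close>
  define Z where "Z = (\<lambda>x i. t * q t x i + (\<Sum>m\<in>UNIV. a t x i m * x $ m) + (n - 1) / 2 * p t x i)"
  define Zd where "Zd = (\<lambda>x i k. t * c t x i k + (\<Sum>m\<in>UNIV. x $ m * d t x i m k) + a t x i k + (n - 1) / 2 * a t x i k)"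
  define Sd where "Sd = (\<lambda>x k i m. stress C (\<lambda>j l. d t x j l m) k i)"
  define M where "M = (\<lambda>x. F (u t x) + 1/2 * Q t x - 1/2 * W t x)"
  define Md where "Md = (\<lambda>x k. (\<Sum>i\<in>UNIV. f t x i * a t x i k) + (\<Sum>i\<in>UNIV. q t x i * c t x i k) - (\<Sum>i\<in>UNIV. \<Sum>m\<in>UNIV. S t x m i * d t x i m k))"
  define Y where "Y = (\<lambda>k x. (\<Sum>i\<in>UNIV. S t x k i * Z x i) + x $ k * M x)"
  define G where "G = (\<lambda>k x. \<chi> m. (\<Sum>i\<in>UNIV. S t x k i * Zd x i m + Z x i * Sd x k i m) + x $ k * Md x m + M x * axis k 1 $ m)"
  have gp: "C1_upto \<Omega> (\<lambda>x. p t x i) (\<lambda>x. \<chi> k. a t x i k)" for i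
    unfolding p_def a_def by (rule C1_up_to_boundary_C1_upto[OF u0 \<Omega>(2)])
  have gq: "C1_upto \<Omega> (\<lambda>x. q t x i) (\<lambda>x. \<chi> k. c t x i k)" for i
    unfolding q_def c_def by (rule C1_up_to_boundary_C1_upto[OF ut \<Omega>(2)])
  have ga: "C1_upto \<Omega> (\<lambda>x. a t x i k) (\<lambda>x. \<chi> l. d t x i k l)" for i k
    unfolding a_def d_def by (rule C1_up_to_boundary_C1_upto[OF ux \<Omega>(2)])
  have gF: "C1_upto \<Omega> (\<lambda>x. F (u t x)) (\<lambda>x. \<chi> k. \<Sum>i\<in>UNIV. f t x i * a t x i k)"
    unfolding f_def a_def by (rule C1_compose(1)[OF assms(8) u0 \<Omega>(2)])
  have gS: "C1_upto \<Omega> (\<lambda>x. S t x k i) (\<lambda>x. \<chi> m. Sd x k i m)" for k i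
    unfolding S_def stress_def
    by (rule C1_upto_cong[OF C1_upto_sum[OF C1_upto_sum[OF C1_upto_cmult[OF ga]]]])
       (simp add: vec_eq_iff Sd_def stress_def)
  have gW: "C1_upto \<Omega> (\<lambda>x. W t x) (\<lambda>x. \<chi> m. 2 * (\<Sum>i\<in>UNIV. \<Sum>k\<in>UNIV. S t x k i * d t x i k m))"
    unfolding W_def
  proof (rule C1_upto_cong[OF C1_upto_sum[OF C1_upto_sum[OF C1_upto_mult[OF gS ga]]]])
    fix x
    have "(\<Sum>i\<in>UNIV. \<Sum>k\<in>UNIV. S t x k i * d t x i k m + a t x i k * Sd x k i m) = 2 * (\<Sum>i\<in>UNIV. \<Sum>k\<in>UNIV. S t x k i * d t x i k m)" for m
      using stress_sym[OF Csym, where c="\<lambda>j l. d t x j l m" and a="a t x"] unfolding S_def Sd_def by (simp add: sum.distrib mult.commute)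
    then show "(\<Sum>i\<in>UNIV. \<Sum>k\<in>UNIV. S t x k i *\<^sub>R (\<chi> l. d t x i k l) + a t x i k *\<^sub>R (\<chi> m. Sd x k i m)) =
        (\<chi> m. 2 * (\<Sum>i\<in>UNIV. \<Sum>k\<in>UNIV. S t x k i * d t x i k m))"
      by (simp add: vec_eq_iff)
  qed
  have gQ: "C1_upto \<Omega> (\<lambda>x. Q t x) (\<lambda>x. \<chi> k. 2 * (\<Sum>i\<in>UNIV. q t x i * c t x i k))"
    unfolding Q_def
    by (rule C1_upto_cong[OF C1_upto_sum[OF C1_upto_mult[OF gq gq]]]) (simp add: vec_eq_iff sum_distrib_left mult.left_commute)
  have gM: "C1_upto \<Omega> M (\<lambda>x. \<chi> k. Md x k)"
    unfolding M_def
    by (rule C1_upto_cong[OF C1_upto_diff[OF C1_upto_add[OF gF C1_upto_cmult[OF gQ]] C1_upto_cmult[OF gW]]])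
       (simp add: vec_eq_iff Md_def)
  have gZ: "C1_upto \<Omega> (\<lambda>x. Z x i) (\<lambda>x. \<chi> m. Zd x i m)" for i
    unfolding Z_def
  proof (rule C1_upto_cong[OF C1_upto_add[OF C1_upto_add[OF C1_upto_cmult[OF gq]
        C1_upto_sum[OF C1_upto_mult[OF ga C1_upto_coordinate[OF \<Omega>(2)]]]] C1_upto_cmult[OF gp]]])
    fix x
    have "(\<Sum>m\<in>UNIV. a t x i m * axis m 1 $ k) = a t x i k" for k
      by (simp add: axis_def if_distrib[of "\<lambda>y. _ * y"] cong: if_cong)
    then show "t *\<^sub>R (\<chi> k. c t x i k) + (\<Sum>m\<in>UNIV. a t x i m *\<^sub>R axis m 1 + x $ m *\<^sub>R (\<chi> l. d t x i m l)) + ((n - 1) / 2) *\<^sub>R (\<chi> k. a t x i k) = (\<chi> m. Zd x i m)"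
      by (simp add: vec_eq_iff Zd_def sum.distrib)
  qed
  have gY: "C1_upto \<Omega> (Y k) (G k)" for k
    unfolding Y_def
    by (rule C1_upto_cong[OF C1_upto_add[OF C1_upto_sum[OF C1_upto_mult[OF gS gZ]] C1_upto_mult[OF C1_upto_coordinate[OF \<Omega>(2)] gM]]])
       (simp add: vec_eq_iff G_def)

  define R where "R = (\<lambda>x. (n - 1) / 2 * (\<Sum>i\<in>UNIV. p t x i * f t x i) - (n + 1) * F (u t x))"
  \<comment> \<open>Inside \<Omega> the equation and the symmetry of second derivatives are
    available, and the virial identity splits \<open>J\<close> into the divergence of
    \<open>Y\<close> and the bulk density \<open>R\<close>.\<close>
  have JGR: "J t x = (\<Sum>k\<in>UNIV. G k x $ k) + R x" if x: "x \<in> \<Omega>" for x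
  proof -
    have dsym: "d t x i k l = d t x i l k" for i k l
      unfolding d_def by (rule C2_mixed_derivatives(2)[OF assms(10) \<Omega>(1) x])
    have pde: "b t x i = (\<Sum>j\<in>UNIV. \<Sum>k\<in>UNIV. \<Sum>l\<in>UNIV. C k l i j * d t x j k l) + f t x i" for i
      using assms(11)[rule_format, OF x, of t i] unfolding b_def d_def f_def grad_def by simp
    have "(\<Sum>k\<in>UNIV. G k x $ k) = (\<Sum>k\<in>UNIV. (\<Sum>i\<in>UNIV. S t x k i * Zd x i k + Z x i * Sd x k i k) + x $ k * Md x k + M x)"
      by (simp add: G_def)
    then show ?thesis
      using virial_identity[where d="d t x" and n=n and b="b t x" and C=C and f="f t x" and a="a t x" and q="q t x" and Fu="F (u t x)" and t=t and c="c t x" and x="\<lambda>k. x $ k" and p="p t x", OF dsym n_def pde]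
      unfolding J_def R_def M_def Md_def Z_def Zd_def Sd_def S_def W_def Q_def by simp
  qed

  have cR: "continuous_on (closure \<Omega>) R"
    unfolding R_def
    by (intro continuous_intros continuous_on_time_slice[where f="\<lambda>t x. p t x _"] continuous_on_time_slice[where f="\<lambda>t x. f t x _"]
        continuous_on_time_slice[where f="\<lambda>t x. F (u t x)"] cp cf cF)
  have Jint: "(LINT x:\<Omega>|lborel. J t x) = (\<Sum>k\<in>UNIV. \<integral>x. G k x $ k * indicator \<Omega> x \<partial>lborel) + (LINT x:\<Omega>|lborel. R x)"
  proof -
    have "(LINT x:\<Omega>|lborel. J t x) = (\<integral>x. (\<Sum>k\<in>UNIV. G k x $ k * indicator \<Omega> x) + R x * indicator \<Omega> x \<partial>lborel)"
      unfolding set_integral_eq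
    proof (rule Bochner_Integration.integral_cong[OF refl])
      fix x show "J t x * indicator \<Omega> x = (\<Sum>k\<in>UNIV. G k x $ k * indicator \<Omega> x) + R x * indicator \<Omega> x"
        by (cases "x \<in> \<Omega>") (auto simp: JGR)
    qed
    also have "\<dots> = (\<integral>x. (\<Sum>k\<in>UNIV. G k x $ k * indicator \<Omega> x) \<partial>lborel) + (\<integral>x. R x * indicator \<Omega> x \<partial>lborel)"
      by (intro Bochner_Integration.integral_add Bochner_Integration.integrable_sum bounded_borel_integrable C1_upto_bounded_borel[OF gY \<Omega>] bounded_borel_continuous_closure[OF \<Omega> cR])
    also have "(\<integral>x. (\<Sum>k\<in>UNIV. G k x $ k * indicator \<Omega> x) \<partial>lborel) = (\<Sum>k\<in>UNIV. \<integral>x. G k x $ k * indicator \<Omega> x \<partial>lborel)"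
      by (intro Bochner_Integration.integral_sum bounded_borel_integrable C1_upto_bounded_borel[OF gY \<Omega>])
    finally show ?thesis unfolding set_integral_eq .
  qed

  have Fcl: "x \<in> closure \<Omega>" if "x \<in> frontier \<Omega>" for x using that by (simp add: frontier_def)
  have p0: "p s x i = 0" if "x \<in> frontier \<Omega>" for s x i using assms(12) that by (simp add: p_def)
  have q0: "q t x i = 0" if x: "x \<in> frontier \<Omega>" for x i
    by (rule time_derivative_zero_on_frontier[where f="\<lambda>t x. p t x i" and f'="\<lambda>t x. q t x i", OF dp _ _ p0[OF x] Fcl[OF x]])
       (simp_all add: case_prod_beta' cp cq)
  have par: "a t x i j * outward_normal \<Omega> x $ k = a t x i k * outward_normal \<Omega> x $ j" if "x \<in> regular_boundary \<Omega>" for x i j k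
  proof -
    have "continuous_on (closure \<Omega>) (\<lambda>x. \<chi> k. a t x i k)"
      by (intro continuous_on_vec_lambda continuous_on_time_slice[where f="\<lambda>t x. a t x i _"] ca)
    from gradient_parallel_normal[OF \<Omega>(1) C1_uptoD(1)[OF gp] this C1_uptoD(5)[OF gp] p0 that]
    show ?thesis by simp
  qed
  \<comment> \<open>On the boundary F(u) = F(0) = 0, and \<open>Q\<close> and the terms of
    \<open>Z\<close> with \<open>p\<close> and \<open>q\<close> vanish; what is left is the
    situation of \<open>flux_on_boundary\<close>.\<close>
  have bd: "(\<Sum>k\<in>UNIV. outward_normal \<Omega> x $ k * Y k x) = 1/2 * W t x * (x \<bullet> outward_normal \<Omega> x)" if x: "x \<in> regular_boundary \<Omega>" for x
  proof -
    have xF: "x \<in> frontier \<Omega>" using x by (auto simp: regular_boundary_def)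
    have "F (u t x) = 0" using assms(9,12) xF by simp
    then have "M x = - (1/2 * W t x)" using q0[OF xF] by (simp add: M_def Q_def)
    moreover have "Z x i = (\<Sum>m\<in>UNIV. a t x i m * x $ m)" for i using q0[OF xF] p0[OF xF] by (simp add: Z_def)
    ultimately show ?thesis unfolding Y_def
      using flux_on_boundary[where a="a t x" and \<nu>="outward_normal \<Omega> x" and W="W t x" and S="S t x" and x=x] par[OF x] by (simp add: W_def)
  qed

  define T where "T = (\<lambda>x. 1/2 * (elastic_form \<Omega> C u t x + 1/2 * (\<Sum>i\<in>UNIV. deriv_t \<Omega> u t x $ i * deriv_t \<Omega> u t x $ i))
                   * (x \<bullet> outward_normal \<Omega> x)
               + t * (\<Sum>i\<in>UNIV. \<Sum>j\<in>UNIV. \<Sum>k\<in>UNIV. \<Sum>l\<in>UNIV.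
                        C k l i j * deriv_t \<Omega> u t x $ i * deriv_x \<Omega> l u t x $ j * outward_normal \<Omega> x $ k))"
  have Wel: "elastic_form \<Omega> C u s x = W s x" for s x
    unfolding elastic_form_def W_def S_def a_def by (rule elastic_form_stress)
  have TF: "T x = 1/2 * W t x * (x \<bullet> outward_normal \<Omega> x)" if "x \<in> frontier \<Omega>" for x
    using q0[OF that] unfolding T_def Wel q_def by simp
  have sint: "(\<Sum>k\<in>UNIV. \<integral>x. G k x $ k * indicator \<Omega> x \<partial>lborel) = (LINT x:frontier \<Omega>|surface_measure \<Omega>. T x)"
  proof -
    have i: "integrable (surface_measure \<Omega>) (\<lambda>x. outward_normal \<Omega> x $ k * Y k x * indicator (regular_boundary \<Omega>) x)" for k
      by (rule C1_upto_surface_integrable[OF \<Omega> fin gY])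
    have "(\<Sum>k\<in>UNIV. \<integral>x. G k x $ k * indicator \<Omega> x \<partial>lborel) =
        (\<integral>x. (\<Sum>k\<in>UNIV. outward_normal \<Omega> x $ k * Y k x * indicator (regular_boundary \<Omega>) x) \<partial>surface_measure \<Omega>)"
      unfolding gauss_green[OF \<Omega> assms(6) gY] by (rule Bochner_Integration.integral_sum[symmetric]) (rule i)
    also have "\<dots> = (\<integral>x. T x * indicator (frontier \<Omega>) x \<partial>surface_measure \<Omega>)"
    \<comment> \<open>Equality is known on the regular boundary, which carries the whole surface
      measure. The integrand \<open>T\<close>, however, lives on the entire boundary, so its
      measurability is shown separately, with the normal measurable everywhere.\<close>
    proof (rule integral_cong_AE)
      show "(\<lambda>x. \<Sum>k\<in>UNIV. outward_normal \<Omega> x $ k * Y k x * indicator (regular_boundary \<Omega>) x) \<in> borel_measurable (surface_measure \<Omega>)"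
        by (rule borel_measurable_sum) (rule borel_measurable_integrable[OF i])
      have "frontier \<Omega> \<subseteq> closure \<Omega>" using Fcl by blast
      then have "continuous_on (frontier \<Omega>) (\<lambda>x. W t x)"
        using continuous_on_subset[OF continuous_on_time_slice[OF cW]] by blast
      then have "(\<lambda>x. indicator (frontier \<Omega>) x *\<^sub>R W t x) \<in> borel_measurable borel"
        by (intro borel_measurable_continuous_on_indicator) auto
      then have "(\<lambda>x. 1/2 * (indicator (frontier \<Omega>) x *\<^sub>R W t x) * (x \<bullet> outward_normal \<Omega> x)) \<in> borel_measurable borel"
        using outward_normal_borel_measurable[OF \<Omega>(1)] by measurable
      moreover have "(\<lambda>x. T x * indicator (frontier \<Omega>) x) = (\<lambda>x. 1/2 * (indicator (frontier \<Omega>) x *\<^sub>R W t x) * (x \<bullet> outward_normal \<Omega> x))"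
        using TF by (auto simp: fun_eq_iff indicator_def)
      ultimately show "(\<lambda>x. T x * indicator (frontier \<Omega>) x) \<in> borel_measurable (surface_measure \<Omega>)"
        using SM(1) measurable_cong_sets by metis
      have "AE x in surface_measure \<Omega>. x \<in> regular_boundary \<Omega>"
      proof (rule AE_I[where N="- regular_boundary \<Omega>"])
        show "- regular_boundary \<Omega> \<in> sets (surface_measure \<Omega>)" using SM(1) regular_boundary_borel[of \<Omega>] by simp
      qed (use SM(2) in auto)
      then show "AE x in surface_measure \<Omega>. (\<Sum>k\<in>UNIV. outward_normal \<Omega> x $ k * Y k x * indicator (regular_boundary \<Omega>) x) = T x * indicator (frontier \<Omega>) x"
      proof eventually_elim
        case (elim x)
        then have "x \<in> frontier \<Omega>" by (auto simp: regular_boundary_def)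
        then have "(\<Sum>k\<in>UNIV. outward_normal \<Omega> x $ k * Y k x) = T x" using bd[OF elim] TF by presburger
        then show ?case using \<open>x \<in> frontier \<Omega>\<close> elim by simp
      qed
    qed
    finally show ?thesis unfolding set_integral_eq .
  qed

  have "(\<lambda>t. LINT x:\<Omega>|lborel.
             t * energy_density \<Omega> C F u t x
             + (\<Sum>i\<in>UNIV. \<Sum>k\<in>UNIV. deriv_t \<Omega> u t x $ i * deriv_x \<Omega> k u t x $ i * x $ k)
             + (real CARD('n) - 1) / 2 * (\<Sum>i\<in>UNIV. u t x $ i * deriv_t \<Omega> u t x $ i)) = (\<lambda>t. LINT x:\<Omega>|lborel. I t x)"
    unfolding energy_density_def Wel I_def Q_def p_def q_def a_def n_def ..
  moreover have "(\<lambda>x. (real CARD('n) - 1) / 2 * (\<Sum>k\<in>UNIV. u t x $ k * partial_deriv k F (u t x))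
               - (real CARD('n) + 1) * F (u t x)) = R"
    unfolding R_def p_def f_def n_def grad_def by simp
  ultimately show ?thesis
    using deriv unfolding Jint sint T_def by (simp add: add.commute)
qed

end
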